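(* Consider the MTLS problem with the data, standing assumptions and notation given in the context, and assume that one of the genericity conditions (G1) or (G2) of the context holds. Let $x=x_{\rm M}\neq0$ be the exact MTLS solution and $r=Ax-b$. Let $[A,b]$ be perturbed to $[A+\Delta A,\,b+\Delta b]$ with $\|[\Delta A,\Delta b]\|_F$ small enough, let $\hat x$ be the solution of the perturbed MTLS problem (the same problem with data $[A+\Delta A,\,b+\Delta b]$), and let $\Delta x=\hat x-x$. Then, to first order, $$\frac{\|\Delta x\|_2}{\|x\|_2}\lesssim\kappa_b\frac{\|\Delta b\|_2}{\|b\|_2}+\kappa_A\frac{\|\Delta A\|_2}{\|A\|_2},$$ that is, the left-hand side is at most the right-hand side plus a term $\mathcal{O}(\|[\Delta A,\Delta b]\|_F^2)$ as $\|[\Delta A,\Delta b]\|_F\to0$, where $$\kappa_b=\frac{\|b\|_2}{\|x\|_2}\big\|(A^TA-\tilde\sigma_{n_2+1}^2W)^{-1}A^T\big\|_2,$$ $$\kappa_A=\frac{\|A\|_2}{\|x\|_2}\Big(\|r\|_2\big\|(A^TA-\tilde\sigma_{n_2+1}^2W)^{-1}\big\|_2+\|x\|_2\big\|(A^TA-\tilde\sigma_{n_2+1}^2W)^{-1}A^T\big\|_2\Big).$$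
   Context: Data and standing assumptions: $A\in\mathbb{R}^{m\times n}$, $m\ge n$, has full column rank, $b\in\mathbb{R}^m$, and $Ax=b$ is not consistent. $A=[A_1,A_2]$ with $A_1\in\mathbb{R}^{m\times n_1}$ (columns known exactly), $A_2\in\mathbb{R}^{m\times n_2}$, $n_1+n_2=n$; vectors $x=[x_1^T,x_2^T]^T$ and perturbed matrices are partitioned conformally. The MTLS problem is $\min_{E_2,f}\|[E_2,f]\|_F$ subject to $A_1x_1+(A_2+E_2)x_2=b+f$. An MTLS solution is a vector $x\in\mathbb{R}^n$ satisfying the constraint for some $(E_2,f)$ attaining the minimum over all triples $(E_2,f,x)$ satisfying the constraint; it is denoted $x_{\rm M}$ when unique. The perturbation $\Delta A\in\mathbb{R}^{m\times n}$ may affect all columns of $A$, and for $\|[\Delta A,\Delta b]\|_F$ small enough the perturbed MTLS problem has a unique solution. QR factorization: for an orthogonal $Q\in\mathbb{R}^{m\times m}$, $Q^T[A_1,A_2,b]=\begin{bmatrix}R_{11}&R_{12}&R_{1b}\\0&R_{22}&R_{2b}\end{bmatrix}$, upper triangular, with row blocks of sizes $n_1$, $m-n_1$ and column blocks of sizes $n_1,n_2,1$. Put $W=\mathrm{diag}(O_{n_1},I_{n_2})$, $\tilde W=\mathrm{diag}(W,1)$, $\tilde A=[A,b]$, and $\tilde\sigma_{n_2+1}=\sigma_{n_2+1}([R_{22},R_{2b}])$. Genericity conditions: (G1) $\sigma_{n_2}(R_{22})>\sigma_{n_2+1}([R_{22},R_{2b}])>0$; (G2) $\lambda_n(A^TA,W)>\lambda_{n+1}(\tilde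 A^T\tilde A,\tilde W)$. Here $\sigma_i$ is the $i$-th largest singular value (if $n_2=0$, read $\sigma_0=+\infty$), and $\lambda_i(M,N)$ is the $i$-th largest generalized eigenvalue of the pair $(M,N)$, infinite eigenvalues (arising when $N$ is singular) being counted first. One has $\tilde\sigma_{n_2+1}^2=\lambda_{n+1}(\tilde A^T\tilde A,\tilde W)$, and under (G1) or (G2) the MTLS solution is unique and given by $x_{\rm M}=(A^TA-\tilde\sigma_{n_2+1}^2W)^{-1}A^Tb$. Notation: $\|\cdot\|_2$ of a matrix is the spectral norm, $\|\cdot\|_F$ the Frobenius norm. *)

theory Defs
  imports
    "Jordan_Normal_Form.Char_Poly"
    "Jordan_Normal_Form.DL_Rank"
    "Jordan_Normal_Form.Gauss_Jordan_Elimination"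
    "HOL-Library.Extended_Real"
begin

definition append_cols :: "'a::zero mat \<Rightarrow> 'a mat \<Rightarrow> 'a mat" (infixr \<open>@\<^sub>c\<close> 65) where
  "A @\<^sub>c B = four_block_mat A B (0\<^sub>m 0 (dim_col A)) (0\<^sub>m 0 (dim_col B))"

definition col_mat :: "'a vec \<Rightarrow> 'a mat" where
  "col_mat v = mat_of_cols (dim_vec v) [v]"

definition vnorm2 :: "real vec \<Rightarrow> real" where
  "vnorm2 v = sqrt (v \<bullet> v)"

definition frobenius_norm :: "real mat \<Rightarrow> real" where
  "frobenius_norm M = sqrt (\<Sum>i<dim_row M. \<Sum>j<dim_col M. (M $$ (i, j))\<^sup>2)"

definition spectral_norm :: "real mat \<Rightarrow> real" where
  "spectral_norm M =
    (SUP v \<in> {v \<in> carrier_vec (dim_col M). vnorm2 v \<le> 1}. vnorm2 (M *\<^sub>v v))"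

definition mat_inv :: "'a::field mat \<Rightarrow> 'a mat" where
  "mat_inv M = the (mat_inverse M)"

text \<open>The library predicate \<open>upper_triangular\<close> reads entries outside the matrix when there
  are more rows than columns, so the rectangular case needs the additional column bound.\<close>

definition upper_triangular_rect :: "'a::zero mat \<Rightarrow> bool" where
  "upper_triangular_rect M \<longleftrightarrow> (\<forall>i < dim_row M. \<forall>j < dim_col M. j < i \<longrightarrow> M $$ (i, j) = 0)"

text \<open>The real roots of a polynomial, with multiplicity, in decreasing order (counted from 0).\<close>

definition roots_desc :: "real poly \<Rightarrow> real list" where
  "roots_desc p = rev (sorted_list_of_multiset (proots p))"

text \<open>The \<open>i\<close>-th largest singular value, counted from 1, for
  \<open>1 \<le> i \<le> min (dim_row M) (dim_col M)\<close>, with the convention that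
  the 0-th one is infinite.\<close>

definition sing_val :: "nat \<Rightarrow> real mat \<Rightarrow> ereal" where
  "sing_val i M =
    (if i = 0 then \<infinity> else ereal (sqrt (roots_desc (char_poly (M\<^sup>T * M)) ! (i - 1))))"

definition pencil_poly :: "real mat \<Rightarrow> real mat \<Rightarrow> real poly" where
  "pencil_poly M N = det (mat (dim_row M) (dim_col M) (\<lambda>ij. [: M $$ ij, - (N $$ ij) :]))"

text \<open>The \<open>i\<close>-th largest generalized eigenvalue (counted from 1) of a pair of square matrices of
  order \<open>k\<close> whose pencil polynomial \<open>det (M - \<lambda> N)\<close> is nonzero and has
  only real roots; this is the case for \<open>M\<close> symmetric positive definite and \<open>N\<close> symmetric.
  The finite eigenvalues are these roots, and infinity is an eigenvalue of multiplicity \<open>k\<close>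
  minus the degree; it is listed first.\<close>

definition gen_eigval :: "nat \<Rightarrow> real mat \<Rightarrow> real mat \<Rightarrow> ereal" where
  "gen_eigval i M N =
    (let p = pencil_poly M N; k = dim_row M - degree p
     in if i \<le> k then \<infinity> else ereal (roots_desc p ! (i - k - 1)))"

definition mtls_feasible ::
  "real mat \<Rightarrow> real mat \<Rightarrow> real vec \<Rightarrow> real mat \<Rightarrow> real vec \<Rightarrow> real vec \<Rightarrow> bool" where
  "mtls_feasible A1 A2 b E2 f x \<longleftrightarrow>
    E2 \<in> carrier_mat (dim_row A2) (dim_col A2) \<and>
    f \<in> carrier_vec (dim_vec b) \<and>
    x \<in> carrier_vec (dim_col A1 + dim_col A2) \<and>
    A1 *\<^sub>v vec_first x (dim_col A1) + (A2 + E2) *\<^sub>v vec_last x (dim_col A2) = b + f"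

definition mtls_solution :: "real mat \<Rightarrow> real mat \<Rightarrow> real vec \<Rightarrow> real vec \<Rightarrow> bool" where
  "mtls_solution A1 A2 b x \<longleftrightarrow>
    (\<exists>E2 f. mtls_feasible A1 A2 b E2 f x \<and>
      (\<forall>E2' f' x'. mtls_feasible A1 A2 b E2' f' x' \<longrightarrow>
        frobenius_norm (E2 @\<^sub>c col_mat f) \<le> frobenius_norm (E2' @\<^sub>c col_mat f')))"

end

theory Submission
  imports Defs "HOL-Analysis.Convex" "HOL-Library.Poly_Mapping"
begin

text \<open>
  For a fixed \<open>x\<close> the cheapest correction \<open>[E, f]\<close> that makes the mixed system hold is of rank one
  and costs the quotient \<open>\<rho>(x) = |A x - b|^2 / (1 + |x2|^2)\<close>, so an MTLS solution is a minimizer of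
  \<open>\<rho>\<close> (\<open>mtls_solution_iff\<close>). The triangular factor shows that the minimum is \<open>\<sigma>^2\<close>
  (\<open>residual_low\<close>, \<open>residual_attained\<close>) and that the first genericity condition makes
  \<open>H = A^T A - \<sigma>^2 W\<close> positive definite (\<open>H_positive\<close>). The second condition comes down to the first:
  the pencils \<open>(A^T A, W)\<close> and \<open>([A, b]^T [A, b], W~)\<close> are congruent to block diagonal ones, whose finite
  eigenvalues are the squared singular values of \<open>R22\<close> and \<open>[R22, R2b]\<close> (\<open>gen_eigval_triangular\<close>).

  Write \<open>\<mu> = \<sigma>^2\<close>, \<open>r = A x - b\<close>, \<open>e = \<Delta>A x - \<Delta>b\<close>, and let \<open>d\<close> and \<open>\<Delta>\<mu>\<close> be the changes of the
  minimizer and of the minimum. Subtracting the stationarity equation \<open>A^T r = \<mu> W x\<close> from the perturbed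
  one gives
  \<open>H d = - \<Delta>A^T r - A^T e + \<Delta>\<mu> W x\<close> up to second order. The last term has no counterpart in the
  claimed bound, but it does not enlarge it: since \<open>x\<close> is stationary,
  \<open>\<Delta>\<mu> = 2 <r, e> / (1 + |W x|^2)\<close> up to second order, and with \<open>\<mu> W x = A^T r\<close> and
  \<open>|r|^2 = \<mu> (1 + |W x|^2)\<close> the last two terms combine to \<open>- A^T (e - 2 (<r, e> / |r|^2) r)\<close>. The
  vector in brackets is the Householder reflection of \<open>e\<close> along \<open>r\<close> and has the norm of \<open>e\<close>. Applying
  \<open>H^-1\<close> leaves the two condition numbers (\<open>first_order_bound\<close>).

  The perturbed minimizer exists because coercivity of the form \<open>|A v|^2 - t |W v|^2\<close> survives a small change
  of \<open>A\<close> and \<open>t\<close> (\<open>A'_coercive\<close>), and coercivity at some \<open>t\<close> not below the infimum already forces a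
  unique minimizer (\<open>minimizer_exists_unique\<close>).

  This analysis is carried out in real inner product spaces, where it does not depend on dimensions. Matrices
  of all sizes enter as operators on the single space of finitely supported real sequences, in which
  vectors of length \<open>n\<close> form a finite-dimensional subspace.
\<close>

(* Inner products of the type class and of vectors of a given length share one infix symbol. *)
unbundle no inner_syntax
hide_const (open) VectorSpace.subspace

section \<open>Finitely supported families as an inner product space\<close>

instantiation poly_mapping :: (type, real_vector) real_vector
begin

lift_definition scaleR_poly_mapping :: "real \<Rightarrow> ('a \<Rightarrow>\<^sub>0 'b) \<Rightarrow> 'a \<Rightarrow>\<^sub>0 'b"
  is "\<lambda>c f k. c *\<^sub>R f k"
  by (rule finite_subset[rotated]) auto

instance
  by intro_classes (transfer, simp add: fun_eq_iff scaleR_add_right scaleR_add_left)+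

end

instantiation poly_mapping :: (type, real_inner) real_inner
begin

definition inner_poly_mapping_def:
  "inner f (g :: 'a \<Rightarrow>\<^sub>0 'b) = (\<Sum>k\<in>Poly_Mapping.keys f. inner (Poly_Mapping.lookup f k) (Poly_Mapping.lookup g k))"

definition norm_poly_mapping_def:
  "norm (f :: 'a \<Rightarrow>\<^sub>0 'b) = sqrt (inner f f)"

definition sgn_poly_mapping_def:
  "sgn (f :: 'a \<Rightarrow>\<^sub>0 'b) = f /\<^sub>R norm f"

definition dist_poly_mapping_def:
  "dist f (g :: 'a \<Rightarrow>\<^sub>0 'b) = norm (f - g)"

definition uniformity_poly_mapping_def:
  "uniformity = (INF e\<in>{0<..}. principal {(f, g :: 'a \<Rightarrow>\<^sub>0 'b). dist f g < e})"

definition open_poly_mapping_def: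
  "open (U :: ('a \<Rightarrow>\<^sub>0 'b) set) \<longleftrightarrow> (\<forall>f\<in>U. eventually (\<lambda>(f', g). f' = f \<longrightarrow> g \<in> U) uniformity)"

lemma inner_poly_mapping_superset:
  fixes f g :: "'a \<Rightarrow>\<^sub>0 'b"
  assumes "finite K" "Poly_Mapping.keys f \<subseteq> K"
  shows "inner f g = (\<Sum>k\<in>K. inner (Poly_Mapping.lookup f k) (Poly_Mapping.lookup g k))"
  unfolding inner_poly_mapping_def
  by (rule sum.mono_neutral_left) (use assms in \<open>auto simp: in_keys_iff\<close>)

instance
proof
  fix f g h :: "'a \<Rightarrow>\<^sub>0 'b" and c :: real
  define K where "K = Poly_Mapping.keys f \<union> Poly_Mapping.keys g"
  have K: "finite K" "Poly_Mapping.keys f \<subseteq> K" "Poly_Mapping.keys g \<subseteq> K" "Poly_Mapping.keys (f + g) \<subseteq> K"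
    unfolding K_def using keys_add[of f g] by auto
  have Kc: "Poly_Mapping.keys (c *\<^sub>R f) \<subseteq> K"
    using K(2) by (auto simp: in_keys_iff scaleR_poly_mapping.rep_eq)
  show "inner f g = inner g f"
    by (simp add: inner_poly_mapping_superset[of K] K inner_commute)
  show "inner (f + g) h = inner f h + inner g h"
    by (simp add: inner_poly_mapping_superset[of K] K lookup_add inner_add_left sum.distrib)
  show "inner (c *\<^sub>R f) g = c * inner f g"
    by (simp add: inner_poly_mapping_superset[of K] K Kc scaleR_poly_mapping.rep_eq sum_distrib_left)
  show "0 \<le> inner f f"
    unfolding inner_poly_mapping_def by (simp add: sum_nonneg)
  show "(inner f f = 0) = (f = 0)"
    unfolding inner_poly_mapping_def
    by (subst sum_nonneg_eq_0_iff) (auto simp: in_keys_iff intro!: poly_mapping_eqI)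
qed (rule norm_poly_mapping_def sgn_poly_mapping_def dist_poly_mapping_def
  uniformity_poly_mapping_def open_poly_mapping_def)+

end

section \<open>Symmetric forms on finite-dimensional subspaces\<close>

text \<open>A finite Parseval frame replaces a basis here: it expands vectors by inner products, which gives norm
bounds for linear maps without any compactness argument.\<close>

definition finite_dim_subspace :: "'a::real_inner set \<Rightarrow> bool" where
  "finite_dim_subspace X \<longleftrightarrow> subspace X \<and>
    (\<exists>B. finite B \<and> B \<subseteq> X \<and> (\<forall>u\<in>X. u = (\<Sum>e\<in>B. inner e u *\<^sub>R e)))"

text \<open>A basis of \<open>X\<close> is mapped to an independent set of the same cardinality inside \<open>X\<close>; a vector outside its
span would yield more independent vectors than the basis has elements.\<close>

lemma injective_on_finite_dim_imp_surjective:
  fixes X :: "'a::real_inner set"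
  assumes X: "finite_dim_subspace X" and T: "linear T" "T ` X \<subseteq> X"
    and inj: "\<And>v. v \<in> X \<Longrightarrow> T v = 0 \<Longrightarrow> v = 0"
  shows "T ` X = X"
proof -
  from X obtain B0 where sub: "subspace X" and B0: "finite B0" "B0 \<subseteq> X"
    "\<And>u. u \<in> X \<Longrightarrow> u = (\<Sum>e\<in>B0. inner e u *\<^sub>R e)"
    unfolding finite_dim_subspace_def by auto
  obtain B where B: "B \<subseteq> B0" "independent B" "B0 \<subseteq> span B"
    using maximal_independent_subset[of B0] by auto
  have "X \<subseteq> span B0"
  proof
    fix u assume "u \<in> X"
    have "(\<Sum>e\<in>B0. inner e u *\<^sub>R e) \<in> span B0"
      by (intro span_sum span_scale span_base)
    then show "u \<in> span B0" using B0(3)[OF \<open>u \<in> X\<close>, symmetric] by simp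
  qed
  also have "span B0 \<subseteq> span B"
    using B(3) by (simp add: span_minimal)
  finally have XB: "X = span B"
    using B(1) B0(2) sub by (metis order.trans span_minimal subset_antisym)
  have fin: "finite B" using B(1) B0(1) finite_subset by auto
  have inj_on: "inj_on T (span B)"
    unfolding XB[symmetric]
  proof (rule inj_onI)
    fix u v assume uv: "u \<in> X" "v \<in> X" "T u = T v"
    then have "T (u - v) = 0" by (simp add: linear_diff[OF T(1)])
    moreover have "u - v \<in> X" using uv sub by (simp add: subspace_diff)
    ultimately show "u = v" using inj by fastforce
  qed
  have ind: "independent (T ` B)"
    using linear_independent_injective_image[OF T(1) B(2) inj_on] .
  have card: "card (T ` B) = card B"
    using inj_on by (meson card_image inj_on_subset span_superset)
  have TB: "T ` B \<subseteq> X" using T(2) XB span_superset by blast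
  have "X \<subseteq> span (T ` B)"
  proof
    fix w assume w: "w \<in> X"
    show "w \<in> span (T ` B)"
    proof (rule ccontr)
      assume nw: "w \<notin> span (T ` B)"
      then have ind': "independent (insert w (T ` B))"
        using ind by (simp add: independent_insertI)
      have "insert w (T ` B) \<subseteq> span B" using w TB XB by auto
      then have "card (insert w (T ` B)) \<le> card B"
        using independent_span_bound[OF fin ind'] by simp
      moreover have "w \<notin> T ` B" using nw span_base by blast
      ultimately show False using fin card by simp
    qed
  qed
  then show ?thesis
    using T(2) by (simp add: XB linear_span_image[OF T(1)] subset_antisym)
qed

lemma frame_combination_bound:
  fixes u :: "'a::real_inner" and f :: "'a \<Rightarrow> 'b::real_normed_vector"
  assumes "finite B"
  shows "norm (\<Sum>e\<in>B. inner e u *\<^sub>R f e) \<le> (\<Sum>e\<in>B. norm e * norm (f e)) * norm u"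
proof -
  have "norm (\<Sum>e\<in>B. inner e u *\<^sub>R f e) \<le> (\<Sum>e\<in>B. norm (inner e u *\<^sub>R f e))"
    by (rule norm_sum)
  also have "\<dots> \<le> (\<Sum>e\<in>B. (norm e * norm u) * norm (f e))"
    by (rule sum_mono) (simp add: Cauchy_Schwarz_ineq2 mult_right_mono)
  also have "\<dots> = (\<Sum>e\<in>B. norm e * norm (f e)) * norm u"
    by (simp add: sum_distrib_right sum_distrib_left mult_ac)
  finally show ?thesis .
qed

lemma linear_bounded_on_finite_dim:
  fixes T :: "'a::real_inner \<Rightarrow> 'b::real_normed_vector"
  assumes X: "finite_dim_subspace X" and T: "linear T"
  shows "\<exists>c. \<forall>u\<in>X. norm (T u) \<le> c * norm u"
proof -
  from X obtain B where B: "finite B" "\<And>u. u \<in> X \<Longrightarrow> u = (\<Sum>e\<in>B. inner e u *\<^sub>R e)"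
    unfolding finite_dim_subspace_def by auto
  have "norm (T u) \<le> (\<Sum>e\<in>B. norm e * norm (T e)) * norm u" if "u \<in> X" for u
  proof -
    have "T u = (\<Sum>e\<in>B. inner e u *\<^sub>R T e)"
      by (subst B(2)[OF that]) (simp add: linear_sum[OF T] linear_cmul[OF T])
    then show ?thesis using frame_combination_bound[OF B(1)] by metis
  qed
  then show ?thesis by blast
qed

text \<open>Nonnegativity of the form at \<open>s u + t v\<close>: a quadratic form in \<open>(s, t)\<close> that takes no negative value
has a symmetric matrix with nonnegative determinant.\<close>

lemma psd_form_Cauchy_Schwarz:
  fixes T :: "'a::real_inner \<Rightarrow> 'a"
  assumes X: "subspace X" and T: "linear T"
    and sym: "\<And>u v. u \<in> X \<Longrightarrow> v \<in> X \<Longrightarrow> inner u (T v) = inner (T u) v"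
    and psd: "\<And>u. u \<in> X \<Longrightarrow> 0 \<le> inner u (T u)"
    and u: "u \<in> X" and v: "v \<in> X"
  shows "(inner u (T v))\<^sup>2 \<le> inner u (T u) * inner v (T v)"
proof -
  let ?p = "inner u (T u)" and ?q = "inner v (T v)" and ?c = "inner u (T v)"
  have uv: "inner v (T u) = ?c" using sym[OF u v] by (simp add: inner_commute)
  have quad: "0 \<le> s\<^sup>2 * ?p + 2 * s * t * ?c + t\<^sup>2 * ?q" for s t
  proof -
    have "s *\<^sub>R u + t *\<^sub>R v \<in> X" using X u v by (simp add: subspace_add subspace_scale)
    from psd[OF this] show ?thesis
      by (simp add: linear_add[OF T] linear_cmul[OF T] inner_add_left inner_add_right uv
          algebra_simps power2_eq_square)
  qed
  show ?thesis
  proof (cases "?q = 0")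
    case True
    have "?c = 0"
    proof (rule ccontr)
      assume c: "?c \<noteq> 0"
      have "0 \<le> ?p + 2 * (- (?p + 1) / (2 * ?c)) * ?c"
        using quad[of 1 "- (?p + 1) / (2 * ?c)"] True by simp
      then show False using c by (simp add: field_simps)
    qed
    then show ?thesis using True by simp
  next
    case False
    then have q: "?q > 0" using psd[OF v] by simp
    have "0 \<le> ?q\<^sup>2 * ?p + 2 * ?q * (- ?c) * ?c + (- ?c)\<^sup>2 * ?q"
      by (rule quad)
    also have "\<dots> = ?q * (?p * ?q - ?c\<^sup>2)" by (simp add: algebra_simps power2_eq_square)
    finally show ?thesis using q by (simp add: zero_le_mult_iff)
  qed
qed

text \<open>With \<open>w\<close> a preimage of \<open>v\<close>, bounded by a multiple of \<open>v\<close>, the Cauchy-Schwarz inequality of the form reads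
\<open>|v|^4 = <v, T w>^2 \<le> <v, T v> <w, v>\<close>, and \<open><w, v>\<close> is at most a multiple of \<open>|v|^2\<close>.\<close>

lemma psd_injective_imp_coercive:
  fixes T :: "'a::real_inner \<Rightarrow> 'a"
  assumes X: "finite_dim_subspace X" and T: "linear T" "T ` X \<subseteq> X"
    and sym: "\<And>u v. u \<in> X \<Longrightarrow> v \<in> X \<Longrightarrow> inner u (T v) = inner (T u) v"
    and psd: "\<And>u. u \<in> X \<Longrightarrow> 0 \<le> inner u (T u)"
    and inj: "\<And>v. v \<in> X \<Longrightarrow> T v = 0 \<Longrightarrow> v = 0"
  shows "\<exists>\<alpha>>0. \<forall>v\<in>X. \<alpha> * (norm v)\<^sup>2 \<le> inner v (T v)"
proof -
  from X obtain B where sub: "subspace X" and B: "finite B" "B \<subseteq> X"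
    "\<And>u. u \<in> X \<Longrightarrow> u = (\<Sum>e\<in>B. inner e u *\<^sub>R e)"
    unfolding finite_dim_subspace_def by auto
  have surj: "T ` X = X" by (rule injective_on_finite_dim_imp_surjective[OF X T inj])
  define f where "f e = (SOME w. w \<in> X \<and> T w = e)" for e
  have f: "f e \<in> X" "T (f e) = e" if "e \<in> B" for e
  proof -
    have "\<exists>w. w \<in> X \<and> T w = e" using surj B(2) that by (metis imageE subsetD)
    then have "f e \<in> X \<and> T (f e) = e" unfolding f_def by (rule someI_ex)
    then show "f e \<in> X" "T (f e) = e" by auto
  qed
  define c where "c = (\<Sum>e\<in>B. norm e * norm (f e)) + 1"
  have c: "c > 0" unfolding c_def by (simp add: add_nonneg_pos sum_nonneg)
  have "1 / c * (norm v)\<^sup>2 \<le> inner v (T v)" if v: "v \<in> X" for v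
  proof (cases "v = 0")
    case True
    then show ?thesis by simp
  next
    case False
    define w where "w = (\<Sum>e\<in>B. inner e v *\<^sub>R f e)"
    have w: "w \<in> X" unfolding w_def by (intro subspace_sum subspace_scale sub f)
    have "T w = (\<Sum>e\<in>B. inner e v *\<^sub>R T (f e))"
      unfolding w_def by (simp add: linear_sum[OF T(1)] linear_cmul[OF T(1)])
    also have "\<dots> = v" using f(2) B(3)[OF v, symmetric] by simp
    finally have Tw: "T w = v" .
    have "norm w \<le> (\<Sum>e\<in>B. norm e * norm (f e)) * norm v"
      unfolding w_def by (rule frame_combination_bound[OF B(1)])
    also have "\<dots> \<le> c * norm v" unfolding c_def by (simp add: mult_right_mono)
    finally have nw: "norm w \<le> c * norm v" .
    have "(norm v)\<^sup>2 * (norm v)\<^sup>2 = (inner v (T w))\<^sup>2"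
      by (simp add: Tw power2_norm_eq_inner) (simp add: power2_eq_square)
    also have "\<dots> \<le> inner v (T v) * inner w (T w)"
      by (rule psd_form_Cauchy_Schwarz[OF sub T(1) sym psd v w])
    also have "\<dots> \<le> inner v (T v) * (c * norm v * norm v)"
    proof (rule mult_left_mono[OF _ psd[OF v]])
      have "inner w (T w) \<le> norm w * norm v" by (simp add: Tw norm_cauchy_schwarz)
      also have "\<dots> \<le> c * norm v * norm v" by (simp add: nw mult_right_mono)
      finally show "inner w (T w) \<le> c * norm v * norm v" .
    qed
    finally have "(norm v)\<^sup>2 * (norm v)\<^sup>2 \<le> (inner v (T v) * c) * (norm v)\<^sup>2"
      by (simp add: power2_eq_square mult_ac)
    then have "(norm v)\<^sup>2 \<le> inner v (T v) * c"
      by (rule mult_right_le_imp_le) (use False in simp)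
    then show ?thesis using c by (simp add: divide_le_eq)
  qed
  then show ?thesis using c by (intro exI[of _ "1 / c"]) simp
qed

text \<open>The supremum \<open>\<mu>\<close> of all lower bounds of the Rayleigh quotient is itself one. Were \<open>T - \<mu>\<close> injective,
it would be coercive and \<open>\<mu>\<close> could be increased.\<close>

lemma exists_least_eigenvalue:
  fixes T :: "'a::real_inner \<Rightarrow> 'a"
  assumes X: "finite_dim_subspace X" and ne: "w \<in> X" "w \<noteq> 0"
    and T: "linear T" "T ` X \<subseteq> X"
    and sym: "\<And>u v. u \<in> X \<Longrightarrow> v \<in> X \<Longrightarrow> inner u (T v) = inner (T u) v"
  shows "\<exists>\<mu>. (\<exists>v\<in>X. v \<noteq> 0 \<and> T v = \<mu> *\<^sub>R v) \<and> (\<forall>u\<in>X. \<mu> * (norm u)\<^sup>2 \<le> inner u (T u))"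
proof -
  have sub: "subspace X" using X unfolding finite_dim_subspace_def by auto
  define L where "L = {t. \<forall>u\<in>X. t * (norm u)\<^sup>2 \<le> inner u (T u)}"
  obtain c where c: "\<And>u. u \<in> X \<Longrightarrow> norm (T u) \<le> c * norm u"
    using linear_bounded_on_finite_dim[OF X T(1)] by auto
  have "- c \<in> L"
    unfolding L_def
  proof (intro CollectI ballI)
    fix u assume u: "u \<in> X"
    have "\<bar>inner u (T u)\<bar> \<le> norm u * norm (T u)" by (rule Cauchy_Schwarz_ineq2)
    also have "\<dots> \<le> norm u * (c * norm u)" by (intro mult_left_mono c u) simp
    finally show "- c * (norm u)\<^sup>2 \<le> inner u (T u)" by (simp add: power2_eq_square mult_ac)
  qed
  then have L_ne: "L \<noteq> {}" by auto
  have bdd: "bdd_above L"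
  proof (rule bdd_aboveI)
    fix t assume "t \<in> L"
    then have "t * (norm w)\<^sup>2 \<le> inner w (T w)" using ne unfolding L_def by auto
    then show "t \<le> inner w (T w) / (norm w)\<^sup>2" using ne by (simp add: le_divide_eq)
  qed
  define \<mu> where "\<mu> = Sup L"
  have low: "\<mu> * (norm u)\<^sup>2 \<le> inner u (T u)" if u: "u \<in> X" for u
  proof (cases "u = 0")
    case False
    have "\<mu> \<le> inner u (T u) / (norm u)\<^sup>2"
      unfolding \<mu>_def
    proof (rule cSup_least[OF L_ne])
      fix t assume "t \<in> L"
      then show "t \<le> inner u (T u) / (norm u)\<^sup>2"
        using u False unfolding L_def by (simp add: le_divide_eq)
    qed
    then show ?thesis using False by (simp add: le_divide_eq)
  qed simp
  define S where "S = (\<lambda>u. T u - \<mu> *\<^sub>R u)"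
  have S: "linear S" unfolding S_def using T(1)
    by (intro linearI) (simp_all add: linear_add linear_cmul algebra_simps)
  have SX: "S ` X \<subseteq> X" unfolding S_def using T(2) sub
    by (auto intro!: subspace_diff subspace_scale)
  have S_form: "inner u (S u) = inner u (T u) - \<mu> * (norm u)\<^sup>2" for u
    by (simp add: S_def inner_diff_right power2_norm_eq_inner)
  have "\<exists>v\<in>X. v \<noteq> 0 \<and> T v = \<mu> *\<^sub>R v"
  proof (rule ccontr)
    assume "\<not> ?thesis"
    then have inj: "v = 0" if "v \<in> X" "S v = 0" for v using that unfolding S_def by auto
    have "\<exists>\<alpha>>0. \<forall>v\<in>X. \<alpha> * (norm v)\<^sup>2 \<le> inner v (S v)"
    proof (rule psd_injective_imp_coercive[OF X S SX _ _ inj])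
      show "inner u (S v) = inner (S u) v" if "u \<in> X" "v \<in> X" for u v
        using sym[OF that] by (simp add: S_def inner_diff_right inner_diff_left)
      show "0 \<le> inner u (S u)" if "u \<in> X" for u using low[OF that] S_form by simp
    qed
    then obtain \<alpha> where \<alpha>: "\<alpha> > 0" "\<And>v. v \<in> X \<Longrightarrow> \<alpha> * (norm v)\<^sup>2 \<le> inner v (S v)" by auto
    have "\<mu> + \<alpha> \<in> L" unfolding L_def using \<alpha>(2) S_form by (auto simp: algebra_simps)
    then have "\<mu> + \<alpha> \<le> \<mu>" unfolding \<mu>_def by (rule cSup_upper[OF _ bdd])
    then show False using \<alpha>(1) by simp
  qed
  then show ?thesis using low by auto
qed

section \<open>Minimizers of the residual quotient\<close>

definition adjoint_pair :: "('a::real_inner \<Rightarrow> 'b::real_inner) \<Rightarrow> ('b \<Rightarrow> 'a) \<Rightarrow> bool" where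
  "adjoint_pair A At \<longleftrightarrow> linear A \<and> linear At \<and> (\<forall>u v. inner (A u) v = inner u (At v))"

lemma adjoint_pairD:
  assumes "adjoint_pair A At"
  shows "linear A" "linear At" "inner (A u) v = inner u (At v)"
  using assms unfolding adjoint_pair_def by auto

lemma adjoint_pair_add:
  assumes "adjoint_pair A At" "adjoint_pair D Dt"
  shows "adjoint_pair (\<lambda>u. A u + D u) (\<lambda>v. At v + Dt v)"
  using assms unfolding adjoint_pair_def
  by (auto intro: linear_compose_add simp: inner_add_left inner_add_right)

lemma norm_add_power2: "(norm (u + v))\<^sup>2 = (norm u)\<^sup>2 + 2 * inner u v + (norm v)\<^sup>2"
  for u v :: "'a::real_inner"
  by (simp add: power2_norm_eq_inner inner_add_left inner_add_right inner_commute)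

text \<open>The map is the reflection in the hyperplane orthogonal to \<open>r\<close>. This is what keeps the first-order
change of the minimum from entering the condition numbers.\<close>

lemma norm_Householder_reflection:
  fixes r e :: "'a::real_inner"
  shows "norm (e - (2 * inner r e / (norm r)\<^sup>2) *\<^sub>R r) = norm e"
proof (cases "r = 0")
  case False
  define c where "c = 2 * inner r e / (norm r)\<^sup>2"
  have "(norm (e + (- c) *\<^sub>R r))\<^sup>2 = (norm e)\<^sup>2 - 2 * c * inner r e + c\<^sup>2 * (norm r)\<^sup>2"
    unfolding norm_add_power2 by (simp add: power_mult_distrib inner_commute)
  also have "\<dots> = (norm e)\<^sup>2"
    using False by (simp add: c_def field_simps power2_eq_square)
  finally have "(norm (e - c *\<^sub>R r))\<^sup>2 = (norm e)\<^sup>2" by simp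
  then show ?thesis unfolding c_def by (simp add: power2_eq_iff_nonneg)
qed simp

text \<open>The projection \<open>W\<close> selects the unknowns whose columns may be corrected; for \<open>W = 0\<close> the quotient
below is the squared residual of ordinary least squares, for the projection onto \<open>X\<close> it is the quotient of total least
squares.\<close>

locale mixed_ls =
  fixes X :: "'a::real_inner set" and W :: "'a \<Rightarrow> 'a"
  assumes X: "finite_dim_subspace X"
    and W_lin: "linear W" and W_in: "\<And>u. W u \<in> X"
    and W_proj: "\<And>u v. inner (W u) v = inner (W u) (W v)"
begin

lemma subspace_X: "subspace X"
  using X unfolding finite_dim_subspace_def by auto

lemma inner_W: "inner u (W u) = (norm (W u))\<^sup>2"
  by (metis W_proj inner_commute power2_norm_eq_inner)

lemma norm_W_le: "norm (W u) \<le> norm u"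
proof -
  have "norm (W u) * norm (W u) \<le> norm u * norm (W u)"
    using inner_W[of u] norm_cauchy_schwarz[of u "W u"] by (simp add: power2_eq_square)
  then show ?thesis
    by (cases "W u = 0") (simp_all add: mult_right_le_imp_le)
qed

definition quotient :: "('a \<Rightarrow> 'b::real_inner) \<Rightarrow> 'b \<Rightarrow> 'a \<Rightarrow> real" where
  "quotient A b y = (norm (A y - b))\<^sup>2 / (1 + (norm (W y))\<^sup>2)"

definition minimizer :: "('a \<Rightarrow> 'b::real_inner) \<Rightarrow> 'b \<Rightarrow> 'a \<Rightarrow> bool" where
  "minimizer A b y \<longleftrightarrow> y \<in> X \<and> (\<forall>z\<in>X. quotient A b y \<le> quotient A b z)"

text \<open>Comparing the quotient with a number \<open>t\<close> is a sign condition on a quadratic function, which can be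
expanded exactly.\<close>

definition gap :: "('a \<Rightarrow> 'b::real_inner) \<Rightarrow> 'b \<Rightarrow> real \<Rightarrow> 'a \<Rightarrow> real" where
  "gap A b t y = (norm (A y - b))\<^sup>2 - t * (1 + (norm (W y))\<^sup>2)"

lemma denom_pos: "0 < 1 + (norm (W y))\<^sup>2"
  by (simp add: add_pos_nonneg)

lemma quotient_nonneg: "0 \<le> quotient A b y"
  unfolding quotient_def using denom_pos[of y] by simp

lemma quotient_le_iff: "quotient A b y \<le> t \<longleftrightarrow> gap A b t y \<le> 0"
  unfolding quotient_def gap_def using denom_pos[of y] by (simp add: divide_le_eq)

lemma le_quotient_iff: "t \<le> quotient A b y \<longleftrightarrow> 0 \<le> gap A b t y"
  unfolding quotient_def gap_def using denom_pos[of y] by (simp add: le_divide_eq)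

lemma gap_quotient: "gap A b (quotient A b y) y = 0"
  using quotient_le_iff[of A b y "quotient A b y"] le_quotient_iff[of "quotient A b y" A b y] by simp

text \<open>The stationarity equation removes the linear term of the expansion around \<open>y\<close>.\<close>

lemma gap_expand:
  assumes A: "adjoint_pair A At" and normal: "At (A y - b) = t *\<^sub>R W y"
  shows "gap A b t z = gap A b t y + (norm (A (z - y)))\<^sup>2 - t * (norm (W (z - y)))\<^sup>2"
proof -
  note A = adjoint_pairD[OF A]
  define v where "v = z - y"
  have z: "z = y + v" unfolding v_def by simp
  have "inner (A y - b) (A v) = inner (At (A y - b)) v"
    using A(3)[of v "A y - b"] by (simp add: inner_commute)
  also have "\<dots> = t * inner (W y) (W v)"
    unfolding normal using W_proj[of y v] by simp
  finally have cross: "inner (A y - b) (A v) = t * inner (W y) (W v)" .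
  have "A z - b = (A y - b) + A v" unfolding z by (simp add: linear_add[OF A(1)])
  then have 1: "(norm (A z - b))\<^sup>2 = (norm (A y - b))\<^sup>2 + 2 * (t * inner (W y) (W v)) + (norm (A v))\<^sup>2"
    by (simp only: norm_add_power2 cross)
  have "W z = W y + W v" unfolding z by (simp add: linear_add[OF W_lin])
  then have 2: "(norm (W z))\<^sup>2 = (norm (W y))\<^sup>2 + 2 * inner (W y) (W v) + (norm (W v))\<^sup>2"
    by (simp only: norm_add_power2)
  show ?thesis unfolding gap_def 1 2 v_def[symmetric] by (simp add: algebra_simps)
qed

lemma normal_equation_solvable:
  assumes A: "adjoint_pair A At" and AtX: "\<And>u. At u \<in> X"
    and \<beta>: "0 < \<beta>" and coercive: "\<And>v. v \<in> X \<Longrightarrow> \<beta> * (norm v)\<^sup>2 \<le> (norm (A v))\<^sup>2 - t * (norm (W v))\<^sup>2"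
  shows "\<exists>y\<in>X. At (A y - b) = t *\<^sub>R W y"
proof -
  note A = adjoint_pairD[OF A]
  define T where "T = (\<lambda>v. At (A v) - t *\<^sub>R W v)"
  have T: "linear T" unfolding T_def
    by (intro linearI) (simp_all add: linear_add[OF A(1)] linear_add[OF A(2)] linear_add[OF W_lin]
        linear_cmul[OF A(1)] linear_cmul[OF A(2)] linear_cmul[OF W_lin] algebra_simps)
  have TX: "T ` X \<subseteq> X" unfolding T_def
    by (auto intro!: subspace_diff subspace_scale subspace_X AtX W_in)
  have inj: "v = 0" if v: "v \<in> X" "T v = 0" for v
  proof -
    have "inner v (T v) = (norm (A v))\<^sup>2 - t * (norm (W v))\<^sup>2"
      unfolding T_def by (simp add: inner_diff_right inner_W A(3)[symmetric] power2_norm_eq_inner)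
    then have "\<beta> * (norm v)\<^sup>2 \<le> 0" using coercive[OF v(1)] v(2) by simp
    then show ?thesis using \<beta> by (simp add: mult_le_0_iff)
  qed
  have "T ` X = X" by (rule injective_on_finite_dim_imp_surjective[OF X T TX inj])
  then obtain y where "y \<in> X" "T y = At b" using AtX[of b] by (metis imageE)
  then show ?thesis
    by (intro bexI[of _ y]) (auto simp: T_def linear_diff[OF A(2)] algebra_simps)
qed

text \<open>At the infimum \<open>l\<close> of the quotient, the stationarity equation has a solution \<open>y\<close>, and by coercivity the
gap at \<open>z\<close> exceeds the gap at \<open>y\<close> by at least a multiple of \<open>|z - y|^2\<close>. If the gap at \<open>y\<close> were
positive, the gap would dominate a multiple of \<open>1 + |W z|^2\<close> and the quotient would stay away from \<open>l\<close>.
So \<open>y\<close> attains the infimum, and growth makes it the only point to do so.\<close>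

lemma minimizer_exists_unique:
  assumes A: "adjoint_pair A At" and AtX: "\<And>u. At u \<in> X"
    and \<beta>: "0 < \<beta>" and coercive: "\<And>v. v \<in> X \<Longrightarrow> \<beta> * (norm v)\<^sup>2 \<le> (norm (A v))\<^sup>2 - t * (norm (W v))\<^sup>2"
    and x0: "x0 \<in> X" "quotient A b x0 \<le> t"
  shows "\<exists>!y. minimizer A b y"
    and "minimizer A b y \<Longrightarrow> At (A y - b) = quotient A b y *\<^sub>R W y"
    and "minimizer A b y \<Longrightarrow> quotient A b y \<le> t"
proof -
  define l where "l = Inf (quotient A b ` X)"
  have bdd: "bdd_below (quotient A b ` X)"
    by (rule bdd_belowI[of _ 0]) (auto simp: quotient_nonneg)
  have low: "l \<le> quotient A b z" if "z \<in> X" for z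
    unfolding l_def using that bdd by (intro cInf_lower) auto
  have lt: "l \<le> t" using low[OF x0(1)] x0(2) by simp
  have coercive': "\<beta> * (norm v)\<^sup>2 \<le> (norm (A v))\<^sup>2 - l * (norm (W v))\<^sup>2" if "v \<in> X" for v
    using coercive[OF that] mult_right_mono[OF lt, of "(norm (W v))\<^sup>2"] by simp
  obtain y where y: "y \<in> X" "At (A y - b) = l *\<^sub>R W y"
    using normal_equation_solvable[OF A AtX \<beta> coercive'] by auto
  have grow: "gap A b l y + \<beta> * (norm (z - y))\<^sup>2 \<le> gap A b l z" if z: "z \<in> X" for z
    using gap_expand[OF A y(2), of z] coercive'[of "z - y"] z y(1)
    by (simp add: subspace_diff[OF subspace_X])
  have gap0: "gap A b l y = 0"
  proof (rule ccontr)
    assume "gap A b l y \<noteq> 0"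
    moreover have "0 \<le> gap A b l y" using low[OF y(1)] by (simp add: le_quotient_iff)
    ultimately have c: "0 < gap A b l y" by simp
    \<comment> \<open>uses \<open>1 + |W z|^2 \<le> (1 + 2 |y|^2) + 2 |z - y|^2\<close>: the two arguments of the minimum handle the two summands\<close>
    define \<eta> where "\<eta> = min (gap A b l y / (1 + 2 * (norm y)\<^sup>2)) (\<beta> / 2)"
    have pos: "0 < 1 + 2 * (norm y)\<^sup>2" by (simp add: add_pos_nonneg)
    have \<eta>: "0 < \<eta>" unfolding \<eta>_def using c \<beta> pos by simp
    have "l + \<eta> \<le> quotient A b z" if z: "z \<in> X" for z
    proof -
      have "norm (W z) \<le> norm y + norm (z - y)"
        using norm_W_le[of z] norm_triangle_ineq[of y "z - y"] by simp
      then have "(norm (W z))\<^sup>2 \<le> (norm y + norm (z - y))\<^sup>2" by (simp add: power_mono)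
      also have "\<dots> \<le> 2 * (norm y)\<^sup>2 + 2 * (norm (z - y))\<^sup>2"
        using sum_squares_ge_zero[of "norm y - norm (z - y)" 0]
        by (simp add: power2_eq_square algebra_simps)
      finally have "\<eta> * (1 + (norm (W z))\<^sup>2) \<le> \<eta> * ((1 + 2 * (norm y)\<^sup>2) + 2 * (norm (z - y))\<^sup>2)"
        using \<eta> by (intro mult_left_mono) auto
      also have "\<dots> = \<eta> * (1 + 2 * (norm y)\<^sup>2) + 2 * \<eta> * (norm (z - y))\<^sup>2"
        by (simp add: algebra_simps)
      also have "\<dots> \<le> gap A b l y + \<beta> * (norm (z - y))\<^sup>2"
      proof (rule add_mono)
        have "\<eta> \<le> gap A b l y / (1 + 2 * (norm y)\<^sup>2)" unfolding \<eta>_def by simp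
        then show "\<eta> * (1 + 2 * (norm y)\<^sup>2) \<le> gap A b l y" using pos by (simp add: le_divide_eq)
        have "2 * \<eta> \<le> \<beta>" unfolding \<eta>_def by linarith
        then show "2 * \<eta> * (norm (z - y))\<^sup>2 \<le> \<beta> * (norm (z - y))\<^sup>2" by (simp add: mult_right_mono)
      qed
      also have "\<dots> \<le> gap A b l z" by (rule grow[OF z])
      finally show ?thesis unfolding le_quotient_iff by (simp add: gap_def algebra_simps)
    qed
    then have "l + \<eta> \<le> l" unfolding l_def using x0(1) by (intro cInf_greatest) auto
    then show False using \<eta> by simp
  qed
  have ql: "quotient A b y = l"
    using gap0 low[OF y(1)] quotient_le_iff[of A b y l] by simp
  have min_y: "minimizer A b y" unfolding minimizer_def ql using y(1) low by auto
  have uniq: "z = y" if z: "minimizer A b z" for z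
  proof -
    have zX: "z \<in> X" and "quotient A b z \<le> l"
      using z min_y ql unfolding minimizer_def by auto
    then have "\<beta> * (norm (z - y))\<^sup>2 \<le> 0"
      using grow[OF zX] gap0 by (simp add: quotient_le_iff)
    then show ?thesis using \<beta> by (simp add: mult_le_0_iff)
  qed
  show "\<exists>!y. minimizer A b y" using min_y uniq by blast
  show "At (A y' - b) = quotient A b y' *\<^sub>R W y'" if "minimizer A b y'" for y'
    using uniq[OF that] y(2) ql by simp
  show "quotient A b y' \<le> t" if "minimizer A b y'" for y'
    using uniq[OF that] ql lt by simp
qed

end

section \<open>Perturbation of a minimizer\<close>

lemma norm_triangle_four:
  "norm (- u - v - w + z) \<le> norm u + norm v + norm w + norm z" for u :: "'a::real_normed_vector"
  using norm_triangle_ineq[of "- u - v - w" z] norm_triangle_ineq4[of "- u - v" w]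
    norm_triangle_ineq4[of "- u" v] norm_minus_cancel[of u] by linarith

lemma norm_triangle_six:
  "norm (- u + v - w - t - c + z) \<le> norm u + norm v + norm w + norm t + norm c + norm z"
  for u :: "'a::real_normed_vector"
  using norm_triangle_four[of "u - v" w t "z - c"] norm_triangle_ineq4[of u v] norm_triangle_ineq4[of z c]
  by (simp add: algebra_simps)

lemma eq_add_of_diff_eq: "p = q - s \<Longrightarrow> p = w \<Longrightarrow> q = s + w" for p :: "'a::ab_group_add"
  by simp

text \<open>A minimizer \<open>x\<close> of the quotient with minimum \<open>\<mu>\<close>, and a perturbation of size \<open>\<epsilon>\<close> that is small
relative to the coercivity constant. The bounds on \<open>\<epsilon>\<close> leave half of that constant to the perturbed form: a
quarter is lost to \<open>D\<close>, a quarter to the possible increase of the minimum.\<close>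

locale perturbed_mixed_ls = mixed_ls X W
  for X :: "'a::real_inner set" and W :: "'a \<Rightarrow> 'a" +
  fixes A :: "'a \<Rightarrow> 'b::real_inner" and At :: "'b \<Rightarrow> 'a" and b :: 'b and x :: 'a
    and a \<alpha> \<mu> :: real
    and D :: "'a \<Rightarrow> 'b" and Dt :: "'b \<Rightarrow> 'a" and db :: 'b and \<epsilon> :: real
  assumes A: "adjoint_pair A At" and At_in: "\<And>u. At u \<in> X"
    and a: "\<And>u. norm (A u) \<le> a * norm u" "\<And>u. norm (At u) \<le> a * norm u" "0 \<le> a"
    and \<alpha>: "0 < \<alpha>"
      "\<And>v. v \<in> X \<Longrightarrow> \<alpha> * (norm v)\<^sup>2 \<le> (norm (A v))\<^sup>2 - \<mu> * (norm (W v))\<^sup>2"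
    and x: "minimizer A b x" "quotient A b x = \<mu>"
    and D: "adjoint_pair D Dt" and Dt_in: "\<And>u. Dt u \<in> X"
    and D_bound: "\<And>u. norm (D u) \<le> \<epsilon> * norm u" "\<And>u. norm (Dt u) \<le> \<epsilon> * norm u"
    and db: "norm db \<le> \<epsilon>" and \<epsilon>: "0 \<le> \<epsilon>" "\<epsilon> \<le> 1" "8 * a * \<epsilon> \<le> \<alpha>"
      "4 * (2 * norm (A x - b) * (norm x + 1) + (norm x + 1)\<^sup>2) * \<epsilon> \<le> \<alpha>"
begin

abbreviation "r \<equiv> A x - b"
abbreviation "e \<equiv> D x - db"
abbreviation "A' \<equiv> \<lambda>u. A u + D u"
abbreviation "At' \<equiv> \<lambda>v. At v + Dt v"
abbreviation "b' \<equiv> b + db"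
abbreviation "N \<equiv> 1 + (norm (W x))\<^sup>2"

text \<open>The constants of the estimates below. None of them involves the perturbation, so they are uniform in it:
\<open>s \<epsilon>\<close> bounds the change \<open>e\<close> of the residual at \<open>x\<close>, \<open>\<kappa> \<epsilon>\<close> the increase of the minimum,
\<open>h\<close> and \<open>g\<close> the perturbed minimizer and its residual, \<open>K1 \<epsilon>\<close> the change of the minimum,
\<open>K2 \<epsilon>\<close> that of the minimizer, \<open>K3 \<epsilon>^2\<close> the error of the first-order formula for the change of the
minimum, and \<open>K4 \<epsilon>^2\<close> the second-order part of the linearized stationarity equation.\<close>

definition "s = norm x + 1"
definition "\<kappa> = 2 * norm r * s + s\<^sup>2"
definition "h = (a + 1) * (norm b + 1) / (\<alpha> / 2)"
definition "g = (a + 1) * h + (norm b + 1)"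
definition "K1 = \<kappa> + (2 * g * (h + 1) + (h + 1)\<^sup>2)"
definition "K2 = (norm r + a * s + s + K1 * norm x) / (\<alpha> / 2)"
definition "K3 = s\<^sup>2 + (a + 1)\<^sup>2 * K2\<^sup>2"
definition "K4 = s + K3 * norm x + (2 * a + 1 + K1) * K2"

lemma constants_nonneg: "0 \<le> s" "1 \<le> s" "0 \<le> \<kappa>" "0 \<le> h" "0 \<le> g" "\<kappa> \<le> K1" "0 \<le> K1" "0 \<le> K2" "0 \<le> K3"
proof -
  show s: "0 \<le> s" "1 \<le> s" unfolding s_def by auto
  show \<kappa>: "0 \<le> \<kappa>" unfolding \<kappa>_def using s by simp
  show h: "0 \<le> h" unfolding h_def using a(3) \<alpha>(1) by simp
  show g: "0 \<le> g" unfolding g_def using a(3) h by simp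
  show K1': "\<kappa> \<le> K1" unfolding K1_def using g h by simp
  with \<kappa> show K1: "0 \<le> K1" by simp
  show "0 \<le> K2" unfolding K2_def using a(3) s K1 \<alpha>(1) by simp
  show "0 \<le> K3" unfolding K3_def by simp
qed

lemmas A_adj = adjoint_pairD[OF A]
lemmas D_adj = adjoint_pairD[OF D]
lemmas A'_pair = adjoint_pair_add[OF A D]
lemmas A'_adj = adjoint_pairD[OF A'_pair]

lemma x_in: "x \<in> X"
  using x(1) unfolding minimizer_def by simp

lemma At'_in: "At' u \<in> X"
  by (intro subspace_add[OF subspace_X] At_in Dt_in)

lemma normal_equation: "At r = \<mu> *\<^sub>R W x"
  using minimizer_exists_unique(2)[OF A At_in \<alpha> x_in _ x(1)] x(2) by simp

lemma norm_r: "(norm r)\<^sup>2 = \<mu> * N"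
  using gap_quotient[of A b x] x(2) unfolding gap_def by simp

lemma A'_bound: "norm (A' u) \<le> (a + 1) * norm u"
proof -
  have "norm (A' u) \<le> norm (A u) + norm (D u)" by (rule norm_triangle_ineq)
  also have "\<dots> \<le> a * norm u + 1 * norm u"
    using \<epsilon>(2) by (intro add_mono a order.trans[OF D_bound(1)] mult_right_mono) auto
  finally show ?thesis by (simp add: algebra_simps)
qed

lemma b'_bound: "norm b' \<le> norm b + 1"
  using norm_triangle_ineq[of b db] db \<epsilon>(2) by simp

lemma e_bound: "norm e \<le> s * \<epsilon>"
proof -
  have "norm e \<le> norm (D x) + norm db" by (rule norm_triangle_ineq4)
  also have "\<dots> \<le> \<epsilon> * norm x + \<epsilon>" by (intro add_mono D_bound db)
  finally show ?thesis unfolding s_def by (simp add: algebra_simps)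
qed

lemma A'_residual: "A' x - b' = r + e"
  by simp

lemma \<epsilon>_square: "\<epsilon>\<^sup>2 \<le> \<epsilon>"
  using \<epsilon> by (simp add: power2_eq_square mult_left_le)

lemma residual_x_bound: "(norm (A' x - b'))\<^sup>2 \<le> \<mu> * N + \<kappa> * \<epsilon>"
proof -
  have "inner r e \<le> norm r * norm e" by (rule norm_cauchy_schwarz)
  also have "\<dots> \<le> norm r * (s * \<epsilon>)" by (intro mult_left_mono e_bound) simp
  finally have 1: "inner r e \<le> norm r * s * \<epsilon>" by (simp add: mult_ac)
  have "(norm e)\<^sup>2 \<le> (s * \<epsilon>)\<^sup>2" by (intro power_mono e_bound) simp
  also have "\<dots> \<le> s\<^sup>2 * \<epsilon>" unfolding power_mult_distrib by (intro mult_left_mono \<epsilon>_square) simp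
  finally have 2: "(norm e)\<^sup>2 \<le> s\<^sup>2 * \<epsilon>" .
  have "(norm (A' x - b'))\<^sup>2 = \<mu> * N + 2 * inner r e + (norm e)\<^sup>2"
    unfolding A'_residual norm_add_power2 norm_r ..
  also have "\<dots> \<le> \<mu> * N + \<kappa> * \<epsilon>"
    using 1 2 unfolding \<kappa>_def by (simp add: algebra_simps)
  finally show ?thesis .
qed

lemma quotient_x_bound: "quotient A' b' x \<le> \<mu> + \<kappa> * \<epsilon>"
proof -
  have "0 \<le> \<kappa> * \<epsilon> * (norm (W x))\<^sup>2" using constants_nonneg \<epsilon> by simp
  then show ?thesis
    unfolding quotient_le_iff gap_def using residual_x_bound by (simp add: algebra_simps)
qed

text \<open>The cross term \<open>2 <A v, D v>\<close> and the increase of \<open>t\<close> each cost at most a quarter of \<open>\<alpha>\<close>.\<close>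

lemma A'_coercive:
  assumes v: "v \<in> X" and t: "t \<le> \<mu> + \<kappa> * \<epsilon>"
  shows "\<alpha> / 2 * (norm v)\<^sup>2 \<le> (norm (A' v))\<^sup>2 - t * (norm (W v))\<^sup>2"
proof -
  have "\<bar>inner (A v) (D v)\<bar> \<le> norm (A v) * norm (D v)" by (rule Cauchy_Schwarz_ineq2)
  also have "\<dots> \<le> (a * norm v) * (\<epsilon> * norm v)"
    using a(3) by (intro mult_mono a D_bound) auto
  finally have "- (2 * a * \<epsilon> * (norm v)\<^sup>2) \<le> 2 * inner (A v) (D v)"
    by (simp add: power2_eq_square mult_ac abs_le_iff)
  moreover have "2 * a * \<epsilon> * (norm v)\<^sup>2 \<le> \<alpha> / 4 * (norm v)\<^sup>2"
    using \<epsilon>(3) by (intro mult_right_mono) auto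
  moreover have "(norm (A' v))\<^sup>2 = (norm (A v))\<^sup>2 + 2 * inner (A v) (D v) + (norm (D v))\<^sup>2"
    by (rule norm_add_power2)
  moreover have "t * (norm (W v))\<^sup>2 \<le> \<mu> * (norm (W v))\<^sup>2 + \<alpha> / 4 * (norm v)\<^sup>2"
  proof -
    have "4 * \<kappa> * \<epsilon> \<le> \<alpha>" using \<epsilon>(4) unfolding \<kappa>_def s_def .
    then have "t \<le> \<mu> + \<alpha> / 4" using t by linarith
    then have "t * (norm (W v))\<^sup>2 \<le> (\<mu> + \<alpha> / 4) * (norm (W v))\<^sup>2" by (rule mult_right_mono) simp
    moreover have "\<alpha> / 4 * (norm (W v))\<^sup>2 \<le> \<alpha> / 4 * (norm v)\<^sup>2"
      using \<alpha>(1) by (intro mult_left_mono power_mono norm_W_le) auto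
    ultimately show ?thesis by (simp add: algebra_simps)
  qed
  moreover have "0 \<le> (norm (D v))\<^sup>2" by simp
  moreover note \<alpha>(2)[OF v]
  ultimately show ?thesis by linarith
qed

lemma half_\<alpha>_pos: "0 < \<alpha> / 2"
  using \<alpha>(1) by simp

lemma A'_coercive_top:
  "v \<in> X \<Longrightarrow> \<alpha> / 2 * (norm v)\<^sup>2 \<le> (norm (A' v))\<^sup>2 - (\<mu> + \<kappa> * \<epsilon>) * (norm (W v))\<^sup>2"
  by (rule A'_coercive) simp_all

lemma perturbed_minimizer:
  shows "\<exists>!y. minimizer A' b' y"
    and "minimizer A' b' y \<Longrightarrow> At' (A' y - b') = quotient A' b' y *\<^sub>R W y"
    and "minimizer A' b' y \<Longrightarrow> quotient A' b' y \<le> \<mu> + \<kappa> * \<epsilon>"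
  by (rule minimizer_exists_unique[OF A'_pair At'_in half_\<alpha>_pos A'_coercive_top x_in quotient_x_bound];
      assumption)+

context
  fixes y \<mu>'
  assumes y: "minimizer A' b' y" and \<mu>': "\<mu>' = quotient A' b' y"
begin

abbreviation "d \<equiv> y - x"
abbreviation "T' v \<equiv> At' (A' v) - \<mu>' *\<^sub>R W v"

lemma y_in: "y \<in> X"
  using y unfolding minimizer_def by simp

lemma d_in: "d \<in> X"
  by (intro subspace_diff[OF subspace_X] y_in x_in)

lemma \<mu>'_le: "\<mu>' \<le> \<mu> + \<kappa> * \<epsilon>"
  using perturbed_minimizer(3)[OF y] \<mu>' by simp

lemma normal_equation': "At' (A' y - b') = \<mu>' *\<^sub>R W y"
  using perturbed_minimizer(2)[OF y] \<mu>' by simp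

lemma T'_linear: "linear (\<lambda>v. T' v)"
  by (intro linearI)
    (simp_all add: linear_add[OF A_adj(1)] linear_add[OF A_adj(2)] linear_add[OF D_adj(1)]
      linear_add[OF D_adj(2)] linear_add[OF W_lin] linear_cmul[OF A_adj(1)] linear_cmul[OF A_adj(2)]
      linear_cmul[OF D_adj(1)] linear_cmul[OF D_adj(2)] linear_cmul[OF W_lin] algebra_simps)

lemma inner_T': "inner v (T' v) = (norm (A' v))\<^sup>2 - \<mu>' * (norm (W v))\<^sup>2"
proof -
  have "inner v (At' (A' v)) = inner (A' v) (A' v)" by (rule A'_adj(3)[symmetric])
  then show ?thesis by (simp only: inner_diff_right inner_scaleR_right inner_W power2_norm_eq_inner)
qed

text \<open>Coercivity bounds the inverse of \<open>T'\<close>, which turns stationarity equations into norm estimates.\<close>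

lemma norm_le_norm_T':
  assumes v: "v \<in> X"
  shows "\<alpha> / 2 * norm v \<le> norm (T' v)"
proof (cases "v = 0")
  case False
  have "\<alpha> / 2 * norm v * norm v \<le> inner v (T' v)"
    using A'_coercive[OF v \<mu>'_le] unfolding inner_T' by (simp add: power2_eq_square)
  also have "\<dots> \<le> norm (T' v) * norm v"
    using norm_cauchy_schwarz[of v "T' v"] by (simp add: mult.commute)
  finally show ?thesis using False by (simp add: mult_right_le_imp_le)
qed simp

lemma T'_y: "T' y = At' b'"
proof -
  have "At' (A' y - b') = At' (A' y) - At' b'" by (rule linear_diff[OF A'_adj(2)])
  then have "At' (A' y) - At' b' = \<mu>' *\<^sub>R W y" using normal_equation' by (rule subst)
  then show ?thesis by (metis add.commute diff_add_cancel add_diff_cancel_left')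
qed

lemma y_bound: "norm y \<le> h"
proof -
  have "\<alpha> / 2 * (norm y)\<^sup>2 \<le> inner y (At' b')"
    using A'_coercive[OF y_in \<mu>'_le] unfolding inner_T'[of y, symmetric] T'_y .
  also have "\<dots> = inner (A' y) b'" by (rule A'_adj(3)[symmetric])
  also have "\<dots> \<le> norm (A' y) * norm b'" by (rule norm_cauchy_schwarz)
  also have "\<dots> \<le> ((a + 1) * norm y) * (norm b + 1)"
    using a(3) by (intro mult_mono A'_bound b'_bound) auto
  finally have "(\<alpha> / 2 * norm y) * norm y \<le> ((a + 1) * (norm b + 1)) * norm y"
    by (simp add: power2_eq_square mult_ac)
  note * = this
  have "\<alpha> / 2 * norm y \<le> (a + 1) * (norm b + 1)"
  proof (cases "y = 0")
    case False
    then show ?thesis using mult_right_le_imp_le[OF *] by simp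
  qed (use a(3) in simp)
  then show ?thesis
    unfolding h_def using \<alpha>(1) by (simp add: le_divide_eq mult.commute)
qed

text \<open>The perturbed minimizer \<open>y\<close> is a competitor for the unperturbed problem; its residual there differs from
the perturbed one by \<open>D y - db\<close>, which is of order \<open>\<epsilon>\<close> because \<open>y\<close> is bounded.\<close>

lemma \<mu>'_ge: "\<mu> - \<mu>' \<le> (2 * g * (h + 1) + (h + 1)\<^sup>2) * \<epsilon>"
proof -
  let ?Ny = "1 + (norm (W y))\<^sup>2"
  define f where "f = D y - db"
  define q where "q = A' y - b'"
  have f: "norm f \<le> (h + 1) * \<epsilon>"
  proof -
    have "norm f \<le> norm (D y) + norm db" unfolding f_def by (rule norm_triangle_ineq4)
    also have "\<dots> \<le> \<epsilon> * h + \<epsilon>"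
      using \<epsilon>(1) by (intro add_mono db order.trans[OF D_bound(1)] mult_left_mono y_bound)
    finally show ?thesis by (simp add: algebra_simps)
  qed
  have q: "norm q \<le> g"
  proof -
    have "norm q \<le> norm (A' y) + norm b'" unfolding q_def by (rule norm_triangle_ineq4)
    also have "\<dots> \<le> (a + 1) * h + (norm b + 1)"
      using a(3) by (intro add_mono b'_bound order.trans[OF A'_bound] mult_left_mono y_bound) auto
    finally show ?thesis unfolding g_def .
  qed
  have "\<mu> * ?Ny \<le> (norm (A y - b))\<^sup>2"
  proof -
    have "\<mu> \<le> quotient A b y" using x y_in unfolding minimizer_def by blast
    then show ?thesis unfolding le_quotient_iff gap_def by simp
  qed
  also have "A y - b = q + (- f)" unfolding q_def f_def by simp
  also have "(norm \<dots>)\<^sup>2 = \<mu>' * ?Ny - 2 * inner q f + (norm f)\<^sup>2"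
    using gap_quotient[of A' b' y] \<mu>' unfolding norm_add_power2 gap_def q_def by simp
  also have "\<dots> \<le> \<mu>' * ?Ny + 2 * g * (h + 1) * \<epsilon> + (h + 1)\<^sup>2 * \<epsilon>"
  proof -
    have "- inner q f \<le> norm q * norm f" using Cauchy_Schwarz_ineq2[of q f] by simp
    also have "\<dots> \<le> g * ((h + 1) * \<epsilon>)"
      using constants_nonneg by (intro mult_mono q f) auto
    finally have 1: "- inner q f \<le> g * ((h + 1) * \<epsilon>)" .
    have "(norm f)\<^sup>2 \<le> ((h + 1) * \<epsilon>)\<^sup>2" by (intro power_mono f) simp
    also have "\<dots> \<le> (h + 1)\<^sup>2 * \<epsilon>"
      unfolding power_mult_distrib by (intro mult_left_mono \<epsilon>_square) simp
    finally show ?thesis using 1 by (simp add: algebra_simps)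
  qed
  finally have main: "(\<mu> - \<mu>') * ?Ny \<le> (2 * g * (h + 1) + (h + 1)\<^sup>2) * \<epsilon>" by (simp add: algebra_simps)
  have rhs: "0 \<le> (2 * g * (h + 1) + (h + 1)\<^sup>2) * \<epsilon>" using constants_nonneg \<epsilon>(1) by simp
  show ?thesis
  proof (cases "\<mu> - \<mu>' \<le> 0")
    case False
    then have "(\<mu> - \<mu>') * 1 \<le> (\<mu> - \<mu>') * ?Ny" by (intro mult_left_mono) auto
    then show ?thesis using main by simp
  qed (use rhs in simp)
qed

lemma \<mu>_change: "\<bar>\<mu>' - \<mu>\<bar> \<le> K1 * \<epsilon>"
proof -
  define Z where "Z = 2 * g * (h + 1) + (h + 1)\<^sup>2"
  have Z: "0 \<le> Z * \<epsilon>" "0 \<le> \<kappa> * \<epsilon>"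
    unfolding Z_def using constants_nonneg \<epsilon>(1) by auto
  have K1: "K1 * \<epsilon> = \<kappa> * \<epsilon> + Z * \<epsilon>"
    unfolding K1_def Z_def by (rule distrib_right)
  have "\<mu>' - \<mu> \<le> \<kappa> * \<epsilon>" using \<mu>'_le by simp
  moreover have "- (\<mu>' - \<mu>) \<le> Z * \<epsilon>" using \<mu>'_ge unfolding Z_def[symmetric] by simp
  ultimately show ?thesis unfolding K1 abs_le_iff using Z by auto
qed

text \<open>Difference of the two stationarity equations, with the perturbed operator applied to the change \<open>d\<close>.\<close>

lemma T'_d: "T' d = - Dt r - At e - Dt e + (\<mu>' - \<mu>) *\<^sub>R W x"
proof -
  have 1: "At' (A' x - b') = At' (A' x) - At' b'" by (rule linear_diff[OF A'_adj(2)])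
  have 2: "At' (A' x - b') = At r + Dt r + At e + Dt e"
    by (simp only: A'_residual linear_add[OF A_adj(2)] linear_add[OF D_adj(2)] add.assoc add.left_commute)
  have 3: "At' (A' x) = At' b' + (At r + Dt r + At e + Dt e)"
    by (rule eq_add_of_diff_eq[OF 1 2])
  have "T' d = T' y - T' x" by (rule linear_diff[OF T'_linear])
  also have "\<dots> = At' b' - (At' b' + (At r + Dt r + At e + Dt e) - \<mu>' *\<^sub>R W x)"
    unfolding T'_y 3 ..
  also have "\<dots> = - Dt r - At e - Dt e + (\<mu>' - \<mu>) *\<^sub>R W x"
    unfolding normal_equation scaleR_left_diff_distrib by simp
  finally show ?thesis .
qed

lemma d_bound: "norm d \<le> K2 * \<epsilon>"
proof -
  have "norm (T' d) \<le> norm (Dt r) + norm (At e) + norm (Dt e) + norm ((\<mu>' - \<mu>) *\<^sub>R W x)"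
    unfolding T'_d
    by (rule norm_triangle_four)
  also have "\<dots> \<le> \<epsilon> * norm r + a * (s * \<epsilon>) + 1 * (s * \<epsilon>) + K1 * \<epsilon> * norm x"
  proof (intro add_mono)
    show "norm (Dt r) \<le> \<epsilon> * norm r" by (rule D_bound)
    show "norm (At e) \<le> a * (s * \<epsilon>)"
      using a(3) by (intro order.trans[OF a(2)] mult_left_mono e_bound)
    show "norm (Dt e) \<le> 1 * (s * \<epsilon>)"
      using \<epsilon> by (intro order.trans[OF D_bound(2)] mult_mono e_bound) auto
    show "norm ((\<mu>' - \<mu>) *\<^sub>R W x) \<le> K1 * \<epsilon> * norm x"
      unfolding norm_scaleR using constants_nonneg \<epsilon>(1) by (intro mult_mono \<mu>_change norm_W_le) auto
  qed
  also have "\<dots> = (norm r + a * s + s + K1 * norm x) * \<epsilon>" by (simp add: algebra_simps)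
  finally have "\<alpha> / 2 * norm d \<le> (norm r + a * s + s + K1 * norm x) * \<epsilon>"
    using norm_le_norm_T'[OF d_in] by linarith
  then show ?thesis
    unfolding K2_def using \<alpha>(1) by (simp add: field_simps)
qed

text \<open>The gap at \<open>x\<close> for the perturbed minimum is expanded in two ways: directly, which produces \<open>\<mu>' - \<mu>\<close> and
\<open><r, e>\<close>, and around the perturbed minimizer, where it is quadratic in \<open>d\<close> and hence of second order.\<close>

lemma \<mu>_first_order:
  "\<bar>\<mu>' - \<mu> - 2 * inner r e / N\<bar> \<le> K3 * \<epsilon>\<^sup>2"
proof -
  define \<eta> where "\<eta> = (norm (A' d))\<^sup>2 - \<mu>' * (norm (W d))\<^sup>2"
  have "gap A' b' \<mu>' x = gap A' b' \<mu>' y + \<eta>"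
    using gap_expand[OF A'_pair normal_equation', of x] linear_neg[OF A'_adj(1), of d]
      linear_neg[OF W_lin, of d] norm_minus_cancel[of "A' d"] norm_minus_cancel[of "W d"]
    unfolding \<eta>_def by (simp only: minus_diff_eq)
  also have "gap A' b' \<mu>' y = 0" unfolding \<mu>' by (rule gap_quotient)
  finally have "(norm (r + e))\<^sup>2 - \<mu>' * N = \<eta>" unfolding gap_def A'_residual by simp
  then have sum: "\<mu> * N + 2 * inner r e + (norm e)\<^sup>2 - \<mu>' * N = \<eta>" unfolding norm_add_power2 norm_r .
  have "2 * inner r e / N * N = 2 * inner r e"
    using denom_pos[of x] by (metis less_numeral_extra(3) nonzero_eq_divide_eq)
  then have eq: "(\<mu>' - \<mu> - 2 * inner r e / N) * N = (norm e)\<^sup>2 - \<eta>"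
    using sum unfolding left_diff_distrib by linarith
  have N: "1 \<le> N" by simp
  have "\<bar>\<mu>' - \<mu> - 2 * inner r e / N\<bar> * 1 \<le> \<bar>\<mu>' - \<mu> - 2 * inner r e / N\<bar> * N"
    by (intro mult_left_mono N) simp
  also have "\<dots> = \<bar>(norm e)\<^sup>2 - \<eta>\<bar>" unfolding eq[symmetric] abs_mult by simp
  also have "\<dots> \<le> (norm e)\<^sup>2 + (norm (A' d))\<^sup>2"
  proof -
    have "0 \<le> \<alpha> / 2 * (norm d)\<^sup>2" using \<alpha>(1) by simp
    also have "\<dots> \<le> \<eta>" unfolding \<eta>_def by (rule A'_coercive[OF d_in \<mu>'_le])
    finally have "0 \<le> \<eta>" .
    moreover have "0 \<le> \<mu>'" unfolding \<mu>' by (rule quotient_nonneg)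
    then have "\<eta> \<le> (norm (A' d))\<^sup>2" unfolding \<eta>_def by simp
    moreover have "0 \<le> (norm e)\<^sup>2" by simp
    ultimately show ?thesis by linarith
  qed
  also have "\<dots> \<le> (s * \<epsilon>)\<^sup>2 + ((a + 1) * (K2 * \<epsilon>))\<^sup>2"
    using a(3) by (intro add_mono power_mono e_bound order.trans[OF A'_bound] mult_left_mono d_bound) auto
  also have "\<dots> = K3 * \<epsilon>\<^sup>2"
    unfolding K3_def power_mult_distrib by (simp only: distrib_right mult.assoc)
  finally show ?thesis unfolding mult_1_right .
qed

text \<open>All terms of the stationarity equation that are products of two small quantities go into \<open>R\<close>. In the rest,
the first-order change of the minimum merges with \<open>e\<close> into its reflection \<open>es\<close>, so that only
\<open>P Dt r\<close> and \<open>P At es\<close> contribute to first order.\<close>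

lemma first_order_bound:
  assumes \<mu>_pos: "0 < \<mu>" and P: "linear P" "P (At (A d) - \<mu> *\<^sub>R W d) = d"
    and p: "\<And>u. norm (P u) \<le> p * norm u" and q: "\<And>u. norm (P (At u)) \<le> q * norm u"
    and nonneg: "0 \<le> p" "0 \<le> q"
    and dA: "\<And>u. norm (D u) \<le> dA * norm u" "\<And>u. norm (Dt u) \<le> dA * norm u"
  shows "norm d \<le> q * norm db + (norm r * p + norm x * q) * dA + p * K4 * \<epsilon>\<^sup>2"
proof -
  define \<delta>2 where "\<delta>2 = \<mu>' - \<mu> - 2 * inner r e / N"
  define R where "R = - Dt e + \<delta>2 *\<^sub>R W x - At (D d) - Dt (A d) - Dt (D d) + (\<mu>' - \<mu>) *\<^sub>R W d"
  define es where "es = e - (2 * inner r e / (norm r)\<^sup>2) *\<^sub>R r"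
  \<comment> \<open>the first-order change of the minimum acts in the direction \<open>W x\<close>, a multiple of \<open>At r\<close>\<close>
  have cancel: "c / (\<mu> * t) * \<mu> = c / t" for c t :: real
    using \<mu>_pos by simp
  have Wx: "(2 * inner r e / N) *\<^sub>R W x = At ((2 * inner r e / (norm r)\<^sup>2) *\<^sub>R r)"
    unfolding linear_cmul[OF A_adj(2)] normal_equation norm_r scaleR_scaleR cancel ..
  have "At (A d) - \<mu> *\<^sub>R W d = T' d - At (D d) - Dt (A d) - Dt (D d) + (\<mu>' - \<mu>) *\<^sub>R W d"
    unfolding linear_add[OF A_adj(2)] linear_add[OF D_adj(2)] by (simp add: algebra_simps)
  also have "T' d = - Dt r - At e - Dt e + (2 * inner r e / N + \<delta>2) *\<^sub>R W x"
    unfolding T'_d \<delta>2_def by simp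
  finally have "At (A d) - \<mu> *\<^sub>R W d = - Dt r - At es + R"
    unfolding R_def es_def scaleR_add_left Wx linear_diff[OF A_adj(2)] by (simp add: algebra_simps)
  then have "d = P (- Dt r - At es + R)" using P(2) by simp
  also have "\<dots> = - P (Dt r) - P (At es) + P R"
    by (simp add: linear_add[OF P(1)] linear_diff[OF P(1)] linear_neg[OF P(1)])
  finally have d: "d = - P (Dt r) - P (At es) - 0 + P R" by simp
  have "norm d \<le> norm (P (Dt r)) + norm (P (At es)) + norm (P R)"
    using norm_triangle_four[of "P (Dt r)" "P (At es)" 0 "P R"] unfolding d[symmetric] by simp
  also have "\<dots> \<le> p * (dA * norm r) + q * (dA * norm x + norm db) + p * (K4 * \<epsilon>\<^sup>2)"
  proof (intro add_mono)
    show "norm (P (Dt r)) \<le> p * (dA * norm r)"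
      by (intro order.trans[OF p] mult_left_mono dA nonneg)
    have "norm es = norm e" unfolding es_def by (rule norm_Householder_reflection)
    also have "\<dots> \<le> norm (D x) + norm db" by (rule norm_triangle_ineq4)
    also have "\<dots> \<le> dA * norm x + norm db" using dA(1) by simp
    finally show "norm (P (At es)) \<le> q * (dA * norm x + norm db)"
      by (intro order.trans[OF q] mult_left_mono nonneg)
    have "norm R \<le> norm (Dt e) + norm (\<delta>2 *\<^sub>R W x) + norm (At (D d)) + norm (Dt (A d))
        + norm (Dt (D d)) + norm ((\<mu>' - \<mu>) *\<^sub>R W d)"
      unfolding R_def by (rule norm_triangle_six)
    also have "\<dots> \<le> \<epsilon> * (s * \<epsilon>) + (K3 * \<epsilon>\<^sup>2) * norm x + a * (\<epsilon> * (K2 * \<epsilon>)) + \<epsilon> * (a * (K2 * \<epsilon>))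
        + 1 * (\<epsilon> * (K2 * \<epsilon>)) + (K1 * \<epsilon>) * (K2 * \<epsilon>)"
    proof (intro add_mono)
      note [simp] = a(3) \<epsilon> constants_nonneg
      have Dd: "norm (D d) \<le> \<epsilon> * (K2 * \<epsilon>)"
        by (intro order.trans[OF D_bound(1)] mult_left_mono d_bound) simp
      show "norm (Dt e) \<le> \<epsilon> * (s * \<epsilon>)"
        by (intro order.trans[OF D_bound(2)] mult_left_mono e_bound) simp
      show "norm (\<delta>2 *\<^sub>R W x) \<le> K3 * \<epsilon>\<^sup>2 * norm x"
        unfolding norm_scaleR \<delta>2_def by (intro mult_mono \<mu>_first_order norm_W_le) auto
      show "norm (At (D d)) \<le> a * (\<epsilon> * (K2 * \<epsilon>))"
        by (intro order.trans[OF a(2)] mult_left_mono Dd) simp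
      show "norm (Dt (A d)) \<le> \<epsilon> * (a * (K2 * \<epsilon>))"
        by (intro order.trans[OF D_bound(2)] order.trans[OF a(1)] mult_left_mono d_bound) auto
      show "norm (Dt (D d)) \<le> 1 * (\<epsilon> * (K2 * \<epsilon>))"
        by (intro order.trans[OF D_bound(2)] mult_mono Dd) auto
      show "norm ((\<mu>' - \<mu>) *\<^sub>R W d) \<le> K1 * \<epsilon> * (K2 * \<epsilon>)"
        unfolding norm_scaleR
        by (intro mult_mono \<mu>_change order.trans[OF norm_W_le] d_bound) auto
    qed
    also have "\<dots> = K4 * \<epsilon>\<^sup>2" unfolding K4_def by (simp add: algebra_simps power2_eq_square)
    finally show "norm (P R) \<le> p * (K4 * \<epsilon>\<^sup>2)"
      by (intro order.trans[OF p] mult_left_mono nonneg)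
  qed
  also have "\<dots> = q * norm db + (norm r * p + norm x * q) * dA + p * K4 * \<epsilon>\<^sup>2"
    by (simp add: algebra_simps)
  finally show ?thesis .
qed

end

end

context mixed_ls
begin

text \<open>The threshold \<open>\<delta>\<close> is chosen such that each of the smallness conditions of \<open>perturbed_mixed_ls\<close> follows from
\<open>\<epsilon> < \<delta>\<close>; the constant \<open>C\<close> is uniform because \<open>K4\<close> does not involve the perturbation.\<close>

theorem minimizer_perturbation:
  fixes A :: "'a \<Rightarrow> 'b::real_inner" and b :: 'b and x :: 'a and P :: "'a \<Rightarrow> 'a"
  assumes A: "adjoint_pair A At" and At_in: "\<And>u. At u \<in> X"
    and a: "\<And>u. norm (A u) \<le> a * norm u" "\<And>u. norm (At u) \<le> a * norm u" "0 \<le> a"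
    and \<alpha>: "0 < \<alpha>"
      "\<And>v. v \<in> X \<Longrightarrow> \<alpha> * (norm v)\<^sup>2 \<le> (norm (A v))\<^sup>2 - \<mu> * (norm (W v))\<^sup>2"
    and x: "minimizer A b x" "quotient A b x = \<mu>" and \<mu>: "0 < \<mu>"
    and P: "linear P" "\<And>v. v \<in> X \<Longrightarrow> P (At (A v) - \<mu> *\<^sub>R W v) = v"
    and p: "\<And>u. norm (P u) \<le> p * norm u" and q: "\<And>u. norm (P (At u)) \<le> q * norm u"
    and nonneg: "0 \<le> p" "0 \<le> q"
  shows "\<exists>\<delta>>0. \<exists>C. \<forall>D Dt db \<epsilon> dA.
    adjoint_pair D Dt \<and> (\<forall>u. Dt u \<in> X) \<and>
    (\<forall>u. norm (D u) \<le> dA * norm u) \<and> (\<forall>u. norm (Dt u) \<le> dA * norm u) \<and>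
    dA \<le> \<epsilon> \<and> norm db \<le> \<epsilon> \<and> \<epsilon> < \<delta> \<longrightarrow>
      (\<exists>!y. minimizer (\<lambda>u. A u + D u) (b + db) y) \<and>
      (\<forall>y. minimizer (\<lambda>u. A u + D u) (b + db) y \<longrightarrow>
        norm (y - x) \<le> q * norm db + (norm (A x - b) * p + norm x * q) * dA + C * \<epsilon>\<^sup>2)"
proof -
  let ?\<kappa> = "2 * norm (A x - b) * (norm x + 1) + (norm x + 1)\<^sup>2"
  define \<delta> where "\<delta> = min 1 (\<alpha> / (8 * a + 4 * ?\<kappa> + 1))"
  have den: "0 < 8 * a + 4 * ?\<kappa> + 1" using a(3) by (simp add: add_nonneg_pos)
  have \<delta>: "0 < \<delta>" unfolding \<delta>_def using \<alpha>(1) den by simp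
  show ?thesis
  proof (rule exI[of _ \<delta>], intro conjI \<delta>, rule exI[of _ "p * perturbed_mixed_ls.K4 A b x a \<alpha>"],
      intro allI impI, elim conjE)
    fix D :: "'a \<Rightarrow> 'b" and Dt and db :: 'b and \<epsilon> dA
    assume D: "adjoint_pair D Dt" and Dt_in: "\<forall>u. Dt u \<in> X"
      and dA: "\<forall>u. norm (D u) \<le> dA * norm u" "\<forall>u. norm (Dt u) \<le> dA * norm u"
      and \<epsilon>: "dA \<le> \<epsilon>" "norm db \<le> \<epsilon>" "\<epsilon> < \<delta>"
    have \<epsilon>0: "0 \<le> \<epsilon>" using \<epsilon>(2) norm_ge_zero[of db] by linarith
    have \<epsilon>1: "\<epsilon> \<le> 1" using \<epsilon>(3) unfolding \<delta>_def by simp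
    have "\<epsilon> \<le> \<alpha> / (8 * a + 4 * ?\<kappa> + 1)" using \<epsilon>(3) unfolding \<delta>_def by simp
    then have bound: "8 * a * \<epsilon> + 4 * ?\<kappa> * \<epsilon> + \<epsilon> \<le> \<alpha>"
      using den by (simp add: le_divide_eq algebra_simps)
    have "0 \<le> 8 * a * \<epsilon>" "0 \<le> 4 * ?\<kappa> * \<epsilon>" using a(3) \<epsilon>0 by auto
    then have small: "8 * a * \<epsilon> \<le> \<alpha>" "4 * ?\<kappa> * \<epsilon> \<le> \<alpha>" using bound \<epsilon>0 by linarith+
    show "(\<exists>!y. minimizer (\<lambda>u. A u + D u) (b + db) y) \<and>
      (\<forall>y. minimizer (\<lambda>u. A u + D u) (b + db) y \<longrightarrow>
        norm (y - x) \<le> q * norm db + (norm (A x - b) * p + norm x * q) * dA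
          + p * perturbed_mixed_ls.K4 A b x a \<alpha> * \<epsilon>\<^sup>2)"
    proof -
      interpret perturbed_mixed_ls X W A At b x a \<alpha> \<mu> D Dt db \<epsilon>
      proof
        show "norm (D u) \<le> \<epsilon> * norm u" for u
          using dA(1) mult_right_mono[OF \<epsilon>(1) norm_ge_zero[of u]] by (meson order.trans)
        show "norm (Dt u) \<le> \<epsilon> * norm u" for u
          using dA(2) mult_right_mono[OF \<epsilon>(1) norm_ge_zero[of u]] by (meson order.trans)
      qed (use A At_in a \<alpha> x(1,2) D Dt_in \<epsilon>(2) \<epsilon>0 \<epsilon>1 small in simp_all)
      show ?thesis
      proof (intro conjI perturbed_minimizer(1) allI impI)
        fix y assume y: "minimizer A' b' y"
        have "y - x \<in> X" by (rule d_in[OF y refl])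
        then show "norm (y - x) \<le> q * norm db + (norm r * p + norm x * q) * dA + p * K4 * \<epsilon>\<^sup>2"
          using dA by (intro first_order_bound[OF y refl \<mu> P(1) P(2) p q nonneg]) auto
      qed
    qed
  qed
qed

end

section \<open>Matrices as operators on finitely supported sequences\<close>

text \<open>A vector is padded with zeros, which preserves inner products. As the padded vectors of all lengths lie
in one inner product space, the results above apply to matrices of arbitrary size.\<close>

lift_definition embed_vec :: "real vec \<Rightarrow> nat \<Rightarrow>\<^sub>0 real"
  is "\<lambda>v i. if i < dim_vec v then v $ i else 0"
  by (rule finite_subset[of _ "{..<dim_vec v}" for v]) auto

definition coord_vec :: "nat \<Rightarrow> (nat \<Rightarrow>\<^sub>0 real) \<Rightarrow> real vec" where
  "coord_vec n u = vec n (Poly_Mapping.lookup u)"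

definition coord_space :: "nat \<Rightarrow> (nat \<Rightarrow>\<^sub>0 real) set" where
  "coord_space n = embed_vec ` carrier_vec n"

text \<open>Coordinates beyond the number of columns are discarded. The operator is thereby linear on the
whole space, and its adjoint there is the operator of the transpose.\<close>

definition mat_op :: "real mat \<Rightarrow> (nat \<Rightarrow>\<^sub>0 real) \<Rightarrow> nat \<Rightarrow>\<^sub>0 real" where
  "mat_op M u = embed_vec (M *\<^sub>v coord_vec (dim_col M) u)"

lemma lookup_embed: "Poly_Mapping.lookup (embed_vec v) i = (if i < dim_vec v then v $ i else 0)"
  by transfer simp

lemma coord_vec_carrier [simp]: "coord_vec n u \<in> carrier_vec n" "dim_vec (coord_vec n u) = n"
  unfolding coord_vec_def by auto

lemma coord_embed: "v \<in> carrier_vec n \<Longrightarrow> coord_vec n (embed_vec v) = v"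
  unfolding coord_vec_def by (intro eq_vecI) (auto simp: lookup_embed)

lemma embed_coord: "u \<in> coord_space n \<Longrightarrow> embed_vec (coord_vec n u) = u"
  unfolding coord_space_def by (auto simp: coord_embed)

lemma embed_in_space: "v \<in> carrier_vec n \<Longrightarrow> embed_vec v \<in> coord_space n"
  unfolding coord_space_def by auto

lemma embed_inj: "v \<in> carrier_vec n \<Longrightarrow> w \<in> carrier_vec n \<Longrightarrow> embed_vec v = embed_vec w \<longleftrightarrow> v = w"
  by (metis coord_embed)

lemma embed_add: "v \<in> carrier_vec n \<Longrightarrow> w \<in> carrier_vec n \<Longrightarrow> embed_vec (v + w) = embed_vec v + embed_vec w"
  by (intro poly_mapping_eqI) (auto simp: lookup_embed lookup_add)

lemma embed_diff: "v \<in> carrier_vec n \<Longrightarrow> w \<in> carrier_vec n \<Longrightarrow> embed_vec (v - w) = embed_vec v - embed_vec w"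
  by (intro poly_mapping_eqI) (auto simp: lookup_embed lookup_minus)

lemma embed_smult: "embed_vec (c \<cdot>\<^sub>v v) = c *\<^sub>R embed_vec v"
  by (intro poly_mapping_eqI) (auto simp: lookup_embed scaleR_poly_mapping.rep_eq)

lemma embed_zero: "embed_vec (0\<^sub>v n) = 0"
  by (intro poly_mapping_eqI) (auto simp: lookup_embed)

lemma inner_embed_left:
  assumes v: "v \<in> carrier_vec n"
  shows "inner (embed_vec v) u = v \<bullet> coord_vec n u"
proof -
  have "Poly_Mapping.keys (embed_vec v) \<subseteq> {0..<n}"
    using v by (auto simp: in_keys_iff lookup_embed split: if_splits)
  from inner_poly_mapping_superset[OF _ this]
  show ?thesis using v unfolding scalar_prod_def coord_vec_def by (auto simp: lookup_embed)
qed

lemma inner_embed: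
  "v \<in> carrier_vec n \<Longrightarrow> w \<in> carrier_vec n \<Longrightarrow> inner (embed_vec v) (embed_vec w) = v \<bullet> w"
  by (simp add: inner_embed_left coord_embed)

lemma norm_embed: "norm (embed_vec v) = vnorm2 v"
  unfolding vnorm2_def norm_eq_sqrt_inner by (simp add: inner_embed[OF carrier_vec_dim_vec carrier_vec_dim_vec])

lemma vnorm2_square: "(vnorm2 v)\<^sup>2 = v \<bullet> v"
  unfolding norm_embed[symmetric] power2_norm_eq_inner by (rule inner_embed) (rule carrier_vec_dim_vec)+

lemma vnorm2_nonneg: "0 \<le> vnorm2 v"
  unfolding norm_embed[symmetric] by simp

lemma vnorm2_eq_0: "v \<in> carrier_vec n \<Longrightarrow> vnorm2 v = 0 \<longleftrightarrow> v = 0\<^sub>v n"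
  unfolding norm_embed[symmetric] by (metis embed_inj embed_zero norm_eq_zero zero_carrier_vec)

lemma coord_add: "coord_vec n (u + v) = coord_vec n u + coord_vec n v"
  unfolding coord_vec_def by (intro eq_vecI) (auto simp: lookup_add)

lemma coord_scaleR: "coord_vec n (c *\<^sub>R u) = c \<cdot>\<^sub>v coord_vec n u"
  unfolding coord_vec_def by (intro eq_vecI) (auto simp: scaleR_poly_mapping.rep_eq)

lemma mat_op_embed: "M \<in> carrier_mat m n \<Longrightarrow> v \<in> carrier_vec n \<Longrightarrow> mat_op M (embed_vec v) = embed_vec (M *\<^sub>v v)"
  unfolding mat_op_def by (auto simp: coord_embed)

lemma mat_op_linear: "linear (mat_op M)"
proof (rule linearI)
  have M: "M \<in> carrier_mat (dim_row M) (dim_col M)" by simp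
  show "mat_op M (u + v) = mat_op M u + mat_op M v" for u v
    unfolding mat_op_def coord_add mult_add_distrib_mat_vec[OF M coord_vec_carrier(1) coord_vec_carrier(1)]
    by (rule embed_add[of _ "dim_row M"]) (auto intro: mult_mat_vec_carrier)
  show "mat_op M (c *\<^sub>R u) = c *\<^sub>R mat_op M u" for c u
    unfolding mat_op_def coord_scaleR mult_mat_vec[OF M coord_vec_carrier(1)] embed_smult ..
qed

lemma mat_op_in: "M \<in> carrier_mat m n \<Longrightarrow> mat_op M u \<in> coord_space m"
  unfolding mat_op_def by (intro embed_in_space) auto

lemma mat_op_adjoint: "adjoint_pair (mat_op M) (mat_op M\<^sup>T)"
  unfolding adjoint_pair_def
proof (intro conjI allI mat_op_linear)
  fix u v
  let ?u = "coord_vec (dim_col M) u" and ?v = "coord_vec (dim_row M) v"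
  have M: "M \<in> carrier_mat (dim_row M) (dim_col M)" by simp
  have "inner (mat_op M u) v = (M *\<^sub>v ?u) \<bullet> ?v"
    unfolding mat_op_def by (rule inner_embed_left) (auto intro: mult_mat_vec_carrier)
  also have "\<dots> = ?v \<bullet> (M *\<^sub>v ?u)"
    by (rule comm_scalar_prod[of _ "dim_row M"]) (auto intro: mult_mat_vec_carrier)
  also have "\<dots> = (M\<^sup>T *\<^sub>v ?v) \<bullet> ?u"
    by (rule transpose_vec_mult_scalar[OF M, symmetric]) auto
  also have "\<dots> = inner (mat_op M\<^sup>T v) u"
    unfolding mat_op_def by (subst inner_embed_left[of _ "dim_col M"]) (auto intro!: carrier_vecI)
  finally show "inner (mat_op M u) v = inner u (mat_op M\<^sup>T v)" by (simp add: inner_commute)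
qed

lemma mat_op_add:
  assumes "M \<in> carrier_mat m n" "N \<in> carrier_mat m n"
  shows "mat_op (M + N) u = mat_op M u + mat_op N u"
proof -
  have "(M + N) *\<^sub>v coord_vec n u = M *\<^sub>v coord_vec n u + N *\<^sub>v coord_vec n u"
    by (rule add_mult_distrib_mat_vec[OF assms]) auto
  then show ?thesis unfolding mat_op_def
    using assms embed_add[of "M *\<^sub>v coord_vec n u" m "N *\<^sub>v coord_vec n u"] by auto
qed

lemma mat_op_mult:
  assumes "M \<in> carrier_mat k m" "N \<in> carrier_mat m n"
  shows "mat_op (M * N) u = mat_op M (mat_op N u)"
proof -
  have "mat_op M (mat_op N u) = embed_vec (M *\<^sub>v (N *\<^sub>v coord_vec n u))"
    using assms unfolding mat_op_def[of N] by (subst mat_op_embed[OF assms(1)]) auto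
  then show ?thesis using assms unfolding mat_op_def[of "M * N"] by auto
qed

lemma finite_dim_coord_space: "finite_dim_subspace (coord_space n)"
  unfolding finite_dim_subspace_def
proof (intro conjI exI[of _ "(\<lambda>i. embed_vec (unit_vec n i)) ` {0..<n}"] ballI)
  show "subspace (coord_space n)"
    unfolding Real_Vector_Spaces.subspace_def
  proof (intro conjI ballI allI)
    show "0 \<in> coord_space n" using embed_in_space[of "0\<^sub>v n" n] by (simp add: embed_zero)
    fix u assume u: "u \<in> coord_space n"
    show "c *\<^sub>R u \<in> coord_space n" for c
      using u unfolding coord_space_def by (force simp: embed_smult[symmetric])
    show "u + v \<in> coord_space n" if "v \<in> coord_space n" for v
      using u that unfolding coord_space_def by (force simp: embed_add[symmetric])
  qed
  show "finite ((\<lambda>i. embed_vec (unit_vec n i)) ` {0..<n})" by simp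
  show "(\<lambda>i. embed_vec (unit_vec n i)) ` {0..<n} \<subseteq> coord_space n"
    by (auto intro!: embed_in_space)
  fix u assume "u \<in> coord_space n"
  then obtain v where v: "v \<in> carrier_vec n" and u: "u = embed_vec v" unfolding coord_space_def by auto
  have inj: "inj_on (\<lambda>i. embed_vec (unit_vec n i)) {0..<n}"
    by (intro inj_onI) (simp add: embed_inj[of _ n])
  have "(\<Sum>i\<in>{0..<n}. inner (embed_vec (unit_vec n i)) u *\<^sub>R embed_vec (unit_vec n i)) = u"
  proof (rule poly_mapping_eqI)
    fix k
    have "Poly_Mapping.lookup (\<Sum>i\<in>{0..<n}. inner (embed_vec (unit_vec n i)) u *\<^sub>R embed_vec (unit_vec n i)) k
      = (\<Sum>i\<in>{0..<n}. if i = k then v $ i else 0)"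
      unfolding lookup_sum u
      by (intro sum.cong refl) (use v in \<open>auto simp: scaleR_poly_mapping.rep_eq lookup_embed inner_embed[of _ n]\<close>)
    also have "\<dots> = Poly_Mapping.lookup u k" using v by (auto simp: u lookup_embed)
    finally show "Poly_Mapping.lookup (\<Sum>i\<in>{0..<n}. inner (embed_vec (unit_vec n i)) u *\<^sub>R embed_vec (unit_vec n i)) k
      = Poly_Mapping.lookup u k" .
  qed
  then show "u = (\<Sum>e\<in>(\<lambda>i. embed_vec (unit_vec n i)) ` {0..<n}. inner e u *\<^sub>R e)"
    by (simp add: sum.reindex[OF inj])
qed

lemma frobenius_norm_bound:
  assumes M: "M \<in> carrier_mat m n" and v: "v \<in> carrier_vec n"
  shows "vnorm2 (M *\<^sub>v v) \<le> frobenius_norm M * vnorm2 v"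
proof -
  have vv: "v \<bullet> v = (\<Sum>j<n. (v $ j)\<^sup>2)"
    using v unfolding scalar_prod_def by (auto simp: power2_eq_square atLeast0LessThan)
  have "(M *\<^sub>v v) \<bullet> (M *\<^sub>v v) = (\<Sum>i<m. (row M i \<bullet> v)\<^sup>2)"
    using M v unfolding scalar_prod_def[of "M *\<^sub>v v"] by (auto simp: power2_eq_square atLeast0LessThan)
  also have "\<dots> = (\<Sum>i<m. (\<Sum>j<n. M $$ (i, j) * v $ j)\<^sup>2)"
    using M v unfolding scalar_prod_def by (intro sum.cong refl) (auto simp: atLeast0LessThan intro!: arg_cong[where f = "\<lambda>s. s\<^sup>2"] sum.cong)
  also have "\<dots> \<le> (\<Sum>i<m. (\<Sum>j<n. (M $$ (i, j))\<^sup>2) * (\<Sum>j<n. (v $ j)\<^sup>2))"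
    by (intro sum_mono Cauchy_Schwarz_ineq_sum)
  also have "\<dots> = (frobenius_norm M)\<^sup>2 * (vnorm2 v)\<^sup>2"
    unfolding vnorm2_square vv frobenius_norm_def using M by (simp add: sum_nonneg sum_distrib_right)
  finally have "(vnorm2 (M *\<^sub>v v))\<^sup>2 \<le> (frobenius_norm M * vnorm2 v)\<^sup>2"
    by (simp add: vnorm2_square power_mult_distrib)
  moreover have "0 \<le> frobenius_norm M * vnorm2 v"
    unfolding frobenius_norm_def by (intro mult_nonneg_nonneg vnorm2_nonneg) (simp add: sum_nonneg)
  ultimately show ?thesis by (rule power2_le_imp_le)
qed

lemma spectral_norm_set:
  assumes M: "M \<in> carrier_mat m n"
  defines "S \<equiv> (\<lambda>v. vnorm2 (M *\<^sub>v v)) ` {v \<in> carrier_vec n. vnorm2 v \<le> 1}"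
  shows "0 \<in> S" and "\<And>s. s \<in> S \<Longrightarrow> s \<le> frobenius_norm M" and "spectral_norm M = Sup S"
proof -
  have 1: "0\<^sub>v n \<in> {v \<in> carrier_vec n. vnorm2 v \<le> 1}" unfolding vnorm2_def by simp
  have "M *\<^sub>v 0\<^sub>v n = 0\<^sub>v m" using M by auto
  then have "vnorm2 (M *\<^sub>v 0\<^sub>v n) = 0" by (simp add: vnorm2_def)
  then show "0 \<in> S" unfolding S_def using 1 by (metis (no_types, lifting) imageI)
  show "spectral_norm M = Sup S" unfolding S_def spectral_norm_def using M by auto
  have F: "0 \<le> frobenius_norm M" unfolding frobenius_norm_def by (simp add: sum_nonneg)
  fix s assume "s \<in> S"
  then obtain v where v: "v \<in> carrier_vec n" "vnorm2 v \<le> 1" "s = vnorm2 (M *\<^sub>v v)" unfolding S_def by auto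
  have "s \<le> frobenius_norm M * vnorm2 v" unfolding v(3) by (rule frobenius_norm_bound[OF M v(1)])
  also have "\<dots> \<le> frobenius_norm M" using F v(2) by (simp add: mult_left_le)
  finally show "s \<le> frobenius_norm M" .
qed

lemma spectral_norm_nonneg: "0 \<le> spectral_norm M"
  and spectral_norm_le_frobenius: "spectral_norm M \<le> frobenius_norm M"
proof -
  have M: "M \<in> carrier_mat (dim_row M) (dim_col M)" by simp
  note S = spectral_norm_set[OF M]
  show "0 \<le> spectral_norm M" unfolding S(3) by (rule cSup_upper[OF S(1) bdd_aboveI[OF S(2)]])
  show "spectral_norm M \<le> frobenius_norm M" unfolding S(3) using S(1) by (intro cSup_least S(2)) blast
qed

lemma spectral_norm_bound:
  assumes M: "M \<in> carrier_mat m n" and v: "v \<in> carrier_vec n"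
  shows "vnorm2 (M *\<^sub>v v) \<le> spectral_norm M * vnorm2 v"
proof (cases "vnorm2 v = 0")
  case True
  then show ?thesis using frobenius_norm_bound[OF M v] by simp
next
  case False
  then have pos: "0 < vnorm2 v" using vnorm2_nonneg[of v] by simp
  define w where "w = (1 / vnorm2 v) \<cdot>\<^sub>v v"
  have w: "w \<in> carrier_vec n" "vnorm2 w \<le> 1"
    unfolding w_def using v pos by (auto simp: norm_embed[symmetric] embed_smult)
  have "vnorm2 (M *\<^sub>v w) \<le> spectral_norm M"
    unfolding spectral_norm_set(3)[OF M]
    by (rule cSup_upper[OF _ bdd_aboveI[OF spectral_norm_set(2)[OF M]]]) (use w in auto)
  moreover have "vnorm2 (M *\<^sub>v w) = vnorm2 (M *\<^sub>v v) / vnorm2 v"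
    unfolding w_def using M v pos by (simp add: norm_embed[symmetric] mult_mat_vec embed_smult)
  ultimately show ?thesis using pos by (simp add: divide_le_eq)
qed

lemma norm_coord_le: "vnorm2 (coord_vec n u) \<le> norm u"
proof -
  let ?c = "embed_vec (coord_vec n u)"
  have "inner ?c u = inner ?c ?c" by (simp add: inner_embed_left[of _ n] coord_embed)
  then have "norm ?c * norm ?c \<le> norm ?c * norm u"
    using norm_cauchy_schwarz[of ?c u] by (simp add: dot_square_norm power2_eq_square)
  then show ?thesis unfolding norm_embed by (cases "vnorm2 (coord_vec n u) = 0")
      (use vnorm2_nonneg[of "coord_vec n u"] in \<open>auto simp: mult_le_cancel_left\<close>)
qed

lemma mat_op_norm: "norm (mat_op M u) \<le> spectral_norm M * norm u"
proof -
  have "norm (mat_op M u) \<le> spectral_norm M * vnorm2 (coord_vec (dim_col M) u)"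
    unfolding mat_op_def norm_embed by (rule spectral_norm_bound) auto
  also have "\<dots> \<le> spectral_norm M * norm u"
    by (intro mult_left_mono norm_coord_le spectral_norm_nonneg)
  finally show ?thesis .
qed

text \<open>From \<open>|M^T u|^2 = <M (M^T u), u>\<close>.\<close>

lemma mat_op_transpose_norm: "norm (mat_op M\<^sup>T u) \<le> spectral_norm M * norm u"
proof (cases "mat_op M\<^sup>T u = 0")
  case True
  then show ?thesis using spectral_norm_nonneg[of M] by simp
next
  case False
  let ?w = "mat_op M\<^sup>T u"
  have "norm ?w * norm ?w = inner (mat_op M ?w) u"
    using adjoint_pairD(3)[OF mat_op_adjoint[of M], of ?w u] by (simp add: dot_square_norm power2_eq_square)
  also have "\<dots> \<le> norm (mat_op M ?w) * norm u" by (rule norm_cauchy_schwarz)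
  also have "\<dots> \<le> (spectral_norm M * norm ?w) * norm u" by (intro mult_right_mono mat_op_norm) simp
  finally have "norm ?w * norm ?w \<le> (spectral_norm M * norm u) * norm ?w" by (simp add: mult_ac)
  from mult_right_le_imp_le[OF this] show ?thesis using False by simp
qed

section \<open>Least eigenvalues and least singular values\<close>

lemma symmetric_mat_least_form:
  fixes S :: "real mat"
  assumes S: "S \<in> carrier_mat k k" "S\<^sup>T = S" and k: "0 < k"
  shows "\<exists>\<mu>. eigenvalue S \<mu> \<and> (\<forall>v\<in>carrier_vec k. \<mu> * (v \<bullet> v) \<le> v \<bullet> (S *\<^sub>v v))"
proof -
  have unit: "unit_vec k 0 \<noteq> 0\<^sub>v k" using k by (metis index_unit_vec(2) index_zero_vec(1) zero_neq_one)
  have sym: "inner u (mat_op S v) = inner (mat_op S u) v" for u v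
    using adjoint_pairD(3)[OF mat_op_adjoint[of S]] S(2) by simp
  have "\<exists>\<mu>. (\<exists>v\<in>coord_space k. v \<noteq> 0 \<and> mat_op S v = \<mu> *\<^sub>R v) \<and>
      (\<forall>u\<in>coord_space k. \<mu> * (norm u)\<^sup>2 \<le> inner u (mat_op S u))"
  proof (rule exists_least_eigenvalue[OF finite_dim_coord_space _ _ mat_op_linear _ sym])
    show "embed_vec (unit_vec k 0) \<in> coord_space k" by (rule embed_in_space) simp
    show "embed_vec (unit_vec k 0) \<noteq> 0"
      using unit embed_inj[of "unit_vec k 0" k "0\<^sub>v k"] by (simp add: embed_zero)
    show "mat_op S ` coord_space k \<subseteq> coord_space k" using mat_op_in[OF S(1)] by auto
  qed
  then obtain \<mu> v where v: "v \<in> coord_space k" "v \<noteq> 0" "mat_op S v = \<mu> *\<^sub>R v"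
    and low: "\<And>u. u \<in> coord_space k \<Longrightarrow> \<mu> * (norm u)\<^sup>2 \<le> inner u (mat_op S u)" by auto
  obtain w where w: "w \<in> carrier_vec k" "v = embed_vec w" using v(1) unfolding coord_space_def by auto
  have Sw: "S *\<^sub>v w \<in> carrier_vec k" using S(1) w(1) by (rule mult_mat_vec_carrier)
  have "S *\<^sub>v w = \<mu> \<cdot>\<^sub>v w"
    using v(3) embed_inj[OF Sw, of "\<mu> \<cdot>\<^sub>v w"] w unfolding w(2) mat_op_embed[OF S(1) w(1)] by (simp add: embed_smult)
  moreover have "w \<noteq> 0\<^sub>v k" using v(2) w(2) by (auto simp: embed_zero)
  ultimately have "eigenvalue S \<mu>" unfolding eigenvalue_def eigenvector_def using w(1) S(1) by auto
  moreover have "\<mu> * (v \<bullet> v) \<le> v \<bullet> (S *\<^sub>v v)" if u: "v \<in> carrier_vec k" for v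
    using low[OF embed_in_space[OF u]] mult_mat_vec_carrier[OF S(1) u]
    by (simp add: mat_op_embed[OF S(1) u] norm_embed vnorm2_square inner_embed[OF u])
  ultimately show ?thesis by blast
qed

text \<open>For an eigenvector \<open>p + i q\<close> the symmetry relation between \<open>p\<close> and \<open>q\<close> reads
\<open>Im z (|p|^2 + |q|^2) = 0\<close>.\<close>

lemma symmetric_mat_eigenvalue_real:
  fixes S :: "real mat"
  assumes S: "S \<in> carrier_mat k k" "S\<^sup>T = S" and ev: "eigenvalue (map_mat complex_of_real S) z"
  shows "Im z = 0"
proof -
  obtain v where v: "v \<in> carrier_vec k" "v \<noteq> 0\<^sub>v k" "map_mat complex_of_real S *\<^sub>v v = z \<cdot>\<^sub>v v"
    using ev S(1) unfolding eigenvalue_def eigenvector_def by auto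
  define p q where "p = map_vec Re v" and "q = map_vec Im v"
  have pq: "p \<in> carrier_vec k" "q \<in> carrier_vec k" unfolding p_def q_def using v(1) by auto
  have comp: "(\<Sum>j\<in>{0..<k}. complex_of_real (S $$ (i, j)) * v $ j) = z * v $ i" if "i < k" for i
    using arg_cong[OF v(3), of "\<lambda>w. w $ i"] that v(1) S(1) by (simp add: scalar_prod_def)
  have Sp: "S *\<^sub>v p = Re z \<cdot>\<^sub>v p - Im z \<cdot>\<^sub>v q"
  proof (rule eq_vecI)
    fix i assume "i < dim_vec (Re z \<cdot>\<^sub>v p - Im z \<cdot>\<^sub>v q)"
    then have i: "i < k" using pq by auto
    show "(S *\<^sub>v p) $ i = (Re z \<cdot>\<^sub>v p - Im z \<cdot>\<^sub>v q) $ i"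
      using arg_cong[OF comp[OF i], of Re] i v(1) S(1) pq
      by (simp add: scalar_prod_def p_def q_def)
  qed (use pq S in auto)
  have Sq: "S *\<^sub>v q = Re z \<cdot>\<^sub>v q + Im z \<cdot>\<^sub>v p"
  proof (rule eq_vecI)
    fix i assume "i < dim_vec (Re z \<cdot>\<^sub>v q + Im z \<cdot>\<^sub>v p)"
    then have i: "i < k" using pq by auto
    show "(S *\<^sub>v q) $ i = (Re z \<cdot>\<^sub>v q + Im z \<cdot>\<^sub>v p) $ i"
      using arg_cong[OF comp[OF i], of Im] i v(1) S(1) pq
      by (simp add: scalar_prod_def p_def q_def)
  qed (use pq S in auto)
  let ?p = "embed_vec p" and ?q = "embed_vec q"
  have "inner ?q (mat_op S ?p) = inner (mat_op S ?q) ?p"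
    using adjoint_pairD(3)[OF mat_op_adjoint[of S]] S(2) by simp
  moreover have "mat_op S ?p = Re z *\<^sub>R ?p - Im z *\<^sub>R ?q"
    unfolding mat_op_embed[OF S(1) pq(1)] Sp using pq by (simp add: embed_diff[of _ k] embed_smult)
  moreover have "mat_op S ?q = Re z *\<^sub>R ?q + Im z *\<^sub>R ?p"
    unfolding mat_op_embed[OF S(1) pq(2)] Sq using pq by (simp add: embed_add[of _ k] embed_smult)
  ultimately have "Im z * (inner ?p ?p + inner ?q ?q) = 0"
    by (simp add: inner_diff_right inner_add_left algebra_simps inner_commute)
  moreover have "inner ?p ?p + inner ?q ?q \<noteq> 0"
  proof
    assume "inner ?p ?p + inner ?q ?q = 0"
    then have "?p = 0" "?q = 0" by (simp_all add: add_nonneg_eq_0_iff)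
    then have "p = 0\<^sub>v k" "q = 0\<^sub>v k"
      using embed_inj[OF pq(1), of "0\<^sub>v k"] embed_inj[OF pq(2), of "0\<^sub>v k"] by (auto simp: embed_zero)
    then have "p $ i = 0" "q $ i = 0" if "i < k" for i using that by auto
    then have "v $ i = 0" if "i < k" for i
      using that v(1) unfolding p_def q_def by (simp add: complex_eq_iff)
    then have "v = 0\<^sub>v k" using v(1) by (intro eq_vecI) auto
    then show False using v(2) by simp
  qed
  ultimately show ?thesis by simp
qed

text \<open>The linear factors over the complex numbers are real. Only because of this does the list of real roots have
full length, so that its entry at position \<open>k - 1\<close> is the smallest eigenvalue.\<close>

lemma char_poly_symmetric_splits:
  fixes S :: "real mat"
  assumes S: "S \<in> carrier_mat k k" "S\<^sup>T = S"
  shows "\<exists>as. length as = k \<and> char_poly S = (\<Prod>a\<leftarrow>as. [:- a, 1:])"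
proof -
  let ?C = "map_mat complex_of_real S"
  interpret mp: map_poly_inj_comm_ring_hom complex_of_real ..
  have C: "?C \<in> carrier_mat k k" using S(1) by simp
  obtain zs where zs: "char_poly ?C = (\<Prod>a\<leftarrow>zs. [:- a, 1:])" "length zs = k"
    using char_poly_factorized[OF C] by auto
  have real: "complex_of_real (Re z) = z" if z: "z \<in> set zs" for z
  proof -
    have "poly (char_poly ?C) z = 0" unfolding zs(1) poly_prod_list using z by (force simp: prod_list_zero_iff)
    then have "eigenvalue ?C z" by (simp add: eigenvalue_root_char_poly[OF C])
    then show ?thesis using symmetric_mat_eigenvalue_real[OF S] by (simp add: complex_eq_iff)
  qed
  have "map_poly complex_of_real (char_poly S) = char_poly ?C" by (rule of_real_hom.char_poly_hom[OF S(1), symmetric])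
  also have "\<dots> = (\<Prod>a\<leftarrow>zs. map_poly complex_of_real [:- Re a, 1:])"
    unfolding zs(1) using real by (intro arg_cong[of _ _ prod_list] map_cong refl) auto
  also have "\<dots> = map_poly complex_of_real (\<Prod>a\<leftarrow>map Re zs. [:- a, 1:])"
    by (simp add: mp.hom_prod_list o_def)
  finally have "char_poly S = (\<Prod>a\<leftarrow>map Re zs. [:- a, 1:])" by simp
  then show ?thesis using zs(2) by (intro exI[of _ "map Re zs"]) simp
qed

lemma last_root_char_poly:
  fixes S :: "real mat"
  assumes S: "S \<in> carrier_mat k k" "S\<^sup>T = S" and k: "0 < k"
  defines "\<rho> \<equiv> roots_desc (char_poly S) ! (k - 1)"
  shows "eigenvalue S \<rho>" and "\<And>v. v \<in> carrier_vec k \<Longrightarrow> \<rho> * (v \<bullet> v) \<le> v \<bullet> (S *\<^sub>v v)"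
proof -
  obtain as where as: "length as = k" "char_poly S = (\<Prod>a\<leftarrow>as. [:- a, 1:])"
    using char_poly_symmetric_splits[OF S] by auto
  have "proots (char_poly S) = mset as"
  proof -
    have "proots (\<Prod>a\<leftarrow>xs. [:- a, 1:]) = mset xs" for xs :: "real list"
    proof (induction xs)
      case (Cons x xs)
      have "(\<Prod>a\<leftarrow>xs. [:- a, 1:]) \<noteq> 0" by (auto simp: prod_list_zero_iff)
      then show ?case using Cons by (simp add: proots_mult del: mult_pCons_left)
    qed simp
    then show ?thesis unfolding as(2) .
  qed
  then have r: "roots_desc (char_poly S) = rev (sort as)" unfolding roots_desc_def by simp
  then have \<rho>: "\<rho> = sort as ! 0" unfolding \<rho>_def using as(1) k by (simp add: rev_nth)
  have in_as: "\<rho> \<in> set as" unfolding \<rho> using as(1) k by (metis length_sort nth_mem set_sort)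
  have least: "\<rho> \<le> a" if "a \<in> set as" for a
  proof -
    have "a \<in> set (sort as)" using that by simp
    then obtain i where "i < length (sort as)" "sort as ! i = a" unfolding in_set_conv_nth by blast
    then show ?thesis unfolding \<rho> using sorted_nth_mono[of "sort as" 0 i] by auto
  qed
  have roots: "eigenvalue S a \<longleftrightarrow> a \<in> set as" for a
    unfolding eigenvalue_root_char_poly[OF S(1)] as(2) poly_prod_list prod_list_zero_iff by auto
  show ev: "eigenvalue S \<rho>" using roots in_as by simp
  obtain \<mu> where \<mu>: "eigenvalue S \<mu>" "\<And>v. v \<in> carrier_vec k \<Longrightarrow> \<mu> * (v \<bullet> v) \<le> v \<bullet> (S *\<^sub>v v)"
    using symmetric_mat_least_form[OF S k] by auto
  have "\<rho> \<le> \<mu>" using least roots \<mu>(1) by simp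
  then show "\<rho> * (v \<bullet> v) \<le> v \<bullet> (S *\<^sub>v v)" if "v \<in> carrier_vec k" for v
    using \<mu>(2)[OF that] mult_right_mono[of \<rho> \<mu> "v \<bullet> v"] by (simp add: vnorm2_square[symmetric])
qed

lemma gram_form:
  assumes M: "M \<in> carrier_mat m k" and v: "v \<in> carrier_vec k"
  shows "v \<bullet> ((M\<^sup>T * M) *\<^sub>v v) = (vnorm2 (M *\<^sub>v v))\<^sup>2"
proof -
  have "v \<bullet> ((M\<^sup>T * M) *\<^sub>v v) = v \<bullet> (M\<^sup>T *\<^sub>v (M *\<^sub>v v))" using M v by simp
  also have "\<dots> = (M\<^sup>T *\<^sub>v (M *\<^sub>v v)) \<bullet> v"
    by (rule comm_scalar_prod[OF v]) (use M v in \<open>auto intro!: mult_mat_vec_carrier\<close>)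
  also have "\<dots> = (M *\<^sub>v v) \<bullet> (M *\<^sub>v v)"
    by (rule transpose_vec_mult_scalar[OF M v]) (use M v in auto)
  finally show ?thesis by (simp add: vnorm2_square)
qed

text \<open>The Rayleigh quotient of the Gram matrix at \<open>v\<close> is \<open>|M v|^2 / |v|^2\<close>, so its least eigenvalue is the
minimum of that ratio.\<close>

lemma gram_least_root:
  assumes M: "M \<in> carrier_mat m k" and k: "0 < k"
  defines "\<rho> \<equiv> roots_desc (char_poly (M\<^sup>T * M)) ! (k - 1)"
  shows "0 \<le> \<rho>"
    and "\<And>v. v \<in> carrier_vec k \<Longrightarrow> \<rho> * (vnorm2 v)\<^sup>2 \<le> (vnorm2 (M *\<^sub>v v))\<^sup>2"
    and "\<exists>v\<in>carrier_vec k. v \<noteq> 0\<^sub>v k \<and> (vnorm2 (M *\<^sub>v v))\<^sup>2 = \<rho> * (vnorm2 v)\<^sup>2"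
    and "sing_val k M = ereal (sqrt \<rho>)"
proof -
  have S: "M\<^sup>T * M \<in> carrier_mat k k" "(M\<^sup>T * M)\<^sup>T = M\<^sup>T * M"
    using M by (auto simp: transpose_mult)
  note least = last_root_char_poly[OF S k, folded \<rho>_def]
  show "\<rho> * (vnorm2 v)\<^sup>2 \<le> (vnorm2 (M *\<^sub>v v))\<^sup>2" if "v \<in> carrier_vec k" for v
    using least(2)[OF that] by (simp add: gram_form[OF M that] vnorm2_square[symmetric])
  obtain v where v: "v \<in> carrier_vec k" "v \<noteq> 0\<^sub>v k" "(M\<^sup>T * M) *\<^sub>v v = \<rho> \<cdot>\<^sub>v v"
    using least(1) S(1) unfolding eigenvalue_def eigenvector_def by auto
  have eq: "(vnorm2 (M *\<^sub>v v))\<^sup>2 = \<rho> * (vnorm2 v)\<^sup>2"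
    using gram_form[OF M v(1)] v(1) unfolding v(3) by (simp add: vnorm2_square)
  then show "\<exists>v\<in>carrier_vec k. v \<noteq> 0\<^sub>v k \<and> (vnorm2 (M *\<^sub>v v))\<^sup>2 = \<rho> * (vnorm2 v)\<^sup>2"
    using v by blast
  have "0 < (vnorm2 v)\<^sup>2" using v(1,2) vnorm2_eq_0 by simp
  then show "0 \<le> \<rho>" using eq by (metis linorder_not_less mult_neg_pos zero_le_power2)
  show "sing_val k M = ereal (sqrt \<rho>)" unfolding sing_val_def \<rho>_def using k by simp
qed

section \<open>Generalized eigenvalues of triangular pencils\<close>

text \<open>The matrix \<open>W\<close> of the mixed problem, and for \<open>k\<close> one larger its bordered version \<open>W~\<close>.\<close>

definition weight_mat :: "nat \<Rightarrow> nat \<Rightarrow> real mat" where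
  "weight_mat n1 k = four_block_mat (0\<^sub>m n1 n1) (0\<^sub>m n1 k) (0\<^sub>m k n1) (1\<^sub>m k)"

lemma weight_mat_carrier [simp]: "weight_mat n1 k \<in> carrier_mat (n1 + k) (n1 + k)"
  unfolding weight_mat_def by auto

lemma diag_block_weight: "diag_block_mat [0\<^sub>m n1 n1, 1\<^sub>m k] = weight_mat n1 k"
  unfolding weight_mat_def by (rule eq_matI) (auto simp: Let_def)

lemma diag_block_weight_Suc: "diag_block_mat [weight_mat n1 k, 1\<^sub>m 1] = weight_mat n1 (Suc k)"
  unfolding weight_mat_def by (rule eq_matI) (auto simp: Let_def)

lemma gram_orthogonal_mult:
  fixes Q :: "real mat"
  assumes Q: "Q \<in> carrier_mat m m" "Q\<^sup>T * Q = 1\<^sub>m m" and B: "B \<in> carrier_mat m k"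
  shows "(Q\<^sup>T * B)\<^sup>T * (Q\<^sup>T * B) = B\<^sup>T * B"
proof -
  have QQ: "Q * Q\<^sup>T = 1\<^sub>m m" using mat_mult_left_right_inverse[of "Q\<^sup>T" m Q] Q by simp
  have "(Q\<^sup>T * B)\<^sup>T * (Q\<^sup>T * B) = (B\<^sup>T * Q) * (Q\<^sup>T * B)"
    using Q(1) B by (simp add: transpose_mult[of _ m m])
  also have "\<dots> = B\<^sup>T * (Q * (Q\<^sup>T * B))"
    by (rule assoc_mult_mat[of _ k m _ m _ k]) (use Q(1) B in auto)
  also have "Q * (Q\<^sup>T * B) = (Q * Q\<^sup>T) * B"
    by (rule assoc_mult_mat[of _ m m _ m _ k, symmetric]) (use Q(1) B in auto)
  finally show ?thesis unfolding QQ using B by simp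
qed

lemma poly_pencil_poly:
  assumes M: "M \<in> carrier_mat k k" and N: "N \<in> carrier_mat k k"
  shows "poly (pencil_poly M N) t = det (M - t \<cdot>\<^sub>m N)"
  unfolding pencil_poly_def
  by (rule poly_det_cong[of _ k]) (use M N in \<open>auto simp: algebra_simps\<close>)

lemma poly_char_poly_det:
  fixes S :: "real mat"
  assumes S: "S \<in> carrier_mat k k"
  shows "det (S - t \<cdot>\<^sub>m 1\<^sub>m k) = (-1) ^ k * poly (char_poly S) t"
proof -
  have "- char_matrix S t = (-1) \<cdot>\<^sub>m (S - t \<cdot>\<^sub>m 1\<^sub>m k)"
    unfolding char_matrix_def using S by (intro eq_matI) auto
  then have "poly (char_poly S) t = (-1) ^ k * det (S - t \<cdot>\<^sub>m 1\<^sub>m k)"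
    unfolding char_poly_matrix[OF S] using S by simp
  then show ?thesis by (simp add: power_mult_distrib[symmetric] mult.assoc[symmetric])
qed

text \<open>For \<open>U\<close> with rows \<open>[R11, R12]\<close> and \<open>[0, 1]\<close>, the matrix \<open>B^T B - t W\<close> factors as
\<open>U^T diag(1, R22^T R22 - t) U\<close>, since \<open>W\<close> acts only on the lower right block. Both sides are polynomials
in \<open>t\<close> and are compared at all real \<open>t\<close>.\<close>

lemma pencil_poly_triangular:
  assumes B: "B \<in> carrier_mat m (n1 + k)" and Q: "Q \<in> carrier_mat m m" "Q\<^sup>T * Q = 1\<^sub>m m"
    and R: "R11 \<in> carrier_mat n1 n1" "R12 \<in> carrier_mat n1 k" "R22 \<in> carrier_mat l k"
    and QB: "Q\<^sup>T * B = four_block_mat R11 R12 (0\<^sub>m l n1) R22"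
  shows "pencil_poly (B\<^sup>T * B) (weight_mat n1 k)
    = Polynomial.smult ((det R11)\<^sup>2 * (-1) ^ k) (char_poly (R22\<^sup>T * R22))"
proof -
  let ?S = "R22\<^sup>T * R22"
  define U where "U = four_block_mat R11 R12 (0\<^sub>m k n1) (1\<^sub>m k)"
  have U: "U \<in> carrier_mat (n1 + k) (n1 + k)" unfolding U_def using R by auto
  have S: "?S \<in> carrier_mat k k" using R(3) by auto
  have Ut: "U\<^sup>T = four_block_mat (R11\<^sup>T) (0\<^sub>m n1 k) (R12\<^sup>T) (1\<^sub>m k)"
    unfolding U_def using R by (subst transpose_four_block_mat[of _ n1 n1 _ k _ k]) auto
  have BB: "B\<^sup>T * B = four_block_mat (R11\<^sup>T * R11) (R11\<^sup>T * R12) (R12\<^sup>T * R11) (R12\<^sup>T * R12 + ?S)"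
  proof -
    have "B\<^sup>T * B = (four_block_mat R11 R12 (0\<^sub>m l n1) R22)\<^sup>T * four_block_mat R11 R12 (0\<^sub>m l n1) R22"
      unfolding QB[symmetric] by (rule gram_orthogonal_mult[OF Q B, symmetric])
    also have "(four_block_mat R11 R12 (0\<^sub>m l n1) R22)\<^sup>T = four_block_mat (R11\<^sup>T) (0\<^sub>m n1 l) (R12\<^sup>T) (R22\<^sup>T)"
      using R by (subst transpose_four_block_mat[of _ n1 n1 _ k _ l]) auto
    also have "\<dots> * four_block_mat R11 R12 (0\<^sub>m l n1) R22
      = four_block_mat (R11\<^sup>T * R11 + 0\<^sub>m n1 l * 0\<^sub>m l n1) (R11\<^sup>T * R12 + 0\<^sub>m n1 l * R22)
        (R12\<^sup>T * R11 + R22\<^sup>T * 0\<^sub>m l n1) (R12\<^sup>T * R12 + R22\<^sup>T * R22)"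
      by (rule mult_four_block_mat) (use R in auto)
    finally show ?thesis using R by (simp add: right_add_zero_mat[of _ n1])
  qed
  have "poly (pencil_poly (B\<^sup>T * B) (weight_mat n1 k)) t = (det R11)\<^sup>2 * ((-1) ^ k * poly (char_poly ?S) t)" for t
  proof -
    let ?D = "four_block_mat (1\<^sub>m n1) (0\<^sub>m n1 k) (0\<^sub>m k n1) (?S - t \<cdot>\<^sub>m 1\<^sub>m k)"
    have D: "?D \<in> carrier_mat (n1 + k) (n1 + k)" using S by auto
    have DU: "?D * U = four_block_mat R11 R12 (0\<^sub>m k n1) (?S - t \<cdot>\<^sub>m 1\<^sub>m k)"
      unfolding U_def using R S
      by (subst mult_four_block_mat[of _ n1 n1 _ k _ k _ _ n1 _ k]) auto
    have "U\<^sup>T * (?D * U) = four_block_mat (R11\<^sup>T * R11) (R11\<^sup>T * R12) (R12\<^sup>T * R11)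
        (R12\<^sup>T * R12 + (?S - t \<cdot>\<^sub>m 1\<^sub>m k))"
      unfolding DU Ut using R S
      by (subst mult_four_block_mat[of _ n1 n1 _ k _ k _ _ n1 _ k]) auto
    also have "\<dots> = B\<^sup>T * B - t \<cdot>\<^sub>m weight_mat n1 k"
      unfolding BB weight_mat_def using R S by (intro eq_matI) auto
    finally have fact: "B\<^sup>T * B - t \<cdot>\<^sub>m weight_mat n1 k = U\<^sup>T * (?D * U)" ..
    have detU: "det U = det R11"
      unfolding U_def using R by (subst det_four_block_mat_lower_left_zero[of _ n1 _ k]) auto
    have detD: "det ?D = det (?S - t \<cdot>\<^sub>m 1\<^sub>m k)"
      using S by (subst det_four_block_mat_lower_left_zero[of _ n1 _ k]) auto
    have "poly (pencil_poly (B\<^sup>T * B) (weight_mat n1 k)) t = det (B\<^sup>T * B - t \<cdot>\<^sub>m weight_mat n1 k)"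
      by (rule poly_pencil_poly[of _ "n1 + k"]) (use B in auto)
    also have "\<dots> = det U * (det ?D * det U)"
      unfolding fact using U D
      by (simp add: det_mult[of _ "n1 + k"] det_transpose[of _ "n1 + k"])
    finally show ?thesis unfolding detU detD poly_char_poly_det[OF S] by (simp add: power2_eq_square)
  qed
  then have "poly (pencil_poly (B\<^sup>T * B) (weight_mat n1 k))
    = poly (Polynomial.smult ((det R11)\<^sup>2 * (-1) ^ k) (char_poly ?S))"
    by (intro ext) (simp add: mult.assoc)
  then show ?thesis by (simp add: poly_eq_poly_eq_iff)
qed

text \<open>The pencil polynomial has degree \<open>k\<close>, so the first \<open>n1\<close> eigenvalues are infinite and the last one is the least
root of the characteristic polynomial.\<close>

lemma gen_eigval_triangular:
  assumes B: "B \<in> carrier_mat m (n1 + k)" and Q: "Q \<in> carrier_mat m m" "Q\<^sup>T * Q = 1\<^sub>m m"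
    and R: "R11 \<in> carrier_mat n1 n1" "R12 \<in> carrier_mat n1 k" "R22 \<in> carrier_mat l k"
    and QB: "Q\<^sup>T * B = four_block_mat R11 R12 (0\<^sub>m l n1) R22" and det: "det R11 \<noteq> 0" and k: "0 < k"
  shows "gen_eigval (n1 + k) (B\<^sup>T * B) (weight_mat n1 k)
    = ereal (roots_desc (char_poly (R22\<^sup>T * R22)) ! (k - 1))"
proof -
  have S: "R22\<^sup>T * R22 \<in> carrier_mat k k" using R(3) by auto
  have c: "(det R11)\<^sup>2 * (-1) ^ k \<noteq> 0" using det by simp
  have "degree (char_poly (R22\<^sup>T * R22)) = k" using degree_monic_char_poly[OF S] by simp
  then show ?thesis
    unfolding gen_eigval_def Let_def pencil_poly_triangular[OF B Q R QB] roots_desc_def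
    using c B k by simp
qed

section \<open>Mixed total least squares as a minimization problem\<close>

lemma append_cols_carrier:
  "A \<in> carrier_mat m n1 \<Longrightarrow> B \<in> carrier_mat m n2 \<Longrightarrow> A @\<^sub>c B \<in> carrier_mat m (n1 + n2)"
  unfolding append_cols_def by (auto simp: four_block_mat_def Let_def)

lemma append_cols_index:
  assumes "A \<in> carrier_mat m n1" "B \<in> carrier_mat m n2" "i < m" "j < n1 + n2"
  shows "(A @\<^sub>c B) $$ (i, j) = (if j < n1 then A $$ (i, j) else B $$ (i, j - n1))"
  using assms unfolding append_cols_def by (auto simp: four_block_mat_def Let_def)

lemma append_cols_mult_vec:
  fixes A B :: "real mat"
  assumes A: "A \<in> carrier_mat m n1" and B: "B \<in> carrier_mat m n2"
    and y: "y \<in> carrier_vec n1" and z: "z \<in> carrier_vec n2"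
  shows "(A @\<^sub>c B) *\<^sub>v (y @\<^sub>v z) = A *\<^sub>v y + B *\<^sub>v z"
proof -
  have "(A @\<^sub>c B) *\<^sub>v (y @\<^sub>v z)
    = (A *\<^sub>v y + B *\<^sub>v z) @\<^sub>v (0\<^sub>m 0 n1 *\<^sub>v y + 0\<^sub>m 0 n2 *\<^sub>v z)"
    using A B unfolding append_cols_def
    by (subst four_block_mat_mult_vec[OF A B _ _ y z, of _ 0]) auto
  also have "\<dots> = A *\<^sub>v y + B *\<^sub>v z" by (rule eq_vecI) auto
  finally show ?thesis .
qed

lemma append_cols_add:
  assumes "A \<in> carrier_mat m n1" "B \<in> carrier_mat m n2" "A' \<in> carrier_mat m n1" "B' \<in> carrier_mat m n2"
  shows "(A + A') @\<^sub>c (B + B') = (A @\<^sub>c B) + (A' @\<^sub>c B')"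
  using assms append_cols_carrier[OF assms(1,2)] append_cols_carrier[OF assms(3,4)]
    append_cols_carrier[of "A + A'" m n1 "B + B'" n2]
  by (intro eq_matI) (auto simp: append_cols_index[of _ m n1 _ n2])

lemma col_mat_carrier: "v \<in> carrier_vec m \<Longrightarrow> col_mat v \<in> carrier_mat m 1"
  unfolding col_mat_def by auto

lemma col_mat_mult_vec:
  fixes v :: "real vec"
  assumes v: "v \<in> carrier_vec m"
  shows "col_mat v *\<^sub>v vec 1 (\<lambda>_. c) = c \<cdot>\<^sub>v v"
  using v unfolding col_mat_def
  by (intro eq_vecI) (auto simp: scalar_prod_def mat_of_cols_index)

lemma append_cols_col_mult_vec:
  fixes A :: "real mat"
  assumes A: "A \<in> carrier_mat m n" and v: "v \<in> carrier_vec m" and z: "z \<in> carrier_vec n"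
  shows "(A @\<^sub>c col_mat v) *\<^sub>v (z @\<^sub>v vec 1 (\<lambda>_. c)) = A *\<^sub>v z + c \<cdot>\<^sub>v v"
  using append_cols_mult_vec[OF A col_mat_carrier[OF v] z, of "vec 1 (\<lambda>_. c)"] col_mat_mult_vec[OF v]
  by simp

lemma vnorm2_append:
  assumes "y \<in> carrier_vec n1" "z \<in> carrier_vec n2"
  shows "(vnorm2 (y @\<^sub>v z))\<^sup>2 = (vnorm2 y)\<^sup>2 + (vnorm2 z)\<^sup>2"
  unfolding vnorm2_square by (rule scalar_prod_append[OF assms assms])

lemma vnorm2_vec1: "(vnorm2 (vec 1 (\<lambda>_. c)))\<^sup>2 = c\<^sup>2"
  unfolding vnorm2_square by (simp add: scalar_prod_def power2_eq_square)

lemma frobenius_append_col: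
  assumes E: "E \<in> carrier_mat m n" and f: "f \<in> carrier_vec m"
  shows "(frobenius_norm (E @\<^sub>c col_mat f))\<^sup>2 = (\<Sum>i<m. (\<Sum>j<n. (E $$ (i, j))\<^sup>2) + (f $ i)\<^sup>2)"
proof -
  let ?M = "E @\<^sub>c col_mat f"
  note M = append_cols_carrier[OF E col_mat_carrier[OF f]]
  have dims: "dim_row ?M = m" "dim_col ?M = n + 1" using M by auto
  have "(frobenius_norm ?M)\<^sup>2 = (\<Sum>i<m. \<Sum>j<n + 1. (?M $$ (i, j))\<^sup>2)"
    unfolding frobenius_norm_def dims by (simp add: sum_nonneg add_nonneg_nonneg)
  also have "\<dots> = (\<Sum>i<m. (\<Sum>j<n. (E $$ (i, j))\<^sup>2) + (f $ i)\<^sup>2)"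
  proof (rule sum.cong[OF refl])
    fix i assume i: "i \<in> {..<m}"
    have "?M $$ (i, j) = E $$ (i, j)" if "j < n" for j
      using append_cols_index[OF E col_mat_carrier[OF f], of i j] i that by simp
    moreover have "?M $$ (i, n) = f $ i"
      using append_cols_index[OF E col_mat_carrier[OF f], of i n] i f
      by (simp add: col_mat_def mat_of_cols_index)
    ultimately show "(\<Sum>j<n + 1. (?M $$ (i, j))\<^sup>2) = (\<Sum>j<n. (E $$ (i, j))\<^sup>2) + (f $ i)\<^sup>2" by simp
  qed
  finally show ?thesis .
qed

definition residual_quotient :: "nat \<Rightarrow> real mat \<Rightarrow> real vec \<Rightarrow> real vec \<Rightarrow> real" where
  "residual_quotient n2 A b x = (vnorm2 (A *\<^sub>v x - b))\<^sup>2 / (1 + (vnorm2 (vec_last x n2))\<^sup>2)"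

lemma mtls_feasible_iff:
  assumes A1: "A1 \<in> carrier_mat m n1" and A2: "A2 \<in> carrier_mat m n2" and b: "b \<in> carrier_vec m"
  shows "mtls_feasible A1 A2 b E f x \<longleftrightarrow> E \<in> carrier_mat m n2 \<and> f \<in> carrier_vec m \<and>
    x \<in> carrier_vec (n1 + n2) \<and> E *\<^sub>v vec_last x n2 - f = b - (A1 @\<^sub>c A2) *\<^sub>v x"
proof -
  have eq: "A1 *\<^sub>v vec_first x n1 + (A2 + E) *\<^sub>v vec_last x n2 = b + f \<longleftrightarrow>
      E *\<^sub>v vec_last x n2 - f = b - (A1 @\<^sub>c A2) *\<^sub>v x"
    if E: "E \<in> carrier_mat m n2" and f: "f \<in> carrier_vec m" and x: "x \<in> carrier_vec (n1 + n2)"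
  proof -
    let ?y = "vec_first x n1" and ?z = "vec_last x n2"
    have "(A1 @\<^sub>c A2) *\<^sub>v x = A1 *\<^sub>v ?y + A2 *\<^sub>v ?z"
      using append_cols_mult_vec[OF A1 A2, of ?y ?z] x by simp
    moreover have "(A2 + E) *\<^sub>v ?z = A2 *\<^sub>v ?z + E *\<^sub>v ?z"
      by (rule add_mult_distrib_mat_vec[OF A2 E]) auto
    moreover define p q s where "p = A1 *\<^sub>v ?y" and "q = A2 *\<^sub>v ?z" and "s = E *\<^sub>v ?z"
    moreover have "p \<in> carrier_vec m" "q \<in> carrier_vec m" "s \<in> carrier_vec m"
      unfolding p_def q_def s_def using A1 A2 E by (auto intro!: mult_mat_vec_carrier)
    ultimately show ?thesis
      using b f by (auto simp: vec_eq_iff algebra_simps)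
  qed
  show ?thesis unfolding mtls_feasible_def using A1 A2 b eq by auto
qed

text \<open>The constraint says that \<open>[E, f]\<close> maps \<open>(x2, -1)\<close> to \<open>b - A x\<close>, and the Frobenius norm bounds the
amplification of that vector.\<close>

lemma residual_quotient_le_frobenius:
  assumes A1: "A1 \<in> carrier_mat m n1" and A2: "A2 \<in> carrier_mat m n2" and b: "b \<in> carrier_vec m"
    and feas: "mtls_feasible A1 A2 b E f x"
  shows "residual_quotient n2 (A1 @\<^sub>c A2) b x \<le> (frobenius_norm (E @\<^sub>c col_mat f))\<^sup>2"
proof -
  let ?z = "vec_last x n2" and ?M = "E @\<^sub>c col_mat f" and ?A = "A1 @\<^sub>c A2"
  from feas have E: "E \<in> carrier_mat m n2" and f: "f \<in> carrier_vec m"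
    and x: "x \<in> carrier_vec (n1 + n2)" and eq: "E *\<^sub>v ?z - f = b - ?A *\<^sub>v x"
    unfolding mtls_feasible_iff[OF A1 A2 b] by auto
  have M: "?M \<in> carrier_mat m (n2 + 1)" by (rule append_cols_carrier[OF E col_mat_carrier[OF f]])
  have Ax: "?A *\<^sub>v x \<in> carrier_vec m" using append_cols_carrier[OF A1 A2] x by (rule mult_mat_vec_carrier)
  define w where "w = ?z @\<^sub>v vec 1 (\<lambda>_. -1 :: real)"
  have w: "w \<in> carrier_vec (n2 + 1)" unfolding w_def by (intro append_carrier_vec) auto
  have Ez: "E *\<^sub>v ?z \<in> carrier_vec m" using E by (rule mult_mat_vec_carrier) simp
  have "?M *\<^sub>v w = E *\<^sub>v ?z + (-1) \<cdot>\<^sub>v f"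
    unfolding w_def by (rule append_cols_col_mult_vec[OF E f]) simp
  also have "\<dots> = E *\<^sub>v ?z - f" using Ez f by (intro eq_vecI) auto
  also have "\<dots> = b - ?A *\<^sub>v x" by (rule eq)
  finally have "vnorm2 (?M *\<^sub>v w) = norm (embed_vec b - embed_vec (?A *\<^sub>v x))"
    unfolding embed_diff[OF b Ax, symmetric] norm_embed by simp
  also have "\<dots> = vnorm2 (?A *\<^sub>v x - b)"
    unfolding norm_embed[symmetric] embed_diff[OF Ax b] by (rule norm_minus_commute)
  finally have "vnorm2 (?A *\<^sub>v x - b) \<le> frobenius_norm ?M * vnorm2 w"
    using frobenius_norm_bound[OF M w] by simp
  then have "(vnorm2 (?A *\<^sub>v x - b))\<^sup>2 \<le> (frobenius_norm ?M * vnorm2 w)\<^sup>2"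
    by (intro power_mono vnorm2_nonneg)
  also have "\<dots> = (frobenius_norm ?M)\<^sup>2 * (1 + (vnorm2 ?z)\<^sup>2)"
    unfolding power_mult_distrib w_def vnorm2_append[OF vec_last_carrier vec_carrier] vnorm2_vec1 by simp
  finally show ?thesis
    unfolding residual_quotient_def by (simp add: divide_le_eq add_pos_nonneg)
qed

text \<open>The rank-one matrix \<open>[E, f] = - r (x2, -1)^T / (1 + |x2|^2)\<close> with \<open>r = A x - b\<close> is feasible and gives
equality in the bound.\<close>

lemma residual_quotient_attained:
  assumes A1: "A1 \<in> carrier_mat m n1" and A2: "A2 \<in> carrier_mat m n2" and b: "b \<in> carrier_vec m"
    and x: "x \<in> carrier_vec (n1 + n2)"
  shows "\<exists>E f. mtls_feasible A1 A2 b E f x \<and>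
    (frobenius_norm (E @\<^sub>c col_mat f))\<^sup>2 = residual_quotient n2 (A1 @\<^sub>c A2) b x"
proof -
  let ?z = "vec_last x n2" and ?A = "A1 @\<^sub>c A2"
  define r where "r = ?A *\<^sub>v x - b"
  define N where "N = 1 + (vnorm2 ?z)\<^sup>2"
  define E where "E = mat m n2 (\<lambda>(i, j). - (r $ i * ?z $ j / N))"
  define f where "f = (1 / N) \<cdot>\<^sub>v r"
  have Ax: "?A *\<^sub>v x \<in> carrier_vec m" using append_cols_carrier[OF A1 A2] x by (rule mult_mat_vec_carrier)
  have r: "r \<in> carrier_vec m" unfolding r_def using Ax b by simp
  have N: "N > 0" unfolding N_def by (simp add: add_pos_nonneg)
  have zz: "(\<Sum>j<n2. (?z $ j)\<^sup>2) = N - 1"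
    unfolding N_def vnorm2_square by (simp add: scalar_prod_def power2_eq_square atLeast0LessThan)
  have E: "E \<in> carrier_mat m n2" and f: "f \<in> carrier_vec m" unfolding E_def f_def using r by auto
  have "E *\<^sub>v ?z - f = b - ?A *\<^sub>v x"
  proof (rule eq_vecI)
    fix i assume "i < dim_vec (b - ?A *\<^sub>v x)"
    then have i: "i < m" using append_cols_carrier[OF A1 A2] by auto
    have "(E *\<^sub>v ?z) $ i = (\<Sum>j<n2. - (r $ i / N) * (?z $ j)\<^sup>2)"
      using E i unfolding E_def
      by (auto simp: scalar_prod_def atLeast0LessThan power2_eq_square intro!: sum.cong)
    also have "\<dots> = - (r $ i / N) * (N - 1)" unfolding sum_distrib_left[symmetric] zz ..
    finally have "(E *\<^sub>v ?z - f) $ i = - (r $ i / N) * (N - 1) - r $ i / N"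
      using i f r E unfolding f_def by simp
    also have "\<dots> = - r $ i" using N by (simp add: field_simps)
    also have "\<dots> = (b - ?A *\<^sub>v x) $ i" unfolding r_def using i append_cols_carrier[OF A1 A2] b by auto
    finally show "(E *\<^sub>v ?z - f) $ i = (b - ?A *\<^sub>v x) $ i" .
  qed (use E f append_cols_carrier[OF A1 A2] b in auto)
  then have feas: "mtls_feasible A1 A2 b E f x"
    unfolding mtls_feasible_iff[OF A1 A2 b] using E f x by simp
  have "(frobenius_norm (E @\<^sub>c col_mat f))\<^sup>2 = (\<Sum>i<m. (\<Sum>j<n2. (r $ i / N)\<^sup>2 * (?z $ j)\<^sup>2) + (r $ i / N)\<^sup>2)"
    unfolding frobenius_append_col[OF E f]
    by (intro sum.cong refl arg_cong2[where f = plus])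
      (use r in \<open>auto simp: E_def f_def power_mult_distrib power_divide\<close>)
  also have "\<dots> = (\<Sum>i<m. (r $ i)\<^sup>2 * (1 / N))"
    unfolding sum_distrib_left[symmetric] zz using N by (intro sum.cong refl) (simp add: field_simps power2_eq_square)
  also have "\<dots> = (vnorm2 r)\<^sup>2 / N"
    unfolding sum_distrib_right[symmetric] vnorm2_square using r
    by (simp add: scalar_prod_def power2_eq_square atLeast0LessThan)
  finally show ?thesis using feas unfolding residual_quotient_def r_def N_def by blast
qed

lemma mtls_solution_iff:
  assumes A1: "A1 \<in> carrier_mat m n1" and A2: "A2 \<in> carrier_mat m n2" and b: "b \<in> carrier_vec m"
  shows "mtls_solution A1 A2 b x \<longleftrightarrow> x \<in> carrier_vec (n1 + n2) \<and>
    (\<forall>y\<in>carrier_vec (n1 + n2).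
      residual_quotient n2 (A1 @\<^sub>c A2) b x \<le> residual_quotient n2 (A1 @\<^sub>c A2) b y)"
    (is "_ \<longleftrightarrow> _ \<and> (\<forall>y\<in>_. ?q x \<le> ?q y)")
proof
  let ?F = "\<lambda>E f. frobenius_norm (E @\<^sub>c col_mat f)"
  have F: "0 \<le> frobenius_norm M" for M unfolding frobenius_norm_def by (simp add: sum_nonneg)
  note lower = residual_quotient_le_frobenius[OF A1 A2 b]
  note attained = residual_quotient_attained[OF A1 A2 b]
  {
    assume "mtls_solution A1 A2 b x"
    then obtain E f where feas: "mtls_feasible A1 A2 b E f x"
      and opt: "\<And>E' f' x'. mtls_feasible A1 A2 b E' f' x' \<Longrightarrow> ?F E f \<le> ?F E' f'"
      unfolding mtls_solution_def by blast
    have "?q x \<le> ?q y" if y: "y \<in> carrier_vec (n1 + n2)" for y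
    proof -
      obtain E' f' where *: "mtls_feasible A1 A2 b E' f' y" "(?F E' f')\<^sup>2 = ?q y"
        using attained[OF y] by blast
      have "?q x \<le> (?F E f)\<^sup>2" by (rule lower[OF feas])
      also have "\<dots> \<le> (?F E' f')\<^sup>2" by (intro power_mono opt[OF *(1)] F)
      finally show ?thesis unfolding *(2) .
    qed
    then show "x \<in> carrier_vec (n1 + n2) \<and> (\<forall>y\<in>carrier_vec (n1 + n2). ?q x \<le> ?q y)"
      using feas unfolding mtls_feasible_iff[OF A1 A2 b] by blast
  next
    assume R: "x \<in> carrier_vec (n1 + n2) \<and> (\<forall>y\<in>carrier_vec (n1 + n2). ?q x \<le> ?q y)"
    then obtain E f where feas: "mtls_feasible A1 A2 b E f x" "(?F E f)\<^sup>2 = ?q x" using attained by blast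
    have "?F E f \<le> ?F E' f'" if f': "mtls_feasible A1 A2 b E' f' x'" for E' f' x'
    proof -
      have "x' \<in> carrier_vec (n1 + n2)" using f' unfolding mtls_feasible_iff[OF A1 A2 b] by blast
      then have "(?F E f)\<^sup>2 \<le> ?q x'" using R feas(2) by simp
      also have "\<dots> \<le> (?F E' f')\<^sup>2" by (rule lower[OF f'])
      finally show ?thesis by (rule power2_le_imp_le) (rule F)
    qed
    then show "mtls_solution A1 A2 b x" unfolding mtls_solution_def using feas(1) by blast
  }
qed

section \<open>The mixed problem in terms of its triangular factor\<close>

text \<open>Full rank leaves no room for repeated columns, so the columns are distinct and independent.\<close>

lemma full_column_rank_injective:
  fixes A :: "real mat"
  assumes A: "A \<in> carrier_mat m n" and rank: "vec_space.rank m A = n"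
    and v: "v \<in> carrier_vec n" "A *\<^sub>v v = 0\<^sub>v m"
  shows "v = 0\<^sub>v n"
proof (rule ccontr)
  assume "v \<noteq> 0\<^sub>v n"
  interpret vec_space "TYPE(real)" m .
  obtain S where S: "maximal S (\<lambda>T. T \<subseteq> set (cols A) \<and> lin_indpt T)"
    using maximal_exists[of "\<lambda>T. T \<subseteq> set (cols A) \<and> lin_indpt T" "card (set (cols A))" "{}"]
    by (meson List.finite_set card_mono empty_iff empty_subsetI finite_lin_indpt2 rev_finite_subset)
  have "n = card S" using rank_card_indpt[OF A S] rank by simp
  also have "\<dots> \<le> card (set (cols A))" using S unfolding maximal_def by (intro card_mono) auto
  finally have "distinct (cols A)"
    using A card_length[of "cols A"] by (intro card_distinct) auto
  then have "lin_indpt (set (cols A))" "lin_dep (set (cols A))"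
    using full_rank_lin_indpt[OF A rank] lin_depI[OF A v(1) \<open>v \<noteq> 0\<^sub>v n\<close> v(2)] by auto
  then show False by blast
qed

lemma mat_inv_inverse:
  fixes M :: "real mat"
  assumes M: "M \<in> carrier_mat k k" and inj: "\<And>v. v \<in> carrier_vec k \<Longrightarrow> M *\<^sub>v v = 0\<^sub>v k \<Longrightarrow> v = 0\<^sub>v k"
  shows "mat_inv M \<in> carrier_mat k k" "M * mat_inv M = 1\<^sub>m k" "mat_inv M * M = 1\<^sub>m k" "det M \<noteq> 0"
proof -
  show det: "det M \<noteq> 0" using det_0_iff_vec_prod_zero_field[OF M] inj by blast
  then have "M \<in> Units (ring_mat TYPE(real) k ())" by (rule det_non_zero_imp_unit[OF M])
  then obtain B where "mat_inverse M = Some B" using mat_inverse(1)[OF M, of "()"] by (cases "mat_inverse M") auto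
  then show "mat_inv M \<in> carrier_mat k k" "M * mat_inv M = 1\<^sub>m k" "mat_inv M * M = 1\<^sub>m k"
    using mat_inverse(2)[OF M, of B] unfolding mat_inv_def by auto
qed

lemma mat_op_diff_smult:
  assumes M: "M \<in> carrier_mat m n" and N: "N \<in> carrier_mat m n"
  shows "mat_op (M - c \<cdot>\<^sub>m N) u = mat_op M u - c *\<^sub>R mat_op N u"
proof -
  let ?u = "coord_vec n u"
  have "(M - c \<cdot>\<^sub>m N) *\<^sub>v ?u = M *\<^sub>v ?u - (c \<cdot>\<^sub>m N) *\<^sub>v ?u"
    by (rule minus_mult_distrib_mat_vec[OF M]) (use N in auto)
  also have "(c \<cdot>\<^sub>m N) *\<^sub>v ?u = c \<cdot>\<^sub>v (N *\<^sub>v ?u)"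
    using N by (intro eq_vecI) (auto simp: scalar_prod_def sum_distrib_left mult.assoc)
  finally have "embed_vec ((M - c \<cdot>\<^sub>m N) *\<^sub>v ?u) = embed_vec (M *\<^sub>v ?u) - c *\<^sub>R embed_vec (N *\<^sub>v ?u)"
    using embed_diff[of "M *\<^sub>v ?u" m "c \<cdot>\<^sub>v (N *\<^sub>v ?u)"] M N
    by (simp add: embed_smult mult_mat_vec_carrier)
  then show ?thesis unfolding mat_op_def using M N by simp
qed

lemma mat_op_one: "u \<in> coord_space n \<Longrightarrow> mat_op (1\<^sub>m n) u = u"
  unfolding mat_op_def by (simp add: embed_coord)

lemma weight_mat_mult_vec:
  assumes "y \<in> carrier_vec n1" "z \<in> carrier_vec k"
  shows "weight_mat n1 k *\<^sub>v (y @\<^sub>v z) = 0\<^sub>v n1 @\<^sub>v z"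
proof -
  have "weight_mat n1 k *\<^sub>v (y @\<^sub>v z) = (0\<^sub>m n1 n1 *\<^sub>v y + 0\<^sub>m n1 k *\<^sub>v z) @\<^sub>v (0\<^sub>m k n1 *\<^sub>v y + 1\<^sub>m k *\<^sub>v z)"
    unfolding weight_mat_def by (rule four_block_mat_mult_vec) (use assms in auto)
  then show ?thesis using assms by auto
qed

lemma weight_mat_transpose: "(weight_mat n1 k)\<^sup>T = weight_mat n1 k"
  unfolding weight_mat_def by (intro eq_matI) auto

text \<open>Being symmetric and idempotent, the weight matrix acts as an orthogonal projection.\<close>

lemma weight_mat_idem: "weight_mat n1 k * weight_mat n1 k = weight_mat n1 k"
  unfolding weight_mat_def by (subst mult_four_block_mat[of _ n1 n1 _ k _ k _ _ n1 _ k]) auto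

lemma mixed_ls_weight: "mixed_ls (coord_space (n1 + k)) (mat_op (weight_mat n1 k))"
proof
  let ?W = "weight_mat n1 k"
  show "mat_op ?W u \<in> coord_space (n1 + k)" for u by (rule mat_op_in[OF weight_mat_carrier])
  show "inner (mat_op ?W u) v = inner (mat_op ?W u) (mat_op ?W v)" for u v
    using adjoint_pairD(3)[OF mat_op_adjoint[of ?W], of "mat_op ?W u" v]
    unfolding weight_mat_transpose mat_op_mult[OF weight_mat_carrier weight_mat_carrier, symmetric]
      weight_mat_idem .
qed (simp_all add: finite_dim_coord_space linear_add[OF mat_op_linear] linear_cmul[OF mat_op_linear])

lemma norm_weight_embed:
  assumes x: "x \<in> carrier_vec (n1 + k)"
  shows "norm (mat_op (weight_mat n1 k) (embed_vec x)) = vnorm2 (vec_last x k)"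
proof -
  have "weight_mat n1 k *\<^sub>v x = 0\<^sub>v n1 @\<^sub>v vec_last x k"
    using weight_mat_mult_vec[of "vec_first x n1" n1 "vec_last x k" k] x by simp
  then have "(norm (mat_op (weight_mat n1 k) (embed_vec x)))\<^sup>2 = (vnorm2 (vec_last x k))\<^sup>2"
    unfolding mat_op_embed[OF weight_mat_carrier x] norm_embed
    using vnorm2_append[of "0\<^sub>v n1" n1 "vec_last x k" k] by (simp add: vnorm2_def)
  then show ?thesis using vnorm2_nonneg by (simp add: power2_eq_iff_nonneg)
qed

lemma quotient_embed:
  assumes A: "A \<in> carrier_mat m (n1 + k)" and b: "b \<in> carrier_vec m" and x: "x \<in> carrier_vec (n1 + k)"
  shows "mixed_ls.quotient (mat_op (weight_mat n1 k)) (mat_op A) (embed_vec b) (embed_vec x)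
    = residual_quotient k A b x"
proof -
  have "mat_op A (embed_vec x) - embed_vec b = embed_vec (A *\<^sub>v x - b)"
    using embed_diff[of "A *\<^sub>v x" m b] A x b by (simp add: mat_op_embed[OF A x] mult_mat_vec_carrier)
  then show ?thesis
    unfolding mixed_ls.quotient_def[OF mixed_ls_weight] residual_quotient_def
    by (simp add: norm_embed norm_weight_embed[OF x])
qed

lemma mtls_solution_iff_minimizer:
  assumes A1: "A1 \<in> carrier_mat m n1" and A2: "A2 \<in> carrier_mat m n2" and b: "b \<in> carrier_vec m"
  shows "mtls_solution A1 A2 b x \<longleftrightarrow> x \<in> carrier_vec (n1 + n2) \<and>
    mixed_ls.minimizer (coord_space (n1 + n2)) (mat_op (weight_mat n1 n2))
      (mat_op (A1 @\<^sub>c A2)) (embed_vec b) (embed_vec x)"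
proof -
  note A = append_cols_carrier[OF A1 A2]
  have ball: "(\<forall>z\<in>coord_space (n1 + n2). q z) \<longleftrightarrow> (\<forall>y\<in>carrier_vec (n1 + n2). q (embed_vec y))" for q
    unfolding coord_space_def by blast
  show ?thesis
    unfolding mtls_solution_iff[OF A1 A2 b] mixed_ls.minimizer_def[OF mixed_ls_weight] ball
    by (auto simp: quotient_embed[OF A b] embed_in_space)
qed

text \<open>Multiplication by the orthogonal \<open>Q^T\<close> does not change the norm, and the triangular factor separates
the part of the image that the first block of unknowns can cancel from the part that it cannot.\<close>

lemma triangular_norm:
  assumes B: "B \<in> carrier_mat m (n1 + k)" and Q: "Q \<in> carrier_mat m m" "Q\<^sup>T * Q = 1\<^sub>m m"
    and R: "R11 \<in> carrier_mat n1 n1" "R12 \<in> carrier_mat n1 k" "R22 \<in> carrier_mat l k"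
    and QB: "Q\<^sup>T * B = four_block_mat R11 R12 (0\<^sub>m l n1) R22"
    and y: "y \<in> carrier_vec n1" and z: "z \<in> carrier_vec k"
  shows "(vnorm2 (B *\<^sub>v (y @\<^sub>v z)))\<^sup>2 = (vnorm2 (R11 *\<^sub>v y + R12 *\<^sub>v z))\<^sup>2 + (vnorm2 (R22 *\<^sub>v z))\<^sup>2"
proof -
  have v: "y @\<^sub>v z \<in> carrier_vec (n1 + k)" using y z by simp
  have QB_carrier: "Q\<^sup>T * B \<in> carrier_mat m (n1 + k)" using Q B by auto
  have "(vnorm2 (B *\<^sub>v (y @\<^sub>v z)))\<^sup>2 = (vnorm2 ((Q\<^sup>T * B) *\<^sub>v (y @\<^sub>v z)))\<^sup>2"
    unfolding gram_form[OF B v, symmetric] gram_form[OF QB_carrier v, symmetric]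
      gram_orthogonal_mult[OF Q B] ..
  also have "(Q\<^sup>T * B) *\<^sub>v (y @\<^sub>v z) = (R11 *\<^sub>v y + R12 *\<^sub>v z) @\<^sub>v (0\<^sub>m l n1 *\<^sub>v y + R22 *\<^sub>v z)"
    unfolding QB by (rule four_block_mat_mult_vec) (use R y z in auto)
  also have "0\<^sub>m l n1 *\<^sub>v y + R22 *\<^sub>v z = R22 *\<^sub>v z"
    using R(3) y z by (intro eq_vecI) auto
  finally show ?thesis
    using vnorm2_append[of "R11 *\<^sub>v y + R12 *\<^sub>v z" n1 "R22 *\<^sub>v z" l] R y z
    by (simp add: mult_mat_vec_carrier)
qed

lemma symmetric_diff_smult:
  fixes M N :: "real mat"
  assumes M: "M \<in> carrier_mat k k" "M\<^sup>T = M" and N: "N \<in> carrier_mat k k" "N\<^sup>T = N"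
  shows "(M - c \<cdot>\<^sub>m N)\<^sup>T = M - c \<cdot>\<^sub>m N"
proof (rule eq_matI)
  fix i j assume "i < dim_row (M - c \<cdot>\<^sub>m N)" "j < dim_col (M - c \<cdot>\<^sub>m N)"
  then have ij: "i < k" "j < k" using N by auto
  have "M\<^sup>T $$ (i, j) = M $$ (j, i)" "N\<^sup>T $$ (i, j) = N $$ (j, i)" using M(1) N(1) ij by auto
  then show "(M - c \<cdot>\<^sub>m N)\<^sup>T $$ (i, j) = (M - c \<cdot>\<^sub>m N) $$ (i, j)"
    using M N ij by simp
qed (use M N in auto)

text \<open>The data of the mixed problem with its triangular factorization. The disjunction expresses a strict
spectral gap in either of two ways, which are brought together in \<open>R22_gap\<close>.\<close>

locale mtls_qr =
  fixes m n1 n2 :: nat and A1 A2 A Q R11 R12 R22 :: "real mat" and b R1b R2b :: "real vec" and \<sigma> :: real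
  assumes A1: "A1 \<in> carrier_mat m n1" and A2: "A2 \<in> carrier_mat m n2" and A_def: "A = A1 @\<^sub>c A2"
    and b: "b \<in> carrier_vec m"
    and full_column_rank: "vec_space.rank m A = n1 + n2"
    and inconsistent: "\<not> (\<exists>y \<in> carrier_vec (n1 + n2). A *\<^sub>v y = b)"
    and Q: "Q \<in> carrier_mat m m" "Q\<^sup>T * Q = 1\<^sub>m m"
    and R: "R11 \<in> carrier_mat n1 n1" "R12 \<in> carrier_mat n1 n2" "R1b \<in> carrier_vec n1"
      "R22 \<in> carrier_mat (m - n1) n2" "R2b \<in> carrier_vec (m - n1)"
    and QR: "Q\<^sup>T * (A @\<^sub>c col_mat b) =
      four_block_mat R11 (R12 @\<^sub>c col_mat R1b) (0\<^sub>m (m - n1) n1) (R22 @\<^sub>c col_mat R2b)"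
    and \<sigma>: "ereal \<sigma> = sing_val (n2 + 1) (R22 @\<^sub>c col_mat R2b)"
    and generic:
      "sing_val n2 R22 > sing_val (n2 + 1) (R22 @\<^sub>c col_mat R2b) \<or>
       gen_eigval (n1 + n2) (A\<^sup>T * A) (weight_mat n1 n2) >
        gen_eigval (n1 + n2 + 1) ((A @\<^sub>c col_mat b)\<^sup>T * (A @\<^sub>c col_mat b)) (weight_mat n1 (Suc n2))"
begin

abbreviation "Ab \<equiv> A @\<^sub>c col_mat b"
abbreviation "R12b \<equiv> R12 @\<^sub>c col_mat R1b"
abbreviation "R22b \<equiv> R22 @\<^sub>c col_mat R2b"
abbreviation "H \<equiv> A\<^sup>T * A - \<sigma>\<^sup>2 \<cdot>\<^sub>m weight_mat n1 n2"

lemma A: "A \<in> carrier_mat m (n1 + n2)"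
  unfolding A_def by (rule append_cols_carrier[OF A1 A2])

lemma Ab: "Ab \<in> carrier_mat m (n1 + (n2 + 1))"
  using append_cols_carrier[OF A col_mat_carrier[OF b]] by (simp add: add.assoc)

lemma R12b: "R12b \<in> carrier_mat n1 (n2 + 1)" and R22b: "R22b \<in> carrier_mat (m - n1) (n2 + 1)"
  by (intro append_cols_carrier R col_mat_carrier)+

lemma QA: "Q\<^sup>T * A = four_block_mat R11 R12 (0\<^sub>m (m - n1) n1) R22"
proof -
  have dims: "dim_row (four_block_mat R11 R12b (0\<^sub>m (m - n1) n1) R22b) = m"
    using arg_cong[OF QR, of dim_row] Q(1) by simp
  then have m: "n1 + (m - n1) = m" using R R22b by simp
  show ?thesis
  proof (rule eq_matI)
    fix i j assume "i < dim_row (four_block_mat R11 R12 (0\<^sub>m (m - n1) n1) R22)"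
      "j < dim_col (four_block_mat R11 R12 (0\<^sub>m (m - n1) n1) R22)"
    then have ij: "i < m" "j < n1 + n2" using R m by auto
    have col: "col Ab j = col A j"
      using A Ab ij append_cols_index[OF A col_mat_carrier[OF b]]
      by (intro eq_vecI) auto
    have "(Q\<^sup>T * A) $$ (i, j) = (Q\<^sup>T * Ab) $$ (i, j)"
      using Q A Ab ij col by simp
    also have "\<dots> = four_block_mat R11 R12 (0\<^sub>m (m - n1) n1) R22 $$ (i, j)"
      unfolding QR using R R12b R22b ij m
      by (auto simp: append_cols_index[OF R(2) col_mat_carrier[OF R(3)]]
          append_cols_index[OF R(4) col_mat_carrier[OF R(5)]])
    finally show "(Q\<^sup>T * A) $$ (i, j) = four_block_mat R11 R12 (0\<^sub>m (m - n1) n1) R22 $$ (i, j)" .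
  qed (use Q A R m in auto)
qed

lemmas norm_A = triangular_norm[OF A Q R(1,2,4) QA]
lemmas norm_Ab = triangular_norm[OF Ab Q R(1) R12b R22b QR]

lemma A_injective: "v \<in> carrier_vec (n1 + n2) \<Longrightarrow> A *\<^sub>v v = 0\<^sub>v m \<Longrightarrow> v = 0\<^sub>v (n1 + n2)"
  by (rule full_column_rank_injective[OF A full_column_rank])

lemma R11_injective:
  assumes y: "y \<in> carrier_vec n1" and R11y: "R11 *\<^sub>v y = 0\<^sub>v n1"
  shows "y = 0\<^sub>v n1"
proof -
  have R120: "R12 *\<^sub>v 0\<^sub>v n2 = 0\<^sub>v n1" and R220: "R22 *\<^sub>v 0\<^sub>v n2 = 0\<^sub>v (m - n1)"
    using R by auto
  have v: "y @\<^sub>v 0\<^sub>v n2 \<in> carrier_vec (n1 + n2)" using y by simp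
  have "(vnorm2 (A *\<^sub>v (y @\<^sub>v 0\<^sub>v n2)))\<^sup>2 = 0"
    using norm_A[OF y zero_carrier_vec] unfolding R11y R120 R220 by (simp add: vnorm2_def)
  then have "A *\<^sub>v (y @\<^sub>v 0\<^sub>v n2) = 0\<^sub>v m"
    using vnorm2_eq_0[OF mult_mat_vec_carrier[OF A v]] by simp
  then have "y @\<^sub>v 0\<^sub>v n2 = 0\<^sub>v (n1 + n2)" by (rule A_injective[OF v])
  also have "\<dots> = 0\<^sub>v n1 @\<^sub>v 0\<^sub>v n2" by (intro eq_vecI) auto
  finally show ?thesis using append_vec_eq[OF y zero_carrier_vec] by auto
qed

lemma R11_inverse:
  shows "mat_inv R11 \<in> carrier_mat n1 n1" "R11 * mat_inv R11 = 1\<^sub>m n1" "det R11 \<noteq> 0"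
  by (rule mat_inv_inverse[OF R(1)]; rule R11_injective; assumption)+

lemma \<sigma>_root: "\<sigma> = sqrt (roots_desc (char_poly (R22b\<^sup>T * R22b)) ! n2)"
  and \<sigma>_square: "\<sigma>\<^sup>2 = roots_desc (char_poly (R22b\<^sup>T * R22b)) ! n2"
  and \<sigma>_low: "z \<in> carrier_vec (n2 + 1) \<Longrightarrow> \<sigma>\<^sup>2 * (vnorm2 z)\<^sup>2 \<le> (vnorm2 (R22b *\<^sub>v z))\<^sup>2"
  and \<sigma>_attained: "\<exists>z\<in>carrier_vec (n2 + 1). z \<noteq> 0\<^sub>v (n2 + 1) \<and>
    (vnorm2 (R22b *\<^sub>v z))\<^sup>2 = \<sigma>\<^sup>2 * (vnorm2 z)\<^sup>2"
proof -
  note g = gram_least_root[OF R22b, simplified]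
  show r: "\<sigma> = sqrt (roots_desc (char_poly (R22b\<^sup>T * R22b)) ! n2)" using \<sigma> g(4) by simp
  show s: "\<sigma>\<^sup>2 = roots_desc (char_poly (R22b\<^sup>T * R22b)) ! n2" unfolding r using g(1) by simp
  show "z \<in> carrier_vec (n2 + 1) \<Longrightarrow> \<sigma>\<^sup>2 * (vnorm2 z)\<^sup>2 \<le> (vnorm2 (R22b *\<^sub>v z))\<^sup>2"
    unfolding s using g(2) by simp
  show "\<exists>z\<in>carrier_vec (n2 + 1). z \<noteq> 0\<^sub>v (n2 + 1) \<and>
    (vnorm2 (R22b *\<^sub>v z))\<^sup>2 = \<sigma>\<^sup>2 * (vnorm2 z)\<^sup>2"
    unfolding s using g(3) by simp
qed

text \<open>Both genericity conditions imply that the least eigenvalue of \<open>R22^T R22\<close> exceeds \<open>\<sigma>^2\<close>, the first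
directly, the second through the pencils. For \<open>n2 = 0\<close> there is no nonzero \<open>z\<close>.\<close>

lemma R22_gap:
  assumes z: "z \<in> carrier_vec n2" "z \<noteq> 0\<^sub>v n2"
  shows "\<sigma>\<^sup>2 * (vnorm2 z)\<^sup>2 < (vnorm2 (R22 *\<^sub>v z))\<^sup>2"
proof -
  have n2: "0 < n2" using z by (cases n2) auto
  define \<rho> where "\<rho> = roots_desc (char_poly (R22\<^sup>T * R22)) ! (n2 - 1)"
  note g = gram_least_root[OF R(4) n2, folded \<rho>_def]
  have "\<sigma>\<^sup>2 < \<rho>"
    using generic
  proof
    assume "sing_val n2 R22 > sing_val (n2 + 1) R22b"
    then have "\<sigma> < sqrt \<rho>" unfolding g(4) \<sigma>[symmetric] by simp
    moreover have "0 \<le> \<sigma>" unfolding \<sigma>_root using \<sigma>_square by (metis real_sqrt_ge_zero zero_le_power2)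
    ultimately show ?thesis using g(1) by (metis real_sqrt_unique real_sqrt_less_iff real_sqrt_abs abs_of_nonneg)
  next
    assume "gen_eigval (n1 + n2) (A\<^sup>T * A) (weight_mat n1 n2) >
      gen_eigval (n1 + n2 + 1) (Ab\<^sup>T * Ab) (weight_mat n1 (Suc n2))"
    moreover have "gen_eigval (n1 + n2) (A\<^sup>T * A) (weight_mat n1 n2) = ereal \<rho>"
      unfolding \<rho>_def by (rule gen_eigval_triangular[OF A Q R(1,2,4) QA R11_inverse(3) n2])
    moreover have "gen_eigval (n1 + (n2 + 1)) (Ab\<^sup>T * Ab) (weight_mat n1 (n2 + 1)) = ereal (\<sigma>\<^sup>2)"
      using gen_eigval_triangular[OF Ab Q R(1) R12b R22b QR R11_inverse(3)] unfolding \<sigma>_square by simp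
    ultimately show ?thesis by (simp add: add.assoc)
  qed
  moreover have "0 < (vnorm2 z)\<^sup>2" using vnorm2_eq_0[OF z(1)] z(2) by simp
  ultimately have "\<sigma>\<^sup>2 * (vnorm2 z)\<^sup>2 < \<rho> * (vnorm2 z)\<^sup>2" by simp
  also have "\<dots> \<le> (vnorm2 (R22 *\<^sub>v z))\<^sup>2" by (rule g(2)[OF z(1)])
  finally show ?thesis .
qed

lemma residual_as_Ab:
  assumes y: "y \<in> carrier_vec n1" and z: "z \<in> carrier_vec n2"
  shows "A *\<^sub>v (y @\<^sub>v z) - b = Ab *\<^sub>v (y @\<^sub>v (z @\<^sub>v vec 1 (\<lambda>_. -1)))"
proof -
  have v: "y @\<^sub>v z \<in> carrier_vec (n1 + n2)" using y z by simp
  have "Ab *\<^sub>v ((y @\<^sub>v z) @\<^sub>v vec 1 (\<lambda>_. -1)) = A *\<^sub>v (y @\<^sub>v z) + (-1) \<cdot>\<^sub>v b"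
    by (rule append_cols_col_mult_vec[OF A b v])
  also have "\<dots> = A *\<^sub>v (y @\<^sub>v z) - b" using A b by (intro eq_vecI) auto
  also have "(y @\<^sub>v z) @\<^sub>v vec 1 (\<lambda>_. -1) = y @\<^sub>v (z @\<^sub>v vec 1 (\<lambda>_. -1))"
    using y z by (intro eq_vecI) auto
  finally show ?thesis ..
qed

lemma vnorm2_append_minus_one:
  assumes z: "z \<in> carrier_vec n2"
  shows "(vnorm2 (z @\<^sub>v vec 1 (\<lambda>_. -1)))\<^sup>2 = 1 + (vnorm2 z)\<^sup>2"
  using vnorm2_append[OF z vec_carrier] vnorm2_vec1[of "-1"] by simp

lemma residual_low:
  assumes x: "x \<in> carrier_vec (n1 + n2)"
  shows "\<sigma>\<^sup>2 \<le> residual_quotient n2 A b x"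
proof -
  let ?y = "vec_first x n1" and ?z = "vec_last x n2"
  let ?w = "?z @\<^sub>v vec 1 (\<lambda>_. -1 :: real)"
  have w: "?w \<in> carrier_vec (n2 + 1)" by (intro append_carrier_vec) auto
  have "\<sigma>\<^sup>2 * (1 + (vnorm2 ?z)\<^sup>2) = \<sigma>\<^sup>2 * (vnorm2 ?w)\<^sup>2"
    by (simp only: vnorm2_append_minus_one[OF vec_last_carrier])
  also have "\<dots> \<le> (vnorm2 (R22b *\<^sub>v ?w))\<^sup>2" by (rule \<sigma>_low[OF w])
  also have "\<dots> \<le> (vnorm2 (Ab *\<^sub>v (?y @\<^sub>v ?w)))\<^sup>2" unfolding norm_Ab[OF vec_first_carrier w] by simp
  also have "\<dots> = (vnorm2 (A *\<^sub>v x - b))\<^sup>2"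
    using residual_as_Ab[OF vec_first_carrier vec_last_carrier, of x x] x by simp
  finally show ?thesis unfolding residual_quotient_def by (simp add: le_divide_eq add_pos_nonneg)
qed

text \<open>A minimal right singular vector of \<open>[R22, R2b]\<close> is scaled so that its last entry is \<open>-1\<close>, and the first block
of unknowns is chosen to annihilate the upper part of the triangular system.\<close>

lemma residual_attained: "\<exists>x\<in>carrier_vec (n1 + n2). residual_quotient n2 A b x = \<sigma>\<^sup>2"
proof -
  obtain w where w: "w \<in> carrier_vec (n2 + 1)" "w \<noteq> 0\<^sub>v (n2 + 1)"
    "(vnorm2 (R22b *\<^sub>v w))\<^sup>2 = \<sigma>\<^sup>2 * (vnorm2 w)\<^sup>2" using \<sigma>_attained by blast
  define z c where "z = vec_first w n2" and "c = w $ n2"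
  have z: "z \<in> carrier_vec n2" unfolding z_def by simp
  have w_eq: "w = z @\<^sub>v vec 1 (\<lambda>_. c)"
    using w(1) unfolding z_def c_def by (intro eq_vecI) (auto simp: vec_first_def less_Suc_eq)
  \<comment> \<open>if the last entry were zero, \<open>z\<close> would contradict the gap for \<open>R22\<close>\<close>
  have c: "c \<noteq> 0"
  proof
    assume c0: "c = 0"
    have "vec 1 (\<lambda>_. 0) = (0\<^sub>v 1 :: real vec)" by auto
    then have "z \<noteq> 0\<^sub>v n2" using w(2) unfolding w_eq c0 by auto
    moreover have "R22b *\<^sub>v w = R22 *\<^sub>v z"
      unfolding w_eq c0 append_cols_col_mult_vec[OF R(4,5) z] using R z by (intro eq_vecI) auto
    moreover have "(vnorm2 w)\<^sup>2 = (vnorm2 z)\<^sup>2"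
      using vnorm2_append[OF z vec_carrier] vnorm2_vec1[of 0] unfolding w_eq c0 by simp
    ultimately show False using R22_gap[OF z] w(3) by simp
  qed
  define z' where "z' = (- 1 / c) \<cdot>\<^sub>v z"
  define w' where "w' = z' @\<^sub>v vec 1 (\<lambda>_. -1 :: real)"
  have z': "z' \<in> carrier_vec n2" unfolding z'_def using z by simp
  have w'_carrier: "w' \<in> carrier_vec (n2 + 1)" unfolding w'_def by (intro append_carrier_vec z') auto
  have w': "w' = (- 1 / c) \<cdot>\<^sub>v w"
    unfolding w'_def z'_def w_eq using z c by (intro eq_vecI) auto
  have scale: "(vnorm2 (t \<cdot>\<^sub>v u))\<^sup>2 = t\<^sup>2 * (vnorm2 u)\<^sup>2" for t u
    unfolding norm_embed[symmetric] embed_smult by (simp add: power_mult_distrib)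
  have eq: "(vnorm2 (R22b *\<^sub>v w'))\<^sup>2 = \<sigma>\<^sup>2 * (vnorm2 w')\<^sup>2"
    unfolding w' mult_mat_vec[OF R22b w(1)] scale w(3) by simp
  define y where "y = - (mat_inv R11 *\<^sub>v (R12b *\<^sub>v w'))"
  have Rw: "R12b *\<^sub>v w' \<in> carrier_vec n1" by (rule mult_mat_vec_carrier[OF R12b w'_carrier])
  have y: "y \<in> carrier_vec n1" unfolding y_def using R11_inverse(1) Rw by simp
  have "R11 *\<^sub>v y = - (R11 *\<^sub>v (mat_inv R11 *\<^sub>v (R12b *\<^sub>v w')))"
    unfolding y_def using R11_inverse(1) R(1) Rw by (intro eq_vecI) auto
  also have "R11 *\<^sub>v (mat_inv R11 *\<^sub>v (R12b *\<^sub>v w')) = R12b *\<^sub>v w'"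
    using assoc_mult_mat_vec[OF R(1) R11_inverse(1) Rw] Rw unfolding R11_inverse(2) by simp
  finally have "R11 *\<^sub>v y + R12b *\<^sub>v w' = 0\<^sub>v n1" using Rw by (simp add: uminus_l_inv_vec)
  then have "(vnorm2 (Ab *\<^sub>v (y @\<^sub>v w')))\<^sup>2 = \<sigma>\<^sup>2 * (vnorm2 w')\<^sup>2"
    unfolding norm_Ab[OF y w'_carrier] eq by (simp add: vnorm2_def)
  then have "(vnorm2 (A *\<^sub>v (y @\<^sub>v z') - b))\<^sup>2 = \<sigma>\<^sup>2 * (1 + (vnorm2 z')\<^sup>2)"
    unfolding residual_as_Ab[OF y z'] w'_def vnorm2_append_minus_one[OF z'] .
  moreover have "vec_last (y @\<^sub>v z') n2 = z'" using y z' by (intro eq_vecI) (auto simp: vec_last_def)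
  moreover have "0 < 1 + (vnorm2 z')\<^sup>2" by (simp add: add_pos_nonneg)
  ultimately have "residual_quotient n2 A b (y @\<^sub>v z') = \<sigma>\<^sup>2" unfolding residual_quotient_def by simp
  then show ?thesis using y z' by (intro bexI[of _ "y @\<^sub>v z'"]) auto
qed

text \<open>If \<open>v2\<close> vanishes, this is injectivity of \<open>A\<close>; otherwise it is the gap for \<open>R22\<close>.\<close>

lemma weight_norm_less:
  assumes v: "v \<in> carrier_vec (n1 + n2)" "v \<noteq> 0\<^sub>v (n1 + n2)"
  shows "\<sigma>\<^sup>2 * (vnorm2 (vec_last v n2))\<^sup>2 < (vnorm2 (A *\<^sub>v v))\<^sup>2"
proof (cases "vec_last v n2 = 0\<^sub>v n2")
  case True
  have "A *\<^sub>v v \<noteq> 0\<^sub>v m" using A_injective v by blast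
  then have "0 < (vnorm2 (A *\<^sub>v v))\<^sup>2" using vnorm2_eq_0[OF mult_mat_vec_carrier[OF A v(1)]] by simp
  then show ?thesis unfolding True by (simp add: vnorm2_def)
next
  case False
  have "\<sigma>\<^sup>2 * (vnorm2 (vec_last v n2))\<^sup>2 < (vnorm2 (R22 *\<^sub>v vec_last v n2))\<^sup>2"
    by (rule R22_gap[OF vec_last_carrier False])
  also have "\<dots> \<le> (vnorm2 (A *\<^sub>v v))\<^sup>2"
    using norm_A[OF vec_first_carrier vec_last_carrier, of v v] v(1) by simp
  finally show ?thesis .
qed

lemma H_carrier: "H \<in> carrier_mat (n1 + n2) (n1 + n2)"
  using A by (auto intro!: minus_carrier_mat)

lemma mat_op_H: "mat_op H u = mat_op A\<^sup>T (mat_op A u) - \<sigma>\<^sup>2 *\<^sub>R mat_op (weight_mat n1 n2) u"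
proof -
  have AA: "A\<^sup>T * A \<in> carrier_mat (n1 + n2) (n1 + n2)" and At: "A\<^sup>T \<in> carrier_mat (n1 + n2) m" using A by auto
  show ?thesis unfolding mat_op_diff_smult[OF AA weight_mat_carrier] mat_op_mult[OF At A] ..
qed

interpretation W: mixed_ls "coord_space (n1 + n2)" "mat_op (weight_mat n1 n2)"
  by (rule mixed_ls_weight)

lemma H_form: "inner u (mat_op H u) = (norm (mat_op A u))\<^sup>2 - \<sigma>\<^sup>2 * (norm (mat_op (weight_mat n1 n2) u))\<^sup>2"
  unfolding mat_op_H inner_diff_right adjoint_pairD(3)[OF mat_op_adjoint, symmetric] inner_scaleR_right W.inner_W
  by (simp add: power2_norm_eq_inner)

lemma H_positive:
  assumes u: "u \<in> coord_space (n1 + n2)" "u \<noteq> 0"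
  shows "0 < inner u (mat_op H u)"
proof -
  obtain v where v: "v \<in> carrier_vec (n1 + n2)" "u = embed_vec v" using u(1) unfolding coord_space_def by auto
  have "v \<noteq> 0\<^sub>v (n1 + n2)" using u(2) v(2) by (auto simp: embed_zero)
  from weight_norm_less[OF v(1) this] show ?thesis
    unfolding H_form v(2) norm_weight_embed[OF v(1)] mat_op_embed[OF A v(1)] norm_embed by simp
qed

lemma H_injective: "u \<in> coord_space (n1 + n2) \<Longrightarrow> mat_op H u = 0 \<Longrightarrow> u = 0"
  using H_positive[of u] by fastforce

lemma H_coercive: "\<exists>\<alpha>>0. \<forall>v\<in>coord_space (n1 + n2). \<alpha> * (norm v)\<^sup>2 \<le> inner v (mat_op H v)"
proof (rule psd_injective_imp_coercive[OF finite_dim_coord_space mat_op_linear _ _ _ H_injective])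
  show "mat_op H ` coord_space (n1 + n2) \<subseteq> coord_space (n1 + n2)" using mat_op_in[OF H_carrier] by auto
  show "0 \<le> inner u (mat_op H u)" if "u \<in> coord_space (n1 + n2)" for u
    using H_positive[OF that] by (cases "u = 0") auto
  have "H\<^sup>T = H"
  proof -
    have sym: "(A\<^sup>T * A)\<^sup>T = A\<^sup>T * A" using A by (simp add: transpose_mult[of _ _ m])
    have "A\<^sup>T * A \<in> carrier_mat (n1 + n2) (n1 + n2)" using A by auto
    from symmetric_diff_smult[OF this sym weight_mat_carrier weight_mat_transpose]
    show ?thesis .
  qed
  then show "inner u (mat_op H v) = inner (mat_op H u) v" for u v
    using adjoint_pairD(3)[OF mat_op_adjoint[of H], of u v] by simp
qed

lemma H_inverse:
  shows "mat_inv H \<in> carrier_mat (n1 + n2) (n1 + n2)" and "mat_inv H * H = 1\<^sub>m (n1 + n2)"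
proof -
  have inj: "v = 0\<^sub>v (n1 + n2)" if v: "v \<in> carrier_vec (n1 + n2)" "H *\<^sub>v v = 0\<^sub>v (n1 + n2)" for v
  proof -
    have "mat_op H (embed_vec v) = 0" unfolding mat_op_embed[OF H_carrier v(1)] v(2) by (rule embed_zero)
    then have "embed_vec v = 0" by (rule H_injective[OF embed_in_space[OF v(1)]])
    then show ?thesis using embed_inj[OF v(1), of "0\<^sub>v (n1 + n2)"] by (simp add: embed_zero)
  qed
  show "mat_inv H \<in> carrier_mat (n1 + n2) (n1 + n2)" "mat_inv H * H = 1\<^sub>m (n1 + n2)"
    using mat_inv_inverse[OF H_carrier inj] by auto
qed

end

section \<open>The first-order perturbation bound\<close>

lemma spectral_norm_le_frobenius_append:
  assumes E: "E \<in> carrier_mat m n" and f: "f \<in> carrier_vec m"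
  shows "spectral_norm E \<le> frobenius_norm (E @\<^sub>c col_mat f)"
    and "vnorm2 f \<le> frobenius_norm (E @\<^sub>c col_mat f)"
proof -
  let ?F = "frobenius_norm (E @\<^sub>c col_mat f)"
  have F: "0 \<le> frobenius_norm M" for M unfolding frobenius_norm_def by (simp add: sum_nonneg)
  have ff: "(vnorm2 f)\<^sup>2 = (\<Sum>i<m. (f $ i)\<^sup>2)"
    unfolding vnorm2_square using f by (simp add: scalar_prod_def power2_eq_square atLeast0LessThan)
  have EE: "(frobenius_norm E)\<^sup>2 = (\<Sum>i<m. \<Sum>j<n. (E $$ (i, j))\<^sup>2)"
    unfolding frobenius_norm_def using E by (simp add: sum_nonneg)
  have sum: "?F\<^sup>2 = (frobenius_norm E)\<^sup>2 + (vnorm2 f)\<^sup>2"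
    unfolding frobenius_append_col[OF E f] ff EE by (rule sum.distrib)
  have "frobenius_norm E \<le> ?F" by (rule power2_le_imp_le[OF _ F]) (simp add: sum)
  then show "spectral_norm E \<le> ?F" using spectral_norm_le_frobenius[of E] by simp
  show "vnorm2 f \<le> ?F" by (rule power2_le_imp_le[OF _ F]) (simp add: sum)
qed

context mtls_qr
begin

text \<open>The abstract perturbation theorem for the lifted matrices, with \<open>\<epsilon>\<close> the Frobenius norm of the whole perturbation,
which bounds both the spectral norm of \<open>\<Delta>A\<close> and the norm of \<open>\<Delta>b\<close>.\<close>

lemma mtls_perturbation:
  assumes x: "mtls_solution A1 A2 b x"
  defines "P \<equiv> mat_inv H"
  shows "\<exists>\<delta>>0. \<exists>C. \<forall>\<Delta>A1 \<in> carrier_mat m n1. \<forall>\<Delta>A2 \<in> carrier_mat m n2. \<forall>\<Delta>b \<in> carrier_vec m.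
    frobenius_norm ((\<Delta>A1 @\<^sub>c \<Delta>A2) @\<^sub>c col_mat \<Delta>b) < \<delta> \<longrightarrow>
      (\<exists>!xh. mtls_solution (A1 + \<Delta>A1) (A2 + \<Delta>A2) (b + \<Delta>b) xh) \<and>
      (\<forall>xh. mtls_solution (A1 + \<Delta>A1) (A2 + \<Delta>A2) (b + \<Delta>b) xh \<longrightarrow>
        vnorm2 (xh - x) \<le> spectral_norm (P * A\<^sup>T) * vnorm2 \<Delta>b +
          (vnorm2 (A *\<^sub>v x - b) * spectral_norm P + vnorm2 x * spectral_norm (P * A\<^sup>T)) *
            spectral_norm (\<Delta>A1 @\<^sub>c \<Delta>A2) +
          C * (frobenius_norm ((\<Delta>A1 @\<^sub>c \<Delta>A2) @\<^sub>c col_mat \<Delta>b))\<^sup>2)"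
proof -
  let ?X = "coord_space (n1 + n2)" and ?W = "mat_op (weight_mat n1 n2)"
  interpret W: mixed_ls ?X ?W by (rule mixed_ls_weight)
  note iff = mtls_solution_iff_minimizer
  have xc: "x \<in> carrier_vec (n1 + n2)" and xmin: "W.minimizer (mat_op A) (embed_vec b) (embed_vec x)"
    using x unfolding iff[OF A1 A2 b] A_def[symmetric] by auto
  have Ax: "A *\<^sub>v x \<in> carrier_vec m" by (rule mult_mat_vec_carrier[OF A xc])
  have quot: "W.quotient (mat_op A) (embed_vec b) (embed_vec x) = \<sigma>\<^sup>2"
  proof -
    obtain v where "v \<in> carrier_vec (n1 + n2)" "residual_quotient n2 A b v = \<sigma>\<^sup>2" using residual_attained by blast
    moreover have "\<forall>y\<in>carrier_vec (n1 + n2). residual_quotient n2 A b x \<le> residual_quotient n2 A b y"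
      using x unfolding mtls_solution_iff[OF A1 A2 b] A_def[symmetric] by blast
    ultimately have "residual_quotient n2 A b x \<le> \<sigma>\<^sup>2" by metis
    then show ?thesis unfolding quotient_embed[OF A b xc] using residual_low[OF xc] by simp
  qed
  have res: "norm (mat_op A (embed_vec x) - embed_vec b) = vnorm2 (A *\<^sub>v x - b)"
    unfolding mat_op_embed[OF A xc] embed_diff[OF Ax b, symmetric] norm_embed ..
  have \<sigma>_pos: "0 < \<sigma>\<^sup>2"
  proof (rule ccontr)
    assume "\<not> 0 < \<sigma>\<^sup>2"
    then have "\<sigma>\<^sup>2 = 0" by simp
    then have "(vnorm2 (A *\<^sub>v x - b))\<^sup>2 = 0"
      using quot W.gap_quotient[of "mat_op A" "embed_vec b" "embed_vec x"] unfolding W.gap_def res by simp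
    then have "embed_vec (A *\<^sub>v x) - embed_vec b = 0" unfolding embed_diff[OF Ax b, symmetric] norm_embed[symmetric] by simp
    then show False using inconsistent xc embed_inj[OF Ax b] by auto
  qed
  obtain \<alpha> where \<alpha>: "0 < \<alpha>" "\<And>v. v \<in> ?X \<Longrightarrow> \<alpha> * (norm v)\<^sup>2 \<le> inner v (mat_op H v)"
    using H_coercive by auto
  have P: "P \<in> carrier_mat (n1 + n2) (n1 + n2)" "P * H = 1\<^sub>m (n1 + n2)" unfolding P_def by (rule H_inverse)+
  have At: "A\<^sup>T \<in> carrier_mat (n1 + n2) m" using A by simp
  have "\<exists>\<delta>>0. \<exists>C. \<forall>D Dt db \<epsilon> dA.
    adjoint_pair D Dt \<and> (\<forall>u. Dt u \<in> ?X) \<and>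
    (\<forall>u. norm (D u) \<le> dA * norm u) \<and> (\<forall>u. norm (Dt u) \<le> dA * norm u) \<and>
    dA \<le> \<epsilon> \<and> norm db \<le> \<epsilon> \<and> \<epsilon> < \<delta> \<longrightarrow>
      (\<exists>!y. W.minimizer (\<lambda>u. mat_op A u + D u) (embed_vec b + db) y) \<and>
      (\<forall>y. W.minimizer (\<lambda>u. mat_op A u + D u) (embed_vec b + db) y \<longrightarrow>
        norm (y - embed_vec x) \<le> spectral_norm (P * A\<^sup>T) * norm db +
          (norm (mat_op A (embed_vec x) - embed_vec b) * spectral_norm P +
            norm (embed_vec x) * spectral_norm (P * A\<^sup>T)) * dA + C * \<epsilon>\<^sup>2)"
  proof (rule W.minimizer_perturbation[OF mat_op_adjoint mat_op_in[OF At] mat_op_norm mat_op_transpose_norm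
        spectral_norm_nonneg \<alpha>(1) _ xmin quot \<sigma>_pos mat_op_linear _ mat_op_norm _ spectral_norm_nonneg spectral_norm_nonneg])
    show "\<alpha> * (norm v)\<^sup>2 \<le> (norm (mat_op A v))\<^sup>2 - \<sigma>\<^sup>2 * (norm (?W v))\<^sup>2" if "v \<in> ?X" for v
      using \<alpha>(2)[OF that] unfolding H_form .
    show "mat_op P (mat_op A\<^sup>T (mat_op A v) - \<sigma>\<^sup>2 *\<^sub>R ?W v) = v" if "v \<in> ?X" for v
      unfolding mat_op_H[symmetric] mat_op_mult[OF P(1) H_carrier, symmetric] P(2) by (rule mat_op_one[OF that])
    show "norm (mat_op P (mat_op A\<^sup>T u)) \<le> spectral_norm (P * A\<^sup>T) * norm u" for u
      unfolding mat_op_mult[OF P(1) At, symmetric] by (rule mat_op_norm)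
  qed
  then obtain \<delta> C where \<delta>: "0 < \<delta>" and bound: "\<And>D Dt db \<epsilon> dA.
    adjoint_pair D Dt \<and> (\<forall>u. Dt u \<in> ?X) \<and>
    (\<forall>u. norm (D u) \<le> dA * norm u) \<and> (\<forall>u. norm (Dt u) \<le> dA * norm u) \<and>
    dA \<le> \<epsilon> \<and> norm db \<le> \<epsilon> \<and> \<epsilon> < \<delta> \<Longrightarrow>
      (\<exists>!y. W.minimizer (\<lambda>u. mat_op A u + D u) (embed_vec b + db) y) \<and>
      (\<forall>y. W.minimizer (\<lambda>u. mat_op A u + D u) (embed_vec b + db) y \<longrightarrow>
        norm (y - embed_vec x) \<le> spectral_norm (P * A\<^sup>T) * norm db +
          (vnorm2 (A *\<^sub>v x - b) * spectral_norm P + vnorm2 x * spectral_norm (P * A\<^sup>T)) * dA + C * \<epsilon>\<^sup>2)"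
    unfolding res norm_embed by blast
  show ?thesis
  proof (rule exI[of _ \<delta>], intro conjI \<delta>, rule exI[of _ C], intro ballI impI)
    fix \<Delta>A1 \<Delta>A2 :: "real mat" and \<Delta>b :: "real vec"
    assume \<Delta>: "\<Delta>A1 \<in> carrier_mat m n1" "\<Delta>A2 \<in> carrier_mat m n2" "\<Delta>b \<in> carrier_vec m"
    define \<Delta>A where "\<Delta>A = \<Delta>A1 @\<^sub>c \<Delta>A2"
    define \<epsilon> where "\<epsilon> = frobenius_norm (\<Delta>A @\<^sub>c col_mat \<Delta>b)"
    assume small: "frobenius_norm ((\<Delta>A1 @\<^sub>c \<Delta>A2) @\<^sub>c col_mat \<Delta>b) < \<delta>"
    have \<Delta>A: "\<Delta>A \<in> carrier_mat m (n1 + n2)" unfolding \<Delta>A_def by (rule append_cols_carrier[OF \<Delta>(1,2)])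
    have \<Delta>At: "\<Delta>A\<^sup>T \<in> carrier_mat (n1 + n2) m" using \<Delta>A by simp
    have op: "(\<lambda>u. mat_op A u + mat_op \<Delta>A u) = mat_op ((A1 + \<Delta>A1) @\<^sub>c (A2 + \<Delta>A2))"
      unfolding append_cols_add[OF A1 A2 \<Delta>(1,2)] A_def[symmetric] \<Delta>A_def[symmetric]
      by (intro ext mat_op_add[OF A \<Delta>A, symmetric])
    have "A1 + \<Delta>A1 \<in> carrier_mat m n1" "A2 + \<Delta>A2 \<in> carrier_mat m n2" "b + \<Delta>b \<in> carrier_vec m"
      using \<Delta> A1 A2 b by auto
    note sol = iff[OF this, folded op, unfolded embed_add[OF b \<Delta>(3)]]
    have main: "(\<exists>!y. W.minimizer (\<lambda>u. mat_op A u + mat_op \<Delta>A u) (embed_vec b + embed_vec \<Delta>b) y) \<and>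
      (\<forall>y. W.minimizer (\<lambda>u. mat_op A u + mat_op \<Delta>A u) (embed_vec b + embed_vec \<Delta>b) y \<longrightarrow>
        norm (y - embed_vec x) \<le> spectral_norm (P * A\<^sup>T) * norm (embed_vec \<Delta>b) +
          (vnorm2 (A *\<^sub>v x - b) * spectral_norm P + vnorm2 x * spectral_norm (P * A\<^sup>T)) * spectral_norm \<Delta>A
          + C * \<epsilon>\<^sup>2)"
      by (rule bound[of _ "mat_op \<Delta>A\<^sup>T"], intro conjI allI mat_op_adjoint mat_op_in[OF \<Delta>At] mat_op_norm mat_op_transpose_norm)
        (use spectral_norm_le_frobenius_append[OF \<Delta>A \<Delta>(3)] small in \<open>auto simp: \<epsilon>_def norm_embed \<Delta>A_def\<close>)
    show "(\<exists>!xh. mtls_solution (A1 + \<Delta>A1) (A2 + \<Delta>A2) (b + \<Delta>b) xh) \<and>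
      (\<forall>xh. mtls_solution (A1 + \<Delta>A1) (A2 + \<Delta>A2) (b + \<Delta>b) xh \<longrightarrow>
        vnorm2 (xh - x) \<le> spectral_norm (P * A\<^sup>T) * vnorm2 \<Delta>b +
          (vnorm2 (A *\<^sub>v x - b) * spectral_norm P + vnorm2 x * spectral_norm (P * A\<^sup>T)) *
            spectral_norm (\<Delta>A1 @\<^sub>c \<Delta>A2) +
          C * (frobenius_norm ((\<Delta>A1 @\<^sub>c \<Delta>A2) @\<^sub>c col_mat \<Delta>b))\<^sup>2)"
    proof (intro conjI allI impI)
      obtain y where y: "W.minimizer (\<lambda>u. mat_op A u + mat_op \<Delta>A u) (embed_vec b + embed_vec \<Delta>b) y"
        and uniq: "\<And>y'. W.minimizer (\<lambda>u. mat_op A u + mat_op \<Delta>A u) (embed_vec b + embed_vec \<Delta>b) y' \<Longrightarrow> y' = y"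
        using main by blast
      have "y \<in> ?X" using y unfolding W.minimizer_def by simp
      then obtain xh where xh: "xh \<in> carrier_vec (n1 + n2)" "y = embed_vec xh"
        unfolding coord_space_def by auto
      show "\<exists>!xh. mtls_solution (A1 + \<Delta>A1) (A2 + \<Delta>A2) (b + \<Delta>b) xh"
      proof (rule ex1I)
        show "mtls_solution (A1 + \<Delta>A1) (A2 + \<Delta>A2) (b + \<Delta>b) xh" unfolding sol using xh y by simp
        show "x' = xh" if "mtls_solution (A1 + \<Delta>A1) (A2 + \<Delta>A2) (b + \<Delta>b) x'" for x'
          using that uniq[of "embed_vec x'"] xh embed_inj[of x' "n1 + n2" xh] unfolding sol by simp
      qed
    next
      fix xh assume "mtls_solution (A1 + \<Delta>A1) (A2 + \<Delta>A2) (b + \<Delta>b) xh"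
      then have xh: "xh \<in> carrier_vec (n1 + n2)"
        and min: "W.minimizer (\<lambda>u. mat_op A u + mat_op \<Delta>A u) (embed_vec b + embed_vec \<Delta>b) (embed_vec xh)"
        unfolding sol by auto
      from main[THEN conjunct2, rule_format, OF min]
      show "vnorm2 (xh - x) \<le> spectral_norm (P * A\<^sup>T) * vnorm2 \<Delta>b +
          (vnorm2 (A *\<^sub>v x - b) * spectral_norm P + vnorm2 x * spectral_norm (P * A\<^sup>T)) *
            spectral_norm (\<Delta>A1 @\<^sub>c \<Delta>A2) +
          C * (frobenius_norm ((\<Delta>A1 @\<^sub>c \<Delta>A2) @\<^sub>c col_mat \<Delta>b))\<^sup>2"
        unfolding \<epsilon>_def \<Delta>A_def embed_diff[OF xh xc, symmetric] norm_embed .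
    qed
  qed
qed

end

theorem theorem4:
  fixes m n n1 n2 :: nat
    and A1 A2 A :: "real mat" and b x r :: "real vec"
    and Q R11 R12 R22 W P :: "real mat" and R1b R2b :: "real vec"
    and \<sigma> \<kappa>b \<kappa>A :: real
  assumes n: "n = n1 + n2" "n \<le> m"
    and A1: "A1 \<in> carrier_mat m n1" and A2: "A2 \<in> carrier_mat m n2"
    and A: "A = A1 @\<^sub>c A2" and b: "b \<in> carrier_vec m"
    and full_column_rank: "vec_space.rank m A = n"
    and inconsistent: "\<not> (\<exists>y \<in> carrier_vec n. A *\<^sub>v y = b)"
    and Q: "Q \<in> carrier_mat m m" "Q\<^sup>T * Q = 1\<^sub>m m"
    and R: "R11 \<in> carrier_mat n1 n1" "R12 \<in> carrier_mat n1 n2" "R1b \<in> carrier_vec n1"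
      "R22 \<in> carrier_mat (m - n1) n2" "R2b \<in> carrier_vec (m - n1)"
    and QR: "Q\<^sup>T * (A @\<^sub>c col_mat b) =
      four_block_mat R11 (R12 @\<^sub>c col_mat R1b) (0\<^sub>m (m - n1) n1) (R22 @\<^sub>c col_mat R2b)"
    and R_triangular: "upper_triangular_rect (Q\<^sup>T * (A @\<^sub>c col_mat b))"
    and W: "W = diag_block_mat [0\<^sub>m n1 n1, 1\<^sub>m n2]"
    and \<sigma>: "ereal \<sigma> = sing_val (n2 + 1) (R22 @\<^sub>c col_mat R2b)"
    and generic:
      "(sing_val n2 R22 > sing_val (n2 + 1) (R22 @\<^sub>c col_mat R2b) \<and>
        sing_val (n2 + 1) (R22 @\<^sub>c col_mat R2b) > 0) \<or>
       gen_eigval n (A\<^sup>T * A) W >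
        gen_eigval (n + 1) ((A @\<^sub>c col_mat b)\<^sup>T * (A @\<^sub>c col_mat b)) (diag_block_mat [W, 1\<^sub>m 1])"
    and x: "mtls_solution A1 A2 b x" "x \<noteq> 0\<^sub>v n"
    and r: "r = A *\<^sub>v x - b"
    and P: "P = mat_inv (A\<^sup>T * A - \<sigma>\<^sup>2 \<cdot>\<^sub>m W)"
    and \<kappa>b: "\<kappa>b = vnorm2 b / vnorm2 x * spectral_norm (P * A\<^sup>T)"
    and \<kappa>A: "\<kappa>A = spectral_norm A / vnorm2 x *
      (vnorm2 r * spectral_norm P + vnorm2 x * spectral_norm (P * A\<^sup>T))"
  shows "\<exists>\<delta> > 0. \<exists>C. \<forall>\<Delta>A1 \<in> carrier_mat m n1. \<forall>\<Delta>A2 \<in> carrier_mat m n2. \<forall>\<Delta>b \<in> carrier_vec m.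
    frobenius_norm ((\<Delta>A1 @\<^sub>c \<Delta>A2) @\<^sub>c col_mat \<Delta>b) < \<delta> \<longrightarrow>
      (\<exists>!xh. mtls_solution (A1 + \<Delta>A1) (A2 + \<Delta>A2) (b + \<Delta>b) xh) \<and>
      (\<forall>xh. mtls_solution (A1 + \<Delta>A1) (A2 + \<Delta>A2) (b + \<Delta>b) xh \<longrightarrow>
        vnorm2 (xh - x) / vnorm2 x \<le>
          \<kappa>b * (vnorm2 \<Delta>b / vnorm2 b) +
          \<kappa>A * (spectral_norm (\<Delta>A1 @\<^sub>c \<Delta>A2) / spectral_norm A) +
          C * (frobenius_norm ((\<Delta>A1 @\<^sub>c \<Delta>A2) @\<^sub>c col_mat \<Delta>b))\<^sup>2)"
proof -
  have W': "W = weight_mat n1 n2" unfolding W by (rule diag_block_weight)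
  have qr: "mtls_qr m n1 n2 A1 A2 A Q R11 R12 R22 b R1b R2b \<sigma>"
  proof
    show "sing_val n2 R22 > sing_val (n2 + 1) (R22 @\<^sub>c col_mat R2b) \<or>
       gen_eigval (n1 + n2) (A\<^sup>T * A) (weight_mat n1 n2) >
        gen_eigval (n1 + n2 + 1) ((A @\<^sub>c col_mat b)\<^sup>T * (A @\<^sub>c col_mat b)) (weight_mat n1 (Suc n2))"
      using generic unfolding W' diag_block_weight_Suc n(1) by blast
  qed (use A1 A2 A b full_column_rank inconsistent Q R QR \<sigma> n in simp_all)
  interpret mtls_qr m n1 n2 A1 A2 A Q R11 R12 R22 b R1b R2b \<sigma> by (rule qr)
  have PH: "P = mat_inv H" unfolding P W' ..
  obtain \<delta> C where \<delta>: "0 < \<delta>" and main: "\<And>\<Delta>A1 \<Delta>A2 \<Delta>b. \<Delta>A1 \<in> carrier_mat m n1 \<Longrightarrow>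
    \<Delta>A2 \<in> carrier_mat m n2 \<Longrightarrow> \<Delta>b \<in> carrier_vec m \<Longrightarrow>
    frobenius_norm ((\<Delta>A1 @\<^sub>c \<Delta>A2) @\<^sub>c col_mat \<Delta>b) < \<delta> \<Longrightarrow>
      (\<exists>!xh. mtls_solution (A1 + \<Delta>A1) (A2 + \<Delta>A2) (b + \<Delta>b) xh) \<and>
      (\<forall>xh. mtls_solution (A1 + \<Delta>A1) (A2 + \<Delta>A2) (b + \<Delta>b) xh \<longrightarrow>
        vnorm2 (xh - x) \<le> spectral_norm (P * A\<^sup>T) * vnorm2 \<Delta>b +
          (vnorm2 r * spectral_norm P + vnorm2 x * spectral_norm (P * A\<^sup>T)) *
            spectral_norm (\<Delta>A1 @\<^sub>c \<Delta>A2) +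
          C * (frobenius_norm ((\<Delta>A1 @\<^sub>c \<Delta>A2) @\<^sub>c col_mat \<Delta>b))\<^sup>2)"
    using mtls_perturbation[OF x(1)] unfolding PH[symmetric] r[symmetric] by blast
  have xc: "x \<in> carrier_vec (n1 + n2)" using x(1) unfolding mtls_solution_iff[OF A1 A2 b] by blast
  have x_pos: "0 < vnorm2 x"
    using vnorm2_eq_0[OF xc] vnorm2_nonneg[of x] x(2) n(1) by (simp add: order_less_le)
  have b_pos: "0 < vnorm2 b"
  proof -
    have "A *\<^sub>v 0\<^sub>v (n1 + n2) = 0\<^sub>v m" using mtls_qr.A[OF qr] by auto
    then have "b \<noteq> 0\<^sub>v m" using inconsistent n(1) by (metis zero_carrier_vec)
    then show ?thesis using vnorm2_eq_0[OF b] vnorm2_nonneg[of b] by (simp add: order_less_le)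
  qed
  have A_pos: "0 < spectral_norm A"
  proof -
    have "A *\<^sub>v x \<noteq> 0\<^sub>v m" using A_injective[OF xc] x(2) n(1) by auto
    then have "0 < vnorm2 (A *\<^sub>v x)"
      using vnorm2_eq_0[OF mult_mat_vec_carrier[OF mtls_qr.A[OF qr] xc]] vnorm2_nonneg[of "A *\<^sub>v x"]
      by (simp add: order_less_le)
    also have "\<dots> \<le> spectral_norm A * vnorm2 x" by (rule spectral_norm_bound[OF mtls_qr.A[OF qr] xc])
    finally show ?thesis using x_pos by (simp add: zero_less_mult_iff)
  qed
  show ?thesis
  proof (rule exI[of _ \<delta>], intro conjI \<delta>, rule exI[of _ "C / vnorm2 x"], intro ballI impI)
    fix \<Delta>A1 \<Delta>A2 :: "real mat" and \<Delta>b :: "real vec"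
    assume "\<Delta>A1 \<in> carrier_mat m n1" "\<Delta>A2 \<in> carrier_mat m n2" "\<Delta>b \<in> carrier_vec m"
      "frobenius_norm ((\<Delta>A1 @\<^sub>c \<Delta>A2) @\<^sub>c col_mat \<Delta>b) < \<delta>"
    note main = main[OF this]
    show "(\<exists>!xh. mtls_solution (A1 + \<Delta>A1) (A2 + \<Delta>A2) (b + \<Delta>b) xh) \<and>
      (\<forall>xh. mtls_solution (A1 + \<Delta>A1) (A2 + \<Delta>A2) (b + \<Delta>b) xh \<longrightarrow>
        vnorm2 (xh - x) / vnorm2 x \<le>
          \<kappa>b * (vnorm2 \<Delta>b / vnorm2 b) +
          \<kappa>A * (spectral_norm (\<Delta>A1 @\<^sub>c \<Delta>A2) / spectral_norm A) +
          C / vnorm2 x * (frobenius_norm ((\<Delta>A1 @\<^sub>c \<Delta>A2) @\<^sub>c col_mat \<Delta>b))\<^sup>2)"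
    proof (intro conjI allI impI)
      show "\<exists>!xh. mtls_solution (A1 + \<Delta>A1) (A2 + \<Delta>A2) (b + \<Delta>b) xh" using main by blast
      fix xh assume "mtls_solution (A1 + \<Delta>A1) (A2 + \<Delta>A2) (b + \<Delta>b) xh"
      then have "vnorm2 (xh - x) / vnorm2 x \<le> (spectral_norm (P * A\<^sup>T) * vnorm2 \<Delta>b +
          (vnorm2 r * spectral_norm P + vnorm2 x * spectral_norm (P * A\<^sup>T)) *
            spectral_norm (\<Delta>A1 @\<^sub>c \<Delta>A2) +
          C * (frobenius_norm ((\<Delta>A1 @\<^sub>c \<Delta>A2) @\<^sub>c col_mat \<Delta>b))\<^sup>2) / vnorm2 x"
        using main x_pos by (intro divide_right_mono) auto
      also have "\<dots> = \<kappa>b * (vnorm2 \<Delta>b / vnorm2 b) +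
          \<kappa>A * (spectral_norm (\<Delta>A1 @\<^sub>c \<Delta>A2) / spectral_norm A) +
          C / vnorm2 x * (frobenius_norm ((\<Delta>A1 @\<^sub>c \<Delta>A2) @\<^sub>c col_mat \<Delta>b))\<^sup>2"
        unfolding \<kappa>b \<kappa>A using b_pos A_pos by (simp add: add_divide_distrib)
      finally show "vnorm2 (xh - x) / vnorm2 x \<le>
          \<kappa>b * (vnorm2 \<Delta>b / vnorm2 b) +
          \<kappa>A * (spectral_norm (\<Delta>A1 @\<^sub>c \<Delta>A2) / spectral_norm A) +
          C / vnorm2 x * (frobenius_norm ((\<Delta>A1 @\<^sub>c \<Delta>A2) @\<^sub>c col_mat \<Delta>b))\<^sup>2" .
    qed
  qed
qed

end
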